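(* Let $\Omega\subset\mathbb{R}^2$ be open and bounded, let $K\subset\{(x,y)\in\mathbb{R}^2:0<x\le y\}$ be compact, $E=\{\xi\in\mathbb{R}^{2\times2}:(\lambda_1(\xi),\lambda_2(\xi))\in K\}$, let $\xi\in\operatorname{int}E^{rc}$ and let $\varphi:\Omega\to\mathbb{R}^2$ be affine with $D\varphi=\xi$ in $\Omega$. Then there exists $u\in\varphi+W^{1,\infty}_0(\Omega,\mathbb{R}^2)$ with $Du\in E$ a.e. in $\Omega$.
   Context: $\lambda_1(\xi)\le\lambda_2(\xi)$ are the singular values of $\xi$. For compact $E$, $E^{rc}=\{\eta: f(\eta)\le0$ for every rank one convex $f:\mathbb{R}^{2\times2}\to\mathbb{R}$ with $f|_E\le0\}$, where rank one convex means convex along segments $[\xi,\eta]$ with $\operatorname{rank}(\xi-\eta)=1$. *)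

theory Defs
  imports "HOL-Analysis.Analysis"
begin

definition singular_values :: "real^2^2 \<Rightarrow> real set" where
  "singular_values xi = {s. 0 \<le> s \<and> (\<exists>v::real^2. v \<noteq> 0 \<and> (transpose xi ** xi) *v v = (s^2) *s v)}"

text \<open>lambda_1 \<le> lambda_2, counted with multiplicity (if only one distinct singular value
  exists, it has multiplicity two and both coincide).\<close>
definition sv1 :: "real^2^2 \<Rightarrow> real" where
  "sv1 xi = Min (singular_values xi)"

definition sv2 :: "real^2^2 \<Rightarrow> real" where
  "sv2 xi = Max (singular_values xi)"

definition rank_one_convex :: "(real^2^2 \<Rightarrow> real) \<Rightarrow> bool" where
  "rank_one_convex f \<longleftrightarrow>
     (\<forall>xi eta t. rank (xi - eta) = 1 \<and> 0 \<le> t \<and> t \<le> 1 \<longrightarrow>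
        f ((1 - t) *\<^sub>R xi + t *\<^sub>R eta) \<le> (1 - t) * f xi + t * f eta)"

definition rc_hull :: "(real^2^2) set \<Rightarrow> (real^2^2) set" where
  "rc_hull E = {eta. \<forall>f. rank_one_convex f \<and> (\<forall>x\<in>E. f x \<le> 0) \<longrightarrow> f eta \<le> 0}"

end

theory Submission
  imports Defs
begin

text \<open>Write \<open>A v = z v + w (cnj v)\<close> in complex notation, so that \<open>det A = |z|\<^sup>2 - |w|\<^sup>2\<close>
  and the singular values are \<open>||z| - |w||\<close> and \<open>|z| + |w|\<close>; rank-one directions are those with
  \<open>|z| = |w|\<close>. The functions \<open>det + 2 \<theta> |w|\<close> and \<open>- det + 2 \<theta> |z|\<close>
  are rank-one convex, and they show that every interior point of the hull lies in
  the open set \<open>U\<close> of matrices with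
  \<open>\<lambda>\<^sub>1 \<lambda>\<^sub>2 + \<theta> (\<lambda>\<^sub>2 - \<lambda>\<^sub>1) < max\<^sub>K (a b + \<theta> (b - a))\<close> for all
  \<open>0 \<le> \<theta> \<le> max b\<close>.

  Each matrix of \<open>U\<close> at distance at least \<open>\<epsilon>\<close> from \<open>E\<close> is the midpoint of a rank-one
  segment in \<open>U\<close> whose length depends on \<open>\<epsilon>\<close> only: choose \<open>\<theta>\<close> minimizing the gap in the
  inequality above and move along the rank-one line on which the corresponding function is constant.

  Oscillating along these segments on small squares yields piecewise affine maps \<open>u\<^sub>j\<close> whose gradients form
  a bounded martingale. It converges almost everywhere, and the energy gained at every step forces the limit into
  \<open>E\<close>. The steps have gradients of size \<open>\<rho>\<^sub>j\<close> tending to 0 and amplitudes far below the scale on which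
  \<open>u\<^sub>j\<close> is affine; hence at almost every point the limit map is differentiable with the limit of
  the gradients as its derivative, and Rademacher's theorem is not needed.\<close>

section \<open>Tents on a tiling by squares\<close>

text \<open>Put \<open>Z = |z|\<close>, \<open>m = |w|\<close>. For nonnegative determinant,
  \<open>Z^2 - m^2\<close> is the product of the singular values and \<open>2 m\<close> their
  difference. The inequalities of \<open>U\<close> thus say that the line in \<theta> with intercept
  the determinant and slope \<open>2 m\<close> runs strictly below the convex function
  \<open>max (a b + \<theta> (b - a))\<close> over \<open>K\<close>. At the \<theta> of least gap,
  endpoints aside, maximizers exist with slope \<open>b - a\<close> on both sides of
  \<open>2 m\<close>. If the gap is small and some maximizer has slope close to \<open>2 m\<close>,
  the matrix is close to \<open>E\<close>. So away from \<open>E\<close> either the gap is large or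
  the slopes are well separated, and both leave room for a segment of definite length. Two demands
  on the step sizes conflict: differentiability of the limit wants \<open>\<rho> j\<close> to tend
  to 0, while the energy argument wants the sum of the squares to diverge, since the length
  available near a given limit gradient is not known beforehand. The Lipschitz constant must not
  grow with the steps. It does not, because every difference quotient of a correction is itself an
  increment that keeps the gradient in the bounded set \<open>U\<close>.\<close>

lemma infnorm_squares_in_open:
  fixes S :: "(real^2) set"
  assumes "open S" "bounded S" "0 < \<sigma>"
  obtains D where "finite D" "\<And>c s. (c, s) \<in> D \<Longrightarrow> 0 < s \<and> s \<le> \<sigma> \<and> {x. infnorm (x - c) \<le> s} \<subseteq> S"
    "\<And>c s c' s'. (c, s) \<in> D \<Longrightarrow> (c', s') \<in> D \<Longrightarrow> (c, s) \<noteq> (c', s') \<Longrightarrow>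
       {x. infnorm (x - c) < s} \<inter> {x. infnorm (x - c') < s'} = {}"
    "measure lebesgue S \<le> 2 * measure lebesgue (\<Union>(c, s)\<in>D. {x. infnorm (x - c) \<le> s})"
proof -
  obtain a :: "real^2" where a: "S \<subseteq> cbox (-a) a" using bounded_subset_cbox_symmetric[OF \<open>bounded S\<close>] .
  \<comment> \<open>Equal sides turn the dyadic cells of the covering lemma into squares; the 1
    keeps the box nonempty.\<close>
  define k where "k = max 1 (max \<bar>a$1\<bar> \<bar>a$2\<bar>)"
  define b :: "real^2" where "b = (\<chi> i. k)"
  have k: "0 < k" by (simp add: k_def)
  have "cbox (-a) a \<subseteq> cbox (-b) b"
    by (auto simp: subset_iff mem_box_cart forall_2 b_def k_def abs_le_iff max_def)
  with a have Sb: "S \<subseteq> cbox (-b) b" by blast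
  have ne: "box (-b) b \<noteq> {}"
    using k by (auto simp: b_def box_ne_empty Basis_vec_def inner_axis)
  \<comment> \<open>At points of \<open>S\<close> the gauge forces a cell into \<open>S\<close> and
    into a ball of radius \<sigma>. The tags lie in \<open>S\<close>, so the radius chosen elsewhere
    is arbitrary.\<close>
  define g where "g x = (if x \<in> S then ball x \<sigma> \<inter> S else ball x 1)" for x
  have gauge: "gauge g"
    using assms by (auto simp: g_def gauge_def open_Int)
  obtain \<D> where \<D>: "countable \<D>" "\<And>K. K \<in> \<D> \<Longrightarrow> interior K \<noteq> {} \<and> (\<exists>c d. K = cbox c d)"
    "pairwise (\<lambda>A B. interior A \<inter> interior B = {}) \<D>"
    "\<And>K. K \<in> \<D> \<Longrightarrow> \<exists>x \<in> S \<inter> K. K \<subseteq> g x"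
    "\<And>u v. cbox u v \<in> \<D> \<Longrightarrow> \<exists>n. \<forall>i \<in> Basis. v \<bullet> i - u \<bullet> i = (b \<bullet> i - (-b) \<bullet> i) / 2^n"
    "S \<subseteq> \<Union>\<D>"
    using covering_lemma[OF Sb ne gauge] by metis
  have KS: "K \<subseteq> S" if "K \<in> \<D>" for K
    using \<D>(4)[OF that] by (auto simp: g_def)
  then have US: "\<Union>\<D> = S" using \<D>(6) by blast
  have sq: "\<exists>c s. K = {x. infnorm (x - c) \<le> s} \<and> interior K = {x. infnorm (x - c) < s} \<and> 0 < s \<and> s \<le> \<sigma>"
    if K: "K \<in> \<D>" for K
  proof -
    obtain u v where uv: "K = cbox u v" using \<D>(2)[OF K] by blast
    obtain n where n: "\<forall>i \<in> Basis. v \<bullet> i - u \<bullet> i = (b \<bullet> i - (-b) \<bullet> i) / 2^n" using \<D>(5) K uv by blast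
    have ax: "axis 1 1 \<in> (Basis :: (real^2) set)" "axis 2 1 \<in> (Basis :: (real^2) set)"
      by (auto simp: axis_in_Basis_iff)
    define s where "s = k / 2 ^ n"
    define c where "c = u + (\<chi> i. s)"
    have vu: "v $ 1 = u $ 1 + 2 * s" "v $ 2 = u $ 2 + 2 * s"
      using n[rule_format, OF ax(1)] n[rule_format, OF ax(2)]
      by (auto simp: inner_axis b_def s_def)
    have s: "0 < s" using k by (simp add: s_def)
    have eq: "K = {x. infnorm (x - c) \<le> s}" "interior K = {x. infnorm (x - c) < s}"
      unfolding uv interior_cbox by (auto simp: mem_box_cart forall_2 infnorm_2 c_def vu abs_le_iff abs_less_iff)
    obtain x where x: "x \<in> S \<inter> K" "K \<subseteq> g x" using \<D>(4)[OF K] by blast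
    then have Kx: "K \<subseteq> ball x \<sigma>" by (auto simp: g_def)
    \<comment> \<open>\<open>p s\<close> and \<open>p (-s)\<close> are midpoints of opposite sides;
      both lie in a ball of radius \<sigma>, which bounds \<open>s\<close>.\<close>
    define p where "p t = c + t *\<^sub>R axis 1 1" for t :: real
    have "infnorm (p t - c) \<le> s" if "\<bar>t\<bar> \<le> s" for t
      using that s by (simp add: p_def infnorm_2 axis_def)
    then have "p s \<in> K" "p (-s) \<in> K" using s eq(1) by auto
    then have "p s \<in> ball x \<sigma>" "p (-s) \<in> ball x \<sigma>" using Kx by blast+
    then have "dist (p s) (p (-s)) < 2 * \<sigma>"
      using dist_triangle2[of "p s" "p (-s)" x] by (simp add: dist_commute)
    moreover have "p s - p (-s) = (2 * s) *\<^sub>R axis 1 1"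
      by (simp add: p_def algebra_simps scaleR_2[symmetric])
    ultimately have "s \<le> \<sigma>" using s by (simp add: dist_norm)
    with eq s show ?thesis by blast
  qed
  have lm: "K \<in> lmeasurable" if "K \<in> \<D>" for K using \<D>(2)[OF that] by auto
  have Slm: "S \<in> lmeasurable" using assms by (simp add: bounded_set_imp_lmeasurable borel_open)
  \<comment> \<open>Finitely many cells already carry half of the measure. Finiteness makes the
    tents a maximum and the union of the squares closed; the rest of \<open>S\<close> is left
    flat.\<close>
  obtain \<D>' where \<D>': "\<D>' \<subseteq> \<D>" "finite \<D>'" "measure lebesgue S \<le> 2 * measure lebesgue (\<Union>\<D>')"
  proof (cases "measure lebesgue S = 0")
    case True then show ?thesis using that[of "{}"] by simp
  next
    case False
    then have "0 < measure lebesgue S / 2" by (simp add: zero_less_measure_iff)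
    moreover have "measure lebesgue (\<Union>D') \<le> measure lebesgue S" if "D' \<subseteq> \<D>" "finite D'" for D'
      using that lm KS by (intro measure_mono_fmeasurable Slm) (auto intro!: sets.finite_Union)
    ultimately obtain D' where "D' \<subseteq> \<D>" "finite D'"
      "measure lebesgue (\<Union>\<D>) - measure lebesgue S / 2 < measure lebesgue (\<Union>D')"
      using measure_countable_Union_approachable[OF \<D>(1) _ lm] by metis
    then show ?thesis using that[of D'] US by simp
  qed
  obtain c s where cs: "K \<in> \<D> \<Longrightarrow> K = {x. infnorm (x - c K) \<le> s K} \<and>
      interior K = {x. infnorm (x - c K) < s K} \<and> 0 < s K \<and> s K \<le> \<sigma>" for K
    using sq by metis
  show thesis
  proof (rule that[of "(\<lambda>K. (c K, s K)) ` \<D>'"])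
    show "finite ((\<lambda>K. (c K, s K)) ` \<D>')" using \<D>' by simp
    show "0 < t \<and> t \<le> \<sigma> \<and> {x. infnorm (x - d) \<le> t} \<subseteq> S" if dt: "(d, t) \<in> (\<lambda>K. (c K, s K)) ` \<D>'" for d t
    proof -
      from dt obtain K where K: "K \<in> \<D>" "d = c K" "t = s K" using \<D>'(1) by blast
      then show ?thesis using cs[OF K(1)] KS[OF K(1)] by simp
    qed
    show "{x. infnorm (x - d) < t} \<inter> {x. infnorm (x - d') < t'} = {}"
      if dt: "(d, t) \<in> (\<lambda>K. (c K, s K)) ` \<D>'" "(d', t') \<in> (\<lambda>K. (c K, s K)) ` \<D>'" "(d, t) \<noteq> (d', t')" for d t d' t'
    proof -
      from dt obtain K K' where K: "K \<in> \<D>" "d = c K" "t = s K" "K' \<in> \<D>" "d' = c K'" "t' = s K'"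
        using \<D>'(1) by blast
      with dt have "K \<noteq> K'" by auto
      then show ?thesis using cs[OF K(1)] cs[OF K(4)] K \<D>(3) unfolding pairwise_def by metis
    qed
    have "\<Union>\<D>' = (\<Union>(d, t)\<in>(\<lambda>K. (c K, s K)) ` \<D>'. {x. infnorm (x - d) \<le> t})"
      using cs \<D>'(1) by fastforce
    then show "measure lebesgue S \<le> 2 * measure lebesgue (\<Union>(d, t)\<in>(\<lambda>K. (c K, s K)) ` \<D>'. {x. infnorm (x - d) \<le> t})"
      using \<D>'(3) by simp
  qed
qed

section \<open>The four triangles of a square\<close>

definition perp :: "real^2 \<Rightarrow> real^2" where
  "perp v = vector [- v$2, v$1]"

lemma perp_nth [simp]: "perp v $ 1 = - v $ 2" "perp v $ 2 = v $ 1"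
  by (simp_all add: perp_def)

lemma inner_2: "(x::real^2) \<bullet> y = x$1 * y$1 + x$2 * y$2"
  by (simp add: inner_vec_def UNIV_2)

definition axes :: "(real^2) set" where
  "axes = {axis 1 1, axis 2 1, - axis 1 1, - axis 2 1}"

lemma finite_axes [simp]: "finite axes" by (simp add: axes_def)

lemma axis_nth_2 [simp]: "axis 1 (1::real) $ (1::2) = 1" "axis 1 (1::real) $ (2::2) = 0"
  "axis 2 (1::real) $ (1::2) = 0" "axis 2 (1::real) $ (2::2) = 1"
  by (simp_all add: axis_def)

lemma perp_axes: "perp (axis 1 1) = axis 2 1" "perp (axis 2 1) = - axis 1 1"
  "perp (- axis 1 1) = - axis 2 1" "perp (- axis 2 1) = axis 1 1"
  by (simp_all add: vec_eq_iff forall_2)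

text \<open>For \<open>d\<close> in \<open>axes\<close> this is the open quarter of a square,
  between the diagonals and facing the side in direction \<open>d\<close>; on it
  \<open>infnorm (x - c)\<close> is linear with gradient \<open>d\<close>.\<close>

definition tri :: "real^2 \<Rightarrow> (real^2) \<Rightarrow> real \<Rightarrow> (real^2) set" where
  "tri d c s = {x. \<bar>(x - c) \<bullet> perp d\<bar> < (x - c) \<bullet> d \<and> (x - c) \<bullet> d < s}"

lemma open_tri: "open (tri d c s)"
  unfolding tri_def by (intro open_Collect_conj open_Collect_less continuous_intros)

lemma tri_infnorm:
  assumes "d \<in> axes" "x \<in> tri d c s"
  shows "infnorm (x - c) = (x - c) \<bullet> d" "infnorm (x - c) < s"
  using assms by (auto simp: axes_def tri_def infnorm_2 inner_2)

lemma tri_subset_square: "d \<in> axes \<Longrightarrow> tri d c s \<subseteq> {x. infnorm (x - c) < s}"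
  using tri_infnorm by auto

lemma tri_disjoint:
  assumes "d \<in> axes" "d' \<in> axes" "x \<in> tri d c s" "x \<in> tri d' c s'"
  shows "d = d'"
  using assms by (auto simp: axes_def tri_def inner_2)

lemma lmeasurable_tri: "d \<in> axes \<Longrightarrow> tri d c s \<in> lmeasurable"
proof (rule bounded_set_imp_lmeasurable)
  assume "d \<in> axes"
  then have "tri d c s \<subseteq> cbox (c - (\<chi> i. s)) (c + (\<chi> i. s))"
    using tri_subset_square[of d c s]
    by (fastforce simp: mem_box_cart forall_2 infnorm_2 abs_less_iff)
  then show "bounded (tri d c s)" using bounded_cbox bounded_subset by blast
qed (simp add: open_tri)

text \<open>A quarter turn about \<open>c\<close> carries one triangle to the next and has
  determinant 1.\<close>

lemma measure_tri_perp:
  assumes "d \<in> axes"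
  shows "measure lebesgue (tri (perp d) c s) = measure lebesgue (tri d c s)"
proof -
  have lin: "linear perp" by (rule linearI) (simp_all add: vec_eq_iff forall_2)
  have det: "det (matrix perp) = 1" by (simp add: det_2 matrix_def)
  have tr: "tri d c s = (+) c ` tri d 0 s" for d c
  proof (rule set_eqI)
    fix x show "x \<in> tri d c s \<longleftrightarrow> x \<in> (+) c ` tri d 0 s"
      by (auto simp: tri_def image_iff intro!: exI[of _ "x - c"])
  qed
  have "tri (perp d) 0 s = perp ` tri d 0 s"
  proof (rule set_eqI)
    fix x
    have "x = perp (- perp x)" by (simp add: vec_eq_iff forall_2)
    moreover have "x \<in> tri (perp d) 0 s \<longleftrightarrow> - perp x \<in> tri d 0 s"
      by (auto simp: tri_def inner_2 algebra_simps)
    moreover have "- perp (perp y) = y" for y by (simp add: vec_eq_iff forall_2)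
    ultimately show "x \<in> tri (perp d) 0 s \<longleftrightarrow> x \<in> perp ` tri d 0 s"
      by (auto simp: tri_def inner_2)
  qed
  moreover have "measure lebesgue (perp ` tri d 0 s) = \<bar>det (matrix perp)\<bar> * measure lebesgue (tri d 0 s)"
    by (rule measure_linear_image[OF lin lmeasurable_tri[OF assms]])
  ultimately have "measure lebesgue (tri (perp d) 0 s) = measure lebesgue (tri d 0 s)"
    using det by simp
  then show ?thesis
    unfolding tr[of d c] tr[of "perp d" c] by (simp add: measure_translation)
qed

lemma measure_tri_eq:
  assumes "d \<in> axes" "d' \<in> axes"
  shows "measure lebesgue (tri d c s) = measure lebesgue (tri d' c s)"
proof -
  have "measure lebesgue (tri d c s) = measure lebesgue (tri (axis 1 1) c s)" if "d \<in> axes" for d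
    using that measure_tri_perp[of "axis 1 1" c s] measure_tri_perp[of "axis 2 1" c s]
      measure_tri_perp[of "- axis 1 1" c s] measure_tri_perp[of "- axis 2 1" c s]
    by (auto simp: axes_def perp_axes)
  then show ?thesis using assms by metis
qed

lemma negligible_square_minus_tri:
  "negligible ({x. infnorm (x - c) \<le> s} - (\<Union>d\<in>axes. tri d c s))"
proof -
  \<comment> \<open>What remains lies on six lines: four carrying the sides and two carrying the
    diagonals.\<close>
  have "{x. infnorm (x - c) \<le> s} - (\<Union>d\<in>axes. tri d c s) \<subseteq>
     {x. axis 1 1 \<bullet> x = c$1 + s} \<union> {x. axis 1 1 \<bullet> x = c$1 - s} \<union>
     {x. axis 2 1 \<bullet> x = c$2 + s} \<union> {x. axis 2 1 \<bullet> x = c$2 - s} \<union>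
     {x. vector [1, 1] \<bullet> x = c$1 + c$2} \<union> {x. vector [1, -1] \<bullet> x = c$1 - c$2}" (is "_ \<subseteq> ?H")
  proof (intro subsetI, elim DiffE CollectE)
    fix x assume x: "infnorm (x - c) \<le> s" and n: "x \<notin> (\<Union>d\<in>axes. tri d c s)"
    define u v where "u = x$1 - c$1" and "v = x$2 - c$2"
    have "\<bar>u\<bar> \<le> s" "\<bar>v\<bar> \<le> s" using x by (simp_all add: u_def v_def infnorm_2)
    moreover have "\<not> (\<bar>v\<bar> < u \<and> u < s)" "\<not> (\<bar>u\<bar> < v \<and> v < s)"
      "\<not> (\<bar>v\<bar> < - u \<and> - u < s)" "\<not> (\<bar>u\<bar> < - v \<and> - v < s)"
      using n by (simp_all add: axes_def tri_def inner_2 u_def v_def)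
    ultimately have "u = s \<or> u = - s \<or> v = s \<or> v = - s \<or> u + v = 0 \<or> u = v"
      by linarith
    then show "x \<in> ?H" by (auto simp: inner_2 u_def v_def)
  qed
  moreover have "axis 1 1 \<noteq> (0::real^2)" "axis 2 1 \<noteq> (0::real^2)" "vector [1, 1] \<noteq> (0::real^2)"
    "vector [1, -1] \<noteq> (0::real^2)"
    by (auto simp: vec_eq_iff forall_2)
  ultimately show ?thesis
    by (elim negligible_subset[rotated]) (intro negligible_Un negligible_hyperplane disjI1)
qed

lemma card_axes: "card axes = 4"
proof -
  have "axis 1 1 \<noteq> (axis 2 1 :: real^2)" "axis 1 1 \<noteq> (- axis 1 1 :: real^2)" "axis 1 1 \<noteq> (- axis 2 1 :: real^2)"
    "axis 2 1 \<noteq> (- axis 1 1 :: real^2)" "axis 2 1 \<noteq> (- axis 2 1 :: real^2)" "- axis 1 1 \<noteq> (- axis 2 1 :: real^2)"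
    by (auto simp: vec_eq_iff forall_2)
  then show ?thesis by (simp add: axes_def)
qed

lemma uminus_axes: "d \<in> axes \<Longrightarrow> - d \<in> axes"
  by (auto simp: axes_def)

lemma continuous_on_infnorm_2: "continuous_on A (\<lambda>x::real^2. infnorm (x - c))"
  unfolding infnorm_2 by (intro continuous_intros)

text \<open>\<open>W\<close> is the maximum of 0 and finitely many square pyramids with disjoint
  bases; \<open>T d\<close> is where its gradient is \<open>d\<close>. The factor 8 is 2, for the
  part of \<open>S\<close> that the squares may miss, times 4 triangles of equal measure in each
  square.\<close>

lemma scalar_tents:
  fixes S :: "(real^2) set"
  assumes "open S" "bounded S" "0 < \<sigma>"
  obtains W :: "real^2 \<Rightarrow> real" and T :: "real^2 \<Rightarrow> (real^2) set" and L
  where "closed L" "L \<subseteq> S" "\<And>x. x \<notin> L \<Longrightarrow> W x = 0" "\<And>x. \<bar>W x\<bar> \<le> \<sigma>"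
    "\<And>x y. \<bar>W y - W x\<bar> \<le> infnorm (y - x)"
    "\<And>d. d \<in> insert 0 axes \<Longrightarrow> open (T d)" "\<And>d. d \<in> insert 0 axes \<Longrightarrow> T d \<subseteq> S"
    "\<And>d d' x. d \<in> insert 0 axes \<Longrightarrow> d' \<in> insert 0 axes \<Longrightarrow> x \<in> T d \<Longrightarrow> x \<in> T d' \<Longrightarrow> d = d'"
    "\<And>d x. d \<in> insert 0 axes \<Longrightarrow> x \<in> T d \<Longrightarrow> (W has_derivative (\<lambda>h. h \<bullet> d)) (at x)"
    "negligible (S - \<Union>(T ` insert 0 axes))"
    "\<And>d d'. d \<in> axes \<Longrightarrow> d' \<in> axes \<Longrightarrow> measure lebesgue (T d) = measure lebesgue (T d')"
    "\<And>d. d \<in> axes \<Longrightarrow> measure lebesgue S \<le> 8 * measure lebesgue (T d)"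
proof -
  obtain D where D: "finite D"
    "\<And>c s. (c, s) \<in> D \<Longrightarrow> 0 < s \<and> s \<le> \<sigma> \<and> {x. infnorm (x - c) \<le> s} \<subseteq> S"
    "\<And>c s c' s'. (c, s) \<in> D \<Longrightarrow> (c', s') \<in> D \<Longrightarrow> (c, s) \<noteq> (c', s') \<Longrightarrow>
       {x. infnorm (x - c) < s} \<inter> {x. infnorm (x - c') < s'} = {}"
    "measure lebesgue S \<le> 2 * measure lebesgue (\<Union>(c, s)\<in>D. {x. infnorm (x - c) \<le> s})"
    using infnorm_squares_in_open[OF assms] by metis
  define W where "W x = Max (insert 0 ((\<lambda>(c, s). s - infnorm (x - c)) ` D))" for x :: "real^2"
  define L where "L = (\<Union>(c, s)\<in>D. {x. infnorm (x - c) \<le> s})"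
  \<comment> \<open>A pyramid descends outwards, so the gradient \<open>d\<close> occurs on the
    triangles facing \<open>- d\<close>.\<close>
  define T where "T d = (if d = 0 then S - L else \<Union>(c, s)\<in>D. tri (- d) c s)" for d
  have [simp]: "0 \<notin> axes" by (auto simp: axes_def vec_eq_iff forall_2)
  have T0: "T 0 = S - L" and Td: "d \<in> axes \<Longrightarrow> T d = (\<Union>(c, s)\<in>D. tri (- d) c s)" for d
    by (auto simp: T_def)
  have L: "closed L"
    unfolding L_def using D(1)
    by (intro closed_UN) (auto intro!: closed_Collect_le continuous_on_infnorm_2 continuous_intros)
  have LS: "L \<subseteq> S" unfolding L_def using D(2) by blast
  have W0: "W x = 0" if "x \<notin> L" for x
    unfolding W_def using that D(1) by (intro Max_eqI) (auto simp: L_def not_le less_imp_le)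
  \<comment> \<open>Inside the open base of one pyramid all other terms are nonpositive, the open
    bases being disjoint.\<close>
  have Wsq: "W x = s - infnorm (x - c)" if "(c, s) \<in> D" "infnorm (x - c) < s" for x c s
    unfolding W_def
  proof (rule Max_eqI)
    fix y assume "y \<in> insert 0 ((\<lambda>(c, s). s - infnorm (x - c)) ` D)"
    then consider "y = 0" | c' s' where "(c', s') \<in> D" "y = s' - infnorm (x - c')" by auto
    then show "y \<le> s - infnorm (x - c)"
    proof cases
      case 2
      then show ?thesis using D(3)[OF that(1) 2(1)] that(2)
        by (cases "(c, s) = (c', s')") (auto simp: disjoint_iff not_less)
    qed (use that in simp)
  qed (use that D(1) in \<open>auto simp: image_iff intro!: bexI[of _ "(c, s)"]\<close>)
  have W: "0 \<le> W x" "W x \<le> \<sigma>" "W y \<le> W x + infnorm (y - x)" for x y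
  proof -
    show 0: "0 \<le> W x" for x unfolding W_def using D(1) by (intro Max_ge) auto
    have "s - infnorm (x - c) \<le> \<sigma>" if "(c, s) \<in> D" for c s
      using D(2)[OF that] infnorm_pos_le[of "x - c"] by linarith
    then show "W x \<le> \<sigma>" unfolding W_def using D(1) assms(3) by (intro Max.boundedI) auto
    have "s - infnorm (y - c) \<le> W x + infnorm (y - x)" if "(c, s) \<in> D" for c s
    proof -
      have "s - infnorm (x - c) \<le> W x" unfolding W_def using D(1) that by (intro Max_ge) force+
      moreover have "infnorm (x - c) \<le> infnorm (x - y) + infnorm (y - c)"
        using infnorm_triangle[of "x - y" "y - c"] by simp
      ultimately show ?thesis by (simp add: infnorm_sub)
    qed
    moreover have "0 \<le> W x + infnorm (y - x)" using 0[of x] infnorm_pos_le[of "y - x"] by linarith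
    ultimately show "W y \<le> W x + infnorm (y - x)"
      unfolding W_def[of y] using D(1) by (intro Max.boundedI) auto
  qed
  have triL: "tri d c s \<subseteq> L" if "d \<in> axes" "(c, s) \<in> D" for d c s
    using tri_subset_square[OF that(1), of c s] UN_upper[OF that(2), of "\<lambda>(c, s). {x. infnorm (x - c) \<le> s}"]
    unfolding L_def by force
  have oT: "open (T d)" if "d \<in> insert 0 axes" for d
    using assms(1) L by (auto simp: T_def open_Diff open_tri)
  have TS: "T d \<subseteq> S" if "d \<in> insert 0 axes" for d
    using that triL[OF uminus_axes] LS by (fastforce simp: T0 Td)
  have Tdisj: "d = d'" if "d \<in> insert 0 axes" "d' \<in> insert 0 axes" "x \<in> T d" "x \<in> T d'" for d d' x
  proof -
    have "T d \<subseteq> L" if "d \<in> axes" for d using triL[OF uminus_axes[OF that]] by (auto simp: Td[OF that])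
    moreover have "d = d'" if d: "d \<in> axes" "d' \<in> axes" "x \<in> T d" "x \<in> T d'" for d d'
    proof -
      obtain c s c' s' where cs: "(c, s) \<in> D" "x \<in> tri (- d) c s" "(c', s') \<in> D" "x \<in> tri (- d') c' s'"
        using d by (auto simp: Td)
      then have "infnorm (x - c) < s" "infnorm (x - c') < s'" using d tri_infnorm uminus_axes by blast+
      then have "(c, s) = (c', s')" using D(3)[OF cs(1,3)] by auto
      then have "- d = - d'" using cs d tri_disjoint[OF uminus_axes uminus_axes] by auto
      then show ?thesis by simp
    qed
    ultimately show ?thesis using that by (auto simp: T0; blast)
  qed
  have der: "(W has_derivative (\<lambda>h. h \<bullet> d)) (at x)" if "d \<in> insert 0 axes" "x \<in> T d" for d x
  proof (cases "d = 0")
    case True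
    have "((\<lambda>x. 0) has_derivative (\<lambda>h. h \<bullet> d)) (at x)" using True by simp
    then show ?thesis
      by (rule has_derivative_transform_within_open[of _ _ _ _ "T d"]) (use that oT[OF that(1)] W0 True T0 in auto)
  next
    case False
    with that have d: "d \<in> axes" by auto
    then obtain c s where cs: "(c, s) \<in> D" "x \<in> tri (- d) c s"
      using \<open>x \<in> T d\<close> by (auto simp: Td)
    have "((\<lambda>x. s - (x - c) \<bullet> (- d)) has_derivative (\<lambda>h. h \<bullet> d)) (at x)"
      by (auto intro!: derivative_eq_intros)
    then show ?thesis
    proof (rule has_derivative_transform_within_open[OF _ open_tri cs(2)])
      fix y assume y: "y \<in> tri (- d) c s"
      show "s - (y - c) \<bullet> (- d) = W y"
        using tri_infnorm[OF uminus_axes[OF d] y] Wsq[OF cs(1), of y] by simp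
    qed
  qed
  have sub: "L - \<Union>(T ` axes) \<subseteq> (\<Union>(c, s)\<in>D. {x. infnorm (x - c) \<le> s} - (\<Union>d\<in>axes. tri d c s))"
  proof
    fix x assume x: "x \<in> L - \<Union>(T ` axes)"
    then obtain c s where cs: "(c, s) \<in> D" "infnorm (x - c) \<le> s" by (auto simp: L_def)
    have "x \<notin> tri d c s" if "d \<in> axes" for d
      using x cs uminus_axes[OF that] Td[OF uminus_axes[OF that]] by auto
    with cs show "x \<in> (\<Union>(c, s)\<in>D. {x. infnorm (x - c) \<le> s} - (\<Union>d\<in>axes. tri d c s))" by auto
  qed
  have negL: "negligible (L - \<Union>(T ` axes))"
    by (rule negligible_subset[OF _ sub])
       (use D(1) negligible_square_minus_tri in \<open>auto intro!: negligible_Union\<close>)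
  have neg: "negligible (S - \<Union>(T ` insert 0 axes))"
    by (rule negligible_subset[OF negL]) (auto simp: T0)
  have mT: "measure lebesgue (T d) = (\<Sum>(c, s)\<in>D. measure lebesgue (tri (- d) c s))" if "d \<in> axes" for d
  proof -
    have "measure lebesgue (\<Union>p\<in>D. tri (- d) (fst p) (snd p)) = (\<Sum>p\<in>D. measure lebesgue (tri (- d) (fst p) (snd p)))"
    proof (rule measure_finite_Union[OF D(1)])
      show "(\<lambda>p. tri (- d) (fst p) (snd p)) ` D \<subseteq> sets lebesgue"
        using open_tri by auto
      show "disjoint_family_on (\<lambda>p. tri (- d) (fst p) (snd p)) D"
        unfolding disjoint_family_on_def
      proof (intro ballI impI)
        fix p q assume "p \<in> D" "q \<in> D" "p \<noteq> q"
        then have "{x. infnorm (x - fst p) < snd p} \<inter> {x. infnorm (x - fst q) < snd q} = {}"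
          by (intro D(3)) auto
        moreover have "tri (- d) (fst p) (snd p) \<subseteq> {x. infnorm (x - fst p) < snd p}" for p
          by (rule tri_subset_square[OF uminus_axes[OF that]])
        ultimately show "tri (- d) (fst p) (snd p) \<inter> tri (- d) (fst q) (snd q) = {}" by blast
      qed
      show "emeasure lebesgue (tri (- d) (fst p) (snd p)) \<noteq> \<infinity>" if "p \<in> D" for p
        using lmeasurable_tri[OF uminus_axes[OF \<open>d \<in> axes\<close>]] by (metis fmeasurableD2 infinity_ennreal_def)
    qed
    then show ?thesis by (simp add: Td[OF that] case_prod_unfold)
  qed
  have meq: "measure lebesgue (T d) = measure lebesgue (T d')" if "d \<in> axes" "d' \<in> axes" for d d'
    unfolding mT[OF that(1)] mT[OF that(2)]
    by (intro sum.cong refl) (clarify, rule measure_tri_eq[OF uminus_axes uminus_axes, OF that])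
  have Tlm: "T d \<in> lmeasurable" if "d \<in> insert 0 axes" for d
    using bounded_subset[OF assms(2) TS[OF that]] oT[OF that]
    by (simp add: bounded_set_imp_lmeasurable borel_open)
  have mS: "measure lebesgue S \<le> 8 * measure lebesgue (T d)" if "d \<in> axes" for d
  proof -
    have Llm: "L \<in> lmeasurable"
      using bounded_subset[OF assms(2) LS] L by (simp add: bounded_set_imp_lmeasurable borel_closed)
    have Ulm: "\<Union>(T ` axes) \<in> lmeasurable" using Tlm by (intro fmeasurable.finite_UN) auto
    have Dlm: "L - \<Union>(T ` axes) \<in> lmeasurable" using negL negligible_imp_measurable by blast
    have "measure lebesgue L \<le> measure lebesgue (\<Union>(T ` axes) \<union> (L - \<Union>(T ` axes)))"
      using Ulm Dlm Llm by (intro measure_mono_fmeasurable fmeasurable.Un) (auto simp: fmeasurableD)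
    also have "\<dots> \<le> measure lebesgue (\<Union>(T ` axes)) + measure lebesgue (L - \<Union>(T ` axes))"
      using Ulm Dlm by (intro measure_Un_le) (auto simp: fmeasurableD)
    also have "measure lebesgue (L - \<Union>(T ` axes)) = 0" using negL negligible_imp_measure0 by blast
    also have "measure lebesgue (\<Union>(T ` axes)) \<le> (\<Sum>d\<in>axes. measure lebesgue (T d))"
      using Tlm by (intro measure_UNION_le) (auto simp: fmeasurableD)
    also have "\<dots> = (\<Sum>d'\<in>axes. measure lebesgue (T d))"
      using meq[OF _ that] by (intro sum.cong refl)
    also have "\<dots> = 4 * measure lebesgue (T d)" by (simp add: card_axes)
    finally show ?thesis using D(4) unfolding L_def by linarith
  qed
  show thesis
  proof (rule that[of L W T])
    show "\<bar>W y - W x\<bar> \<le> infnorm (y - x)" for x y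
      using W(3)[of x y] W(3)[of y x] by (simp add: infnorm_sub abs_le_iff)
    show "\<bar>W x\<bar> \<le> \<sigma>" for x using W(1,2)[of x] by simp
  qed (fact L LS W0 oT TS Tdisj der neg meq mS)+
qed

section \<open>Oscillation in a rank-one direction\<close>

definition outer :: "real^2 \<Rightarrow> real^2 \<Rightarrow> real^2^2" where
  "outer a n = (\<chi> i j. a $ i * n $ j)"

lemma outer_mult_vec: "outer a n *v h = (n \<bullet> h) *\<^sub>R a"
  by (simp add: vec_eq_iff forall_2 outer_def matrix_vector_mult_def UNIV_2 inner_2 algebra_simps)

lemma outer_zero [simp]: "outer a 0 = 0" "outer 0 n = 0"
  by (simp_all add: vec_eq_iff outer_def)

lemma outer_scaleR: "outer a (r *\<^sub>R n) = r *\<^sub>R outer a n" "outer (r *\<^sub>R a) n = r *\<^sub>R outer a n"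
  by (simp_all add: vec_eq_iff outer_def)

lemma outer_minus_right: "outer a (- n) = - outer a n"
  by (simp add: vec_eq_iff outer_def)

lemma norm_real_2: "norm (v :: real^2) = sqrt ((v$1)\<^sup>2 + (v$2)\<^sup>2)"
  by (simp add: norm_vec_def L2_set_def UNIV_2)

lemma norm_outer: "norm (outer a n) = norm a * norm n"
proof -
  have "norm (outer a n) = sqrt (\<Sum>i\<in>UNIV. (norm (outer a n $ i))\<^sup>2)"
    by (simp add: norm_vec_def L2_set_def)
  also have "outer a n $ i = a $ i *\<^sub>R n" for i by (simp add: vec_eq_iff outer_def)
  then have "(\<Sum>i\<in>UNIV. (norm (outer a n $ i))\<^sup>2) = (\<Sum>i\<in>UNIV. (a $ i)\<^sup>2) * (norm n)\<^sup>2"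
    by (simp add: power_mult_distrib sum_distrib_right)
  also have "sqrt \<dots> = norm a * norm n"
    by (simp add: real_sqrt_mult norm_vec_def L2_set_def sum_nonneg)
  finally show ?thesis .
qed

lemma norm_perp [simp]: "norm (perp e) = norm e"
  by (simp add: norm_real_2 add.commute)

lemma unit_expand:
  assumes "norm e = 1"
  shows "(x \<bullet> e) *\<^sub>R e + (x \<bullet> perp e) *\<^sub>R perp e = x"
proof -
  have "(e$1)\<^sup>2 + (e$2)\<^sup>2 = 1" using assms by (simp add: norm_real_2)
  then have "x$1 * ((e$1)\<^sup>2 + (e$2)\<^sup>2) = x$1" "x$2 * ((e$1)\<^sup>2 + (e$2)\<^sup>2) = x$2" by simp_all
  then show ?thesis
    by (simp add: vec_eq_iff forall_2 inner_2 power2_eq_square algebra_simps)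
qed

text \<open>The gradients \<open>\<plusminus> \<eta>\<close> in the direction \<open>perp e\<close> are the price for vanishing boundary values:
  the tents stand on rectangles with sides parallel to \<open>e\<close> and \<open>perp e\<close> and aspect ratio \<open>\<eta>\<close>.\<close>

lemma rank_one_oscillation:
  fixes S :: "(real^2) set" and a e :: "real^2"
  assumes S: "open S" "bounded S" and "norm e = 1" "0 < \<eta>" "0 < \<sigma>"
  obtains w :: "real^2 \<Rightarrow> real^2" and Z :: "real^2 \<Rightarrow> real^2^2" and \<T> L
  where "closed L" "L \<subseteq> S" "\<And>x. x \<notin> L \<Longrightarrow> w x = 0" "\<And>x. norm (w x) \<le> \<sigma>"
    "\<And>x y. \<exists>\<tau>. \<bar>\<tau>\<bar> \<le> 1 \<and> (w y - w x = outer a (\<tau> *\<^sub>R e) *v (y - x) \<or>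
                        w y - w x = outer a ((\<tau> * \<eta>) *\<^sub>R perp e) *v (y - x))"
    "finite \<T>" "\<And>T. T \<in> \<T> \<Longrightarrow> open T" "\<And>T. T \<in> \<T> \<Longrightarrow> T \<subseteq> S"
    "\<And>T T' x. T \<in> \<T> \<Longrightarrow> T' \<in> \<T> \<Longrightarrow> x \<in> T \<Longrightarrow> x \<in> T' \<Longrightarrow> T = T'"
    "negligible (S - \<Union>\<T>)"
    "\<And>T x y. T \<in> \<T> \<Longrightarrow> x \<in> T \<Longrightarrow> y \<in> T \<Longrightarrow> Z x = Z y"
    "\<And>x. x \<in> \<Union>\<T> \<Longrightarrow> (w has_derivative (*v) (Z x)) (at x)"
    "\<And>x. \<exists>\<tau>. \<bar>\<tau>\<bar> \<le> 1 \<and> (Z x = outer a (\<tau> *\<^sub>R e) \<or> Z x = outer a ((\<tau> * \<eta>) *\<^sub>R perp e))"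
    "\<And>x. x \<notin> S \<Longrightarrow> Z x = 0" "Z \<in> borel_measurable borel"
    "integrable lebesgue Z" "(LINT x|lebesgue. Z x) = 0"
    "(norm a)\<^sup>2 * measure lebesgue S \<le> 4 * (LINT x|lebesgue. (norm (Z x))\<^sup>2)"
proof -
  \<comment> \<open>\<open>G\<close> takes coordinates along \<open>e\<close> and
    \<open>perp e\<close>, the second one scaled by \<eta>, and \<open>F\<close> inverts it.
    Composition with \<open>G\<close> turns a tent gradient \<open>d\<close> into
    \<open>d$1 e + \<eta> d$2 perp e\<close>.\<close>
  define F where "F v = (v$1) *\<^sub>R e + (v$2 / \<eta>) *\<^sub>R perp e" for v :: "real^2"
  define G where "G x = (vector [x \<bullet> e, \<eta> * (x \<bullet> perp e)] :: real^2)" for x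
  have G_nth: "G x $ 1 = x \<bullet> e" "G x $ 2 = \<eta> * (x \<bullet> perp e)" for x by (simp_all add: G_def)
  have ee: "(e$1)\<^sup>2 + (e$2)\<^sup>2 = 1" using assms(3) by (simp add: norm_real_2)
  have eie: "e \<bullet> e = 1" "perp e \<bullet> perp e = 1" "e \<bullet> perp e = 0" "perp e \<bullet> e = 0"
    using ee by (simp_all add: inner_2 power2_eq_square algebra_simps)
  have linF: "linear F" by (rule linearI) (auto simp: F_def algebra_simps add_divide_distrib)
  have linG: "linear G"
    by (rule linearI) (auto simp: vec_eq_iff forall_2 G_nth inner_add_left algebra_simps)
  have FG: "F (G x) = x" for x
    using unit_expand[OF assms(3), of x] \<open>0 < \<eta>\<close> by (simp add: F_def G_nth)
  have GF: "G (F v) = v" for v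
    using \<open>0 < \<eta>\<close> by (simp add: vec_eq_iff forall_2 G_nth F_def inner_add_left eie)
  have contG: "continuous_on A G" for A by (rule linear_continuous_on) (simp add: linG linear_conv_bounded_linear[symmetric])
  have contF: "continuous_on A F" for A by (rule linear_continuous_on) (simp add: linF linear_conv_bounded_linear[symmetric])
  have vimG: "G -` A = F ` A" for A using FG GF by (auto simp: image_iff) metis+
  have vimF: "F -` A = G ` A" for A using FG GF by (auto simp: image_iff) metis+
  have openG: "open (G -` A)" if "open A" for A
    using contG[of UNIV] that by (simp add: open_vimage)
  have "open (F -` S)" using contF[of UNIV] S by (simp add: open_vimage)
  have "bounded (F -` S)"
    unfolding vimF using S linG by (intro bounded_linear_image) (auto simp: linear_conv_bounded_linear[symmetric])
  \<comment> \<open>The \<open>+ 1\<close> covers \<open>a = 0\<close>, the case used later for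
    gradients that stay fixed.\<close>
  have \<sigma>: "0 < \<sigma> / (norm a + 1)" using \<open>0 < \<sigma>\<close> by (simp add: add_nonneg_pos)
  obtain W T L where W: "closed L" "L \<subseteq> F -` S" "\<And>x. x \<notin> L \<Longrightarrow> W x = 0" "\<And>x. \<bar>W x\<bar> \<le> \<sigma> / (norm a + 1)"
    "\<And>x y. \<bar>W y - W x\<bar> \<le> infnorm (y - x)"
    "\<And>d. d \<in> insert 0 axes \<Longrightarrow> open (T d)" "\<And>d. d \<in> insert 0 axes \<Longrightarrow> T d \<subseteq> F -` S"
    "\<And>d d' x. d \<in> insert 0 axes \<Longrightarrow> d' \<in> insert 0 axes \<Longrightarrow> x \<in> T d \<Longrightarrow> x \<in> T d' \<Longrightarrow> d = d'"
    "\<And>d x. d \<in> insert 0 axes \<Longrightarrow> x \<in> T d \<Longrightarrow> (W has_derivative (\<lambda>h. h \<bullet> d)) (at x)"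
    "negligible (F -` S - \<Union>(T ` insert 0 axes))"
    "\<And>d d'. d \<in> axes \<Longrightarrow> d' \<in> axes \<Longrightarrow> measure lebesgue (T d) = measure lebesgue (T d')"
    "\<And>d. d \<in> axes \<Longrightarrow> measure lebesgue (F -` S) \<le> 8 * measure lebesgue (T d)"
    by (rule scalar_tents[OF \<open>open (F -` S)\<close> \<open>bounded (F -` S)\<close> \<sigma>]) blast
  define w where "w x = W (G x) *\<^sub>R a" for x
  define D where "D d = outer a (d$1 *\<^sub>R e + (\<eta> * d$2) *\<^sub>R perp e)" for d :: "real^2"
  define T' where "T' d = G -` T d" for d
  define Z where "Z x = (\<Sum>d\<in>axes. indicator (T' d) x *\<^sub>R D d)" for x
  have D0: "D 0 = 0" by (simp add: D_def)
  have ax0: "0 \<notin> axes" by (auto simp: axes_def vec_eq_iff forall_2)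
  have T'S: "T' d \<subseteq> S" if "d \<in> insert 0 axes" for d
    using W(7)[OF that] FG by (fastforce simp: T'_def)
  have oT': "open (T' d)" if "d \<in> insert 0 axes" for d
    unfolding T'_def using W(6) that openG by blast
  have T'disj: "d = d'" if "d \<in> insert 0 axes" "d' \<in> insert 0 axes" "x \<in> T' d" "x \<in> T' d'" for d d' x
    using that W(8) unfolding T'_def by blast
  have sumT': "(\<Sum>d\<in>axes. indicator (T' d) x *\<^sub>R f d) = f d0" if "d0 \<in> axes" "x \<in> T' d0"
    for x d0 and f :: "real^2 \<Rightarrow> 'b::real_vector"
  proof -
    have "(\<Sum>d\<in>axes. indicator (T' d) x *\<^sub>R f d) = (\<Sum>d\<in>axes. if d = d0 then f d else 0)"
      using that T'disj by (intro sum.cong refl) (auto simp: indicator_def)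
    then show ?thesis using that by simp
  qed
  have sumT'0: "(\<Sum>d\<in>axes. indicator (T' d) x *\<^sub>R f d) = 0" if "\<And>d. d \<in> axes \<Longrightarrow> x \<notin> T' d"
    for x and f :: "real^2 \<Rightarrow> 'b::real_vector"
    using that by (intro sum.neutral) auto
  have ZD: "Z x = D d" if "d \<in> insert 0 axes" "x \<in> T' d" for x d
  proof (cases "d = 0")
    case True
    then have "x \<notin> T' d'" if "d' \<in> axes" for d' using T'disj[of d d' x] that \<open>x \<in> T' d\<close> ax0 by auto
    then show ?thesis using True D0 by (simp add: Z_def sumT'0)
  next
    case False
    then show ?thesis using that unfolding Z_def by (intro sumT') auto
  qed
  have Zcases: "Z x \<in> D ` insert 0 axes" for x
  proof (cases "\<exists>d\<in>axes. x \<in> T' d")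
    case True then show ?thesis using ZD by blast
  next
    case False then have "Z x = D 0" by (simp add: Z_def sumT'0 D0)
    then show ?thesis by blast
  qed
  have der: "(w has_derivative (*v) (Z x)) (at x)" if d: "d \<in> insert 0 axes" "x \<in> T' d" for x d
  proof -
    have "(W has_derivative (\<lambda>h. h \<bullet> d)) (at (G x))" using d W(9) unfolding T'_def by auto
    then have "((\<lambda>x. W (G x)) has_derivative (\<lambda>h. G h \<bullet> d)) (at x)"
      by (rule has_derivative_compose[rotated]) (rule linear_imp_has_derivative[OF linG])
    then have "(w has_derivative (\<lambda>h. (G h \<bullet> d) *\<^sub>R a)) (at x)"
      unfolding w_def by (rule has_derivative_scaleR_left)
    moreover have "(\<lambda>h. (G h \<bullet> d) *\<^sub>R a) = (*v) (Z x)"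
      unfolding ZD[OF d] D_def outer_mult_vec
      by (rule ext) (simp add: inner_2 G_nth inner_add_left algebra_simps)
    ultimately show ?thesis by simp
  qed
  define \<kappa> where "\<kappa> = \<bar>det (matrix F)\<bar>"
  have lm: "F -` S \<in> lmeasurable"
    using \<open>open (F -` S)\<close> \<open>bounded (F -` S)\<close> by (simp add: bounded_set_imp_lmeasurable borel_open)
  have Tlm: "T d \<in> lmeasurable" if "d \<in> insert 0 axes" for d
    using bounded_subset[OF \<open>bounded (F -` S)\<close> W(7)[OF that]] W(6)[OF that]
    by (simp add: bounded_set_imp_lmeasurable borel_open)
  have T'lm: "T' d \<in> lmeasurable" if "d \<in> insert 0 axes" for d
    using bounded_subset[OF S(2) T'S[OF that]] oT'[OF that]
    by (simp add: bounded_set_imp_lmeasurable borel_open)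
  have mF: "measure lebesgue (F ` A) = \<kappa> * measure lebesgue A" if "A \<in> lmeasurable" for A
    unfolding \<kappa>_def by (rule measure_linear_image[OF linF that])
  have mT': "measure lebesgue (T' d) = \<kappa> * measure lebesgue (T d)" if "d \<in> insert 0 axes" for d
    unfolding T'_def vimG by (rule mF[OF Tlm[OF that]])
  have FS: "F ` (F -` S) = S" using FG by (auto simp: image_iff) metis
  have mS: "measure lebesgue S \<le> 8 * measure lebesgue (T' d)" if "d \<in> axes" for d
  proof -
    have "measure lebesgue S = \<kappa> * measure lebesgue (F -` S)" using mF[OF lm] FS by simp
    also have "\<dots> \<le> \<kappa> * (8 * measure lebesgue (T d))"
      by (intro mult_left_mono W(12) that) (simp add: \<kappa>_def)
    finally show ?thesis using mT'[of d] that by simp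
  qed
  define m where "m = measure lebesgue (T' (axis 1 1))"
  have a1: "axis 1 1 \<in> axes" "- axis 1 1 \<in> axes" by (auto simp: axes_def)
  have mm: "measure lebesgue (T' d) = m" if "d \<in> axes" for d
    using mT'[of d] mT'[of "axis 1 1"] W(11)[OF that a1(1)] that a1 by (simp add: m_def)
  have integr: "integrable lebesgue (\<lambda>x. indicator (T' d) x *\<^sub>R f d)" if "d \<in> axes"
    for d and f :: "real^2 \<Rightarrow> 'b::{banach,second_countable_topology}"
  proof (intro integrable_scaleR_left integrable_real_indicator)
    show "T' d \<in> sets lebesgue" "emeasure lebesgue (T' d) < \<infinity>"
      using T'lm[of d] that by (auto simp: fmeasurable_def)
  qed
  have neg: "negligible (S - (\<Union>d\<in>insert 0 axes. T' d))"
  proof -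
    have "S - (\<Union>d\<in>insert 0 axes. T' d) = F ` (F -` S - \<Union>(T ` insert 0 axes))"
      unfolding T'_def vimG[symmetric] by (auto simp: FG)
    moreover have "negligible (F ` A)" if "negligible A" for A
      using that mF[of A] measurable_linear_image[OF linF, of A] by (simp add: negligible_iff_measure)
    ultimately show ?thesis using W(10) by simp
  qed
  show thesis
  proof (rule that[where L = "G -` L" and w = w and Z = Z and \<T> = "T' ` insert 0 axes"])
    show "closed (G -` L)" using W(1) contG[of UNIV] by (simp add: closed_vimage)
    show "G -` L \<subseteq> S" using W(2) FG by fastforce
    show "w x = 0" if "x \<notin> G -` L" for x using that W(3) by (simp add: w_def)
    show "norm (w x) \<le> \<sigma>" for x
    proof -
      have "norm (w x) \<le> \<sigma> / (norm a + 1) * norm a"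
        using mult_right_mono[OF W(4)[of "G x"], of "norm a"] by (simp add: w_def)
      also have "\<dots> \<le> \<sigma>" using \<open>0 < \<sigma>\<close> by (simp add: field_simps add_pos_nonneg)
      finally show ?thesis .
    qed
    show "\<exists>\<tau>. \<bar>\<tau>\<bar> \<le> 1 \<and> (w y - w x = outer a (\<tau> *\<^sub>R e) *v (y - x) \<or>
                        w y - w x = outer a ((\<tau> * \<eta>) *\<^sub>R perp e) *v (y - x))" for x y
    proof -
      have *: "\<exists>\<tau>. \<bar>\<tau>\<bar> \<le> 1 \<and> p = \<tau> * q" if "\<bar>p\<bar> \<le> \<bar>q\<bar>" for p q :: real
      proof (cases "q = 0")
        case False then show ?thesis using that by (intro exI[of _ "p / q"]) simp
      qed (use that in \<open>auto intro: exI[of _ 0]\<close>)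
      \<comment> \<open>The increment of \<open>W\<close> is at most the larger of two coordinate
        increments, hence \<tau> times that one. This is how difference quotients, and not only
        gradients, become rank-one matrices of the listed form.\<close>
      have "\<bar>W (G y) - W (G x)\<bar> \<le> infnorm (G (y - x))"
        using W(5)[of "G y" "G x"] by (simp add: linear_diff[OF linG])
      then consider "\<bar>W (G y) - W (G x)\<bar> \<le> \<bar>(y - x) \<bullet> e\<bar>" | "\<bar>W (G y) - W (G x)\<bar> \<le> \<bar>\<eta> * ((y - x) \<bullet> perp e)\<bar>"
        unfolding infnorm_2 G_nth le_max_iff_disj by blast
      then show ?thesis
      proof cases
        case 1
        from *[OF this] obtain \<tau> where "\<bar>\<tau>\<bar> \<le> 1" "W (G y) - W (G x) = \<tau> * ((y - x) \<bullet> e)" by blast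
        then show ?thesis by (intro exI[of _ \<tau>]) (simp add: w_def scaleR_left_diff_distrib[symmetric] outer_mult_vec inner_commute)
      next
        case 2
        from *[OF this] obtain \<tau> where "\<bar>\<tau>\<bar> \<le> 1" "W (G y) - W (G x) = \<tau> * (\<eta> * ((y - x) \<bullet> perp e))" by blast
        then show ?thesis by (intro exI[of _ \<tau>]) (simp add: w_def scaleR_left_diff_distrib[symmetric] outer_mult_vec inner_commute mult.assoc)
      qed
    qed
    show "finite (T' ` insert 0 axes)" by simp
    show "A = B" if "A \<in> T' ` insert 0 axes" "B \<in> T' ` insert 0 axes" "x \<in> A" "x \<in> B" for A B x
      using that T'disj by blast
    show "Z x = Z y" if "A \<in> T' ` insert 0 axes" "x \<in> A" "y \<in> A" for A x y
      using that ZD by (metis imageE)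
    show "(w has_derivative (*v) (Z x)) (at x)" if "x \<in> \<Union> (T' ` insert 0 axes)" for x
      using that der by blast
    show "negligible (S - \<Union> (T' ` insert 0 axes))" using neg .
    show "\<exists>\<tau>. \<bar>\<tau>\<bar> \<le> 1 \<and> (Z x = outer a (\<tau> *\<^sub>R e) \<or> Z x = outer a ((\<tau> * \<eta>) *\<^sub>R perp e))" for x
    proof -
      have "D 0 = outer a (0 *\<^sub>R e)" "D (axis 1 1) = outer a (1 *\<^sub>R e)" "D (- axis 1 1) = outer a ((-1) *\<^sub>R e)"
        "D (axis 2 1) = outer a ((1 * \<eta>) *\<^sub>R perp e)" "D (- axis 2 1) = outer a (((-1) * \<eta>) *\<^sub>R perp e)"
        by (simp_all add: D_def)
      note D_eqs = this
      obtain d where d: "Z x = D d" "d \<in> insert 0 axes" using Zcases[of x] by blast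
      from d(2) consider "d = 0" | "d = axis 1 1" | "d = - axis 1 1" | "d = axis 2 1" | "d = - axis 2 1"
        unfolding axes_def by blast
      then show ?thesis
      proof cases
        case 1 then show ?thesis using d(1) D_eqs(1) by (intro exI[of _ 0]) simp
      next
        case 2 then show ?thesis using d(1) D_eqs(2) by (intro exI[of _ 1]) simp
      next
        case 3 then show ?thesis using d(1) D_eqs(3) by (intro exI[of _ "-1"]) simp
      next
        case 4 then show ?thesis using d(1) D_eqs(4) by (intro exI[of _ 1]) simp
      next
        case 5 then show ?thesis using d(1) D_eqs(5) by (intro exI[of _ "-1"]) simp
      qed
    qed
    show "Z x = 0" if "x \<notin> S" for x
      using that T'S unfolding Z_def by (intro sumT'0) blast
    show "Z \<in> borel_measurable borel"
      unfolding Z_def using oT' by (intro borel_measurable_sum borel_measurable_scaleR borel_measurable_indicator) auto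
    show "integrable lebesgue Z" unfolding Z_def by (intro Bochner_Integration.integrable_sum integr)
    have LS: "(LINT x|lebesgue. (\<Sum>d\<in>axes. indicator (T' d) x *\<^sub>R f d)) = m *\<^sub>R (\<Sum>d\<in>axes. f d)"
      for f :: "real^2 \<Rightarrow> 'b::{banach,second_countable_topology}"
    proof -
      have "(LINT x|lebesgue. (\<Sum>d\<in>axes. indicator (T' d) x *\<^sub>R f d))
          = (\<Sum>d\<in>axes. LINT x|lebesgue. indicator (T' d) x *\<^sub>R f d)"
        by (rule Bochner_Integration.integral_sum) (rule integr)
      also have "\<dots> = (\<Sum>d\<in>axes. m *\<^sub>R f d)"
      proof (rule sum.cong[OF refl])
        fix d assume d: "d \<in> axes"
        then have "T' d \<in> sets lebesgue" using T'lm[of d] by (auto simp: fmeasurableD)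
        then have "integrable lebesgue (indicator (T' d) :: _ \<Rightarrow> real)"
          using T'lm[of d] d by (intro integrable_real_indicator) (auto simp: fmeasurable_def)
        then show "(LINT x|lebesgue. indicator (T' d) x *\<^sub>R f d) = m *\<^sub>R f d"
          using mm[OF d] by (subst integral_scaleR_left) auto
      qed
      finally show ?thesis by (simp add: scaleR_sum_right)
    qed
    have "(LINT x|lebesgue. Z x) = m *\<^sub>R (\<Sum>d\<in>axes. D d)"
      unfolding Z_def by (rule LS)
    also have "(\<Sum>d\<in>axes. D d) = 0"
    proof -
      have "(\<Sum>d\<in>axes. D d) = (\<Sum>d\<in>axes. D (- d))"
        by (rule sum.reindex_bij_witness[of _ uminus uminus]) (auto simp: uminus_axes)
      also have "\<dots> = - (\<Sum>d\<in>axes. D d)"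
        by (simp add: D_def sum_negf[symmetric] outer_minus_right[symmetric])
      finally have "(2::real) *\<^sub>R (\<Sum>d\<in>axes. D d) = 0" by (metis add.right_inverse scaleR_2)
      then show ?thesis by simp
    qed
    finally show "(LINT x|lebesgue. Z x) = 0" by simp
    have Z2: "(norm (Z x))\<^sup>2 = (\<Sum>d\<in>axes. indicator (T' d) x *\<^sub>R (norm (D d))\<^sup>2)" for x
    proof (cases "\<exists>d\<in>axes. x \<in> T' d")
      case True
      then obtain d where "d \<in> axes" "x \<in> T' d" by blast
      then show ?thesis using ZD[of d x] sumT'[of d x "\<lambda>d. (norm (D d))\<^sup>2"] by simp
    next
      case False then show ?thesis by (simp add: Z_def sumT'0)
    qed
    \<comment> \<open>Only the triangles with gradient plus or minus \<open>outer a e\<close> are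
      counted: two regions, each of at least an eighth of the measure of \<open>S\<close>, hence the
      factor 4.\<close>
    have "measure lebesgue S * (norm a)\<^sup>2 \<le> 8 * m * (norm a)\<^sup>2"
      using mS[OF a1(1)] by (simp add: m_def mult_right_mono)
    also have "\<dots> = 4 * (\<Sum>d\<in>{axis 1 1, - axis 1 1}. m * (norm (D d))\<^sup>2)"
    proof -
      have "axis 1 1 \<noteq> (- axis 1 1 :: real^2)" by (auto simp: vec_eq_iff forall_2)
      then show ?thesis using assms(3) by (simp add: D_def norm_outer outer_minus_right)
    qed
    also have "\<dots> \<le> 4 * (\<Sum>d\<in>axes. m * (norm (D d))\<^sup>2)"
      by (intro mult_left_mono sum_mono2) (auto simp: axes_def m_def)
    also have "(\<Sum>d\<in>axes. m * (norm (D d))\<^sup>2) = (LINT x|lebesgue. (norm (Z x))\<^sup>2)"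
      unfolding Z2 LS by (simp add: sum_distrib_left)
    finally show "(norm a)\<^sup>2 * measure lebesgue S \<le> 4 * (LINT x|lebesgue. (norm (Z x))\<^sup>2)"
      by (simp add: mult.commute)
  qed (use oT' T'S in auto)
qed

lemma affine_of_constant_derivative:
  fixes u :: "real^2 \<Rightarrow> real^2"
  assumes "\<And>y. y \<in> ball x r \<Longrightarrow> (u has_derivative (*v) A) (at y)" "y \<in> ball x r"
  shows "u y - u x = A *v (y - x)"
proof -
  have "((\<lambda>y. u y - A *v y) has_derivative (\<lambda>h. 0)) (at z within ball x r)" if "z \<in> ball x r" for z
  proof -
    have "((*v) A has_derivative (*v) A) (at z)"
      by (rule linear_imp_has_derivative) (rule matrix_vector_mul_linear)
    from has_derivative_diff[OF assms(1)[OF that] this] show ?thesis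
      by (simp add: has_derivative_at_withinI)
  qed
  then obtain c where "\<And>z. z \<in> ball x r \<Longrightarrow> u z - A *v z = c"
    using has_derivative_zero_constant[of "ball x r" "\<lambda>y. u y - A *v y"] by auto
  moreover have "x \<in> ball x r" using assms(2) by (simp, metis zero_le_dist le_less_trans)
  ultimately have "u y - A *v y = u x - A *v x" using assms(2) by metis
  then show ?thesis by (simp add: matrix_vector_mult_diff_distrib algebra_simps)
qed

lemma norm_matrix_vector_mult_le: "norm ((A :: real^2^2) *v h) \<le> norm A * norm h"
proof -
  have "(norm (A *v h))\<^sup>2 = (\<Sum>i\<in>UNIV. (A $ i \<bullet> h)\<^sup>2)"
    by (simp add: norm_vec_def L2_set_def matrix_vector_mul_component sum_nonneg)
  also have "\<dots> \<le> (\<Sum>i\<in>UNIV. (norm (A $ i))\<^sup>2 * (norm h)\<^sup>2)"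
    by (intro sum_mono) (metis Cauchy_Schwarz_ineq2 abs_ge_zero power2_abs power_mono power_mult_distrib)
  also have "\<dots> = (norm A * norm h)\<^sup>2"
    by (simp add: power_mult_distrib norm_vec_def[of A] L2_set_def sum_nonneg sum_distrib_right)
  finally show ?thesis by (rule power2_le_imp_le) simp
qed

text \<open>\<open>A\<close> has to be the midpoint because the two extreme gradients occur on sets
  of equal measure. The intermediate \<tau> are included because difference quotients across several
  triangles take these values.\<close>

definition movable :: "(real^2^2) set \<Rightarrow> real \<Rightarrow> real^2^2 \<Rightarrow> bool" where
  "movable U \<rho> A \<longleftrightarrow> (\<exists>a e. norm a = \<rho> \<and> norm e = 1 \<and> (\<forall>\<tau>. \<bar>\<tau>\<bar> \<le> 1 \<longrightarrow> A + outer a (\<tau> *\<^sub>R e) \<in> U))"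

section \<open>Piecewise affine approximations\<close>

text \<open>The correction made on one piece \<open>T\<close>. \<open>lipschitz_sum\<close> bounds
  difference quotients, so that the constant \<open>C\<close> survives where an increment crosses
  several of the new pieces. Where \<open>S\<close> is constant on \<open>T\<close>, the set in
  \<open>energy_Z\<close> is either \<open>T\<close> or empty.\<close>

locale patch =
  fixes U :: "(real^2^2) set" and C \<rho> \<sigma> :: real and S :: "real^2 \<Rightarrow> real^2^2" and T :: "(real^2) set"
    and w :: "real^2 \<Rightarrow> real^2" and Z :: "real^2 \<Rightarrow> real^2^2" and \<T> :: "(real^2) set set" and L :: "(real^2) set"
  assumes closed_L: "closed L" and L_subset: "L \<subseteq> T" and w_eq_0: "x \<notin> L \<Longrightarrow> w x = 0"
    and norm_w: "norm (w x) \<le> \<sigma>"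
    and lipschitz_w: "norm (w y - w x) \<le> \<rho> * norm (y - x)"
    and lipschitz_sum: "x \<in> T \<Longrightarrow> norm (S x *v (y - x) + (w y - w x)) \<le> C * norm (y - x)"
    and finite_\<T>: "finite \<T>" and open_\<T>: "Q \<in> \<T> \<Longrightarrow> open Q" and \<T>_subset: "Q \<in> \<T> \<Longrightarrow> Q \<subseteq> T"
    and \<T>_disjoint: "Q \<in> \<T> \<Longrightarrow> Q' \<in> \<T> \<Longrightarrow> x \<in> Q \<Longrightarrow> x \<in> Q' \<Longrightarrow> Q = Q'"
    and negligible_rest: "negligible (T - \<Union>\<T>)"
    and Z_const: "Q \<in> \<T> \<Longrightarrow> x \<in> Q \<Longrightarrow> y \<in> Q \<Longrightarrow> Z x = Z y"
    and deriv_w: "Q \<in> \<T> \<Longrightarrow> x \<in> Q \<Longrightarrow> (w has_derivative (*v) (Z x)) (at x)"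
    and sum_in_U: "x \<in> T \<Longrightarrow> S x + Z x \<in> U" and norm_Z: "norm (Z x) \<le> \<rho>"
    and Z_eq_0: "x \<notin> T \<Longrightarrow> Z x = 0" and borel_Z: "Z \<in> borel_measurable borel"
    and integrable_Z: "integrable lebesgue Z" and integral_Z: "(LINT x|lebesgue. Z x) = 0"
    and energy_Z: "\<rho>\<^sup>2 * measure lebesgue {x\<in>T. movable U \<rho> (S x)} \<le> 4 * (LINT x|lebesgue. (norm (Z x))\<^sup>2)"

text \<open>The field \<open>S\<close> is the gradient of \<open>u\<close> on the finitely many open pieces in \<open>\<P>\<close>; a piece
  need not be connected. The local Lipschitz bound is also required on the skeleton between the pieces,
  so that it integrates to a global bound that does not depend on the approximation.\<close>

locale state =
  fixes \<Omega> :: "(real^2) set" and U :: "(real^2^2) set" and C :: real and \<phi> u :: "real^2 \<Rightarrow> real^2"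
    and S :: "real^2 \<Rightarrow> real^2^2" and \<P> :: "(real^2) set set"
  assumes finite_pieces: "finite \<P>" and open_piece: "T \<in> \<P> \<Longrightarrow> open T" and piece_subset: "T \<in> \<P> \<Longrightarrow> T \<subseteq> \<Omega>"
    and pieces_disjoint: "T \<in> \<P> \<Longrightarrow> T' \<in> \<P> \<Longrightarrow> x \<in> T \<Longrightarrow> x \<in> T' \<Longrightarrow> T = T'"
    and negligible_skeleton: "negligible (\<Omega> - \<Union>\<P>)"
    and S_const: "T \<in> \<P> \<Longrightarrow> x \<in> T \<Longrightarrow> y \<in> T \<Longrightarrow> S x = S y"
    and S_in_U: "T \<in> \<P> \<Longrightarrow> x \<in> T \<Longrightarrow> S x \<in> U"
    and deriv_u: "T \<in> \<P> \<Longrightarrow> x \<in> T \<Longrightarrow> (u has_derivative (*v) (S x)) (at x)"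
    and borel_S: "S \<in> borel_measurable borel" and norm_S: "norm (S x) \<le> C"
    and S_eq_0: "x \<notin> \<Omega> \<Longrightarrow> S x = 0" and u_outside: "x \<notin> \<Omega> \<Longrightarrow> u x = \<phi> x"
    and local_lipschitz_u: "\<exists>r>0. \<forall>y\<in>ball x r. norm (u y - u x) \<le> C * norm (y - x)"

lemma (in state) sum_pieces:
  fixes f :: "(real^2) set \<Rightarrow> 'b::real_vector"
  assumes "T \<in> \<P>" "x \<in> T" "\<And>T'. T' \<in> \<P> \<Longrightarrow> x \<notin> T' \<Longrightarrow> f T' = 0"
  shows "(\<Sum>T'\<in>\<P>. f T') = f T"
proof -
  have "(\<Sum>T'\<in>\<P>. f T') = (\<Sum>T'\<in>\<P>. if T' = T then f T' else 0)"
  proof (rule sum.cong[OF refl])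
    fix T' assume T': "T' \<in> \<P>"
    show "f T' = (if T' = T then f T' else 0)"
    proof (cases "T' = T")
      case False
      then have "x \<notin> T'" using pieces_disjoint[OF T' assms(1) _ assms(2)] by blast
      then show ?thesis using assms(3)[OF T'] False by simp
    qed simp
  qed
  then show ?thesis using finite_pieces assms(1) by simp
qed

lemma (in state) sets_piece_where:
  assumes T: "T \<in> \<P>"
  shows "{x\<in>T. Q (S x)} \<in> sets lebesgue"
proof -
  consider "\<forall>x\<in>T. \<not> Q (S x)" | y where "y \<in> T" "Q (S y)" by blast
  then have "{x\<in>T. Q (S x)} \<in> {{}, T}"
  proof cases
    case 1 then show ?thesis by blast
  next
    case 2
    have "Q (S x)" if "x \<in> T" for x using S_const[OF T that 2(1)] 2(2) by simp
    then show ?thesis by blast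
  qed
  moreover have "{} \<in> sets lebesgue" "T \<in> sets lebesgue" using open_piece[OF T] by auto
  ultimately show ?thesis by (elim insertE emptyE) (simp_all only:)
qed

locale gradient_inclusion =
  fixes \<Omega> :: "(real^2) set" and U :: "(real^2^2) set" and C :: real and \<phi> :: "real^2 \<Rightarrow> real^2"
  assumes open_\<Omega>: "open \<Omega>" and bounded_\<Omega>: "bounded \<Omega>"
    and open_U: "open U" and norm_U: "A \<in> U \<Longrightarrow> norm A \<le> C" and C_nonneg: "0 \<le> C"
begin

lemma patch_exists:
  assumes st: "state \<Omega> U C \<phi> u S \<P>" and "0 < \<rho>" "0 < \<sigma>" and T: "T \<in> \<P>"
  shows "\<exists>w Z \<T> L. patch U C \<rho> \<sigma> S T w Z \<T> L"
proof (cases "T = {}")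
  case True
  have "patch U C \<rho> \<sigma> S T (\<lambda>x. 0) (\<lambda>x. 0) {} {}"
    using \<open>0 < \<rho>\<close> \<open>0 < \<sigma>\<close> True by (intro patch.intro) simp_all
  then show ?thesis by blast
next
  case False
  note S = state.finite_pieces[OF st] state.open_piece[OF st] state.piece_subset[OF st]
    state.pieces_disjoint[OF st] state.negligible_skeleton[OF st] state.S_const[OF st] state.S_in_U[OF st]
    state.deriv_u[OF st] state.borel_S[OF st] state.norm_S[OF st] state.S_eq_0[OF st] state.u_outside[OF st]
    state.local_lipschitz_u[OF st]
  have Tb: "bounded T" using bounded_subset[OF bounded_\<Omega> S(3)[OF T]] .
  from False obtain x0 where x0: "x0 \<in> T" by blast
  define A where "A = S x0"
  have Sx: "S x = A" if "x \<in> T" for x unfolding A_def using S(6)[OF T that x0] .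
  have AU: "A \<in> U" unfolding A_def by (rule S(7)[OF T x0])
  \<comment> \<open>For a gradient that is not movable, \<open>a = 0\<close> makes the correction
    vanish, and no energy is claimed.\<close>
  obtain a e where ae: "norm a \<le> \<rho>" "norm e = 1" "\<And>\<tau>. \<bar>\<tau>\<bar> \<le> 1 \<Longrightarrow> A + outer a (\<tau> *\<^sub>R e) \<in> U"
    "movable U \<rho> A \<Longrightarrow> norm a = \<rho>"
  proof (cases "movable U \<rho> A")
    case True then show ?thesis using that unfolding movable_def by force
  next
    case False then show ?thesis using that[of 0 "axis 1 1"] AU \<open>0 < \<rho>\<close> by simp
  qed
  obtain r where r: "0 < r" "ball A r \<subseteq> U" using open_U AU open_contains_ball by blast
  \<comment> \<open>The transverse gradients have norm at most \<open>\<rho> * \<eta> < r\<close>,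
    so openness of \<open>U\<close> admits them although \<open>perp e\<close> is unrelated to the
    movable direction; \<open>\<eta> \<le> 1\<close> keeps them within \<rho>.\<close>
  define \<eta> where "\<eta> = min 1 (r / (2 * \<rho>))"
  have \<eta>: "0 < \<eta>" "\<eta> \<le> 1" "\<rho> * \<eta> < r"
  proof -
    show "0 < \<eta>" "\<eta> \<le> 1" using r \<open>0 < \<rho>\<close> by (simp_all add: \<eta>_def)
    have "\<rho> * \<eta> \<le> \<rho> * (r / (2 * \<rho>))" using \<open>0 < \<rho>\<close> by (intro mult_left_mono) (auto simp: \<eta>_def)
    also have "\<dots> < r" using \<open>0 < \<rho>\<close> r(1) by simp
    finally show "\<rho> * \<eta> < r" .
  qed
  obtain w Z \<T> L where
    w: "closed L" "L \<subseteq> T" "\<And>x. x \<notin> L \<Longrightarrow> w x = 0" "\<And>x. norm (w x) \<le> \<sigma>"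
    "\<And>x y. \<exists>\<tau>. \<bar>\<tau>\<bar> \<le> 1 \<and> (w y - w x = outer a (\<tau> *\<^sub>R e) *v (y - x) \<or>
                        w y - w x = outer a ((\<tau> * \<eta>) *\<^sub>R perp e) *v (y - x))"
    "finite \<T>" "\<And>Q. Q \<in> \<T> \<Longrightarrow> open Q" "\<And>Q. Q \<in> \<T> \<Longrightarrow> Q \<subseteq> T"
    "\<And>Q Q' x. Q \<in> \<T> \<Longrightarrow> Q' \<in> \<T> \<Longrightarrow> x \<in> Q \<Longrightarrow> x \<in> Q' \<Longrightarrow> Q = Q'"
    "negligible (T - \<Union>\<T>)"
    "\<And>Q x y. Q \<in> \<T> \<Longrightarrow> x \<in> Q \<Longrightarrow> y \<in> Q \<Longrightarrow> Z x = Z y"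
    "\<And>x. x \<in> \<Union>\<T> \<Longrightarrow> (w has_derivative (*v) (Z x)) (at x)"
    "\<And>x. \<exists>\<tau>. \<bar>\<tau>\<bar> \<le> 1 \<and> (Z x = outer a (\<tau> *\<^sub>R e) \<or> Z x = outer a ((\<tau> * \<eta>) *\<^sub>R perp e))"
    "\<And>x. x \<notin> T \<Longrightarrow> Z x = 0" "Z \<in> borel_measurable borel"
    "integrable lebesgue Z" "(LINT x|lebesgue. Z x) = 0"
    "(norm a)\<^sup>2 * measure lebesgue T \<le> 4 * (LINT x|lebesgue. (norm (Z x))\<^sup>2)"
    by (rule rank_one_oscillation[OF S(2)[OF T] Tb ae(2) \<eta>(1) \<open>0 < \<sigma>\<close>, of a]) blast
  have dir: "A + D \<in> U \<and> norm D \<le> \<rho>"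
    if "\<bar>\<tau>\<bar> \<le> 1" "D = outer a (\<tau> *\<^sub>R e) \<or> D = outer a ((\<tau> * \<eta>) *\<^sub>R perp e)" for \<tau> D
    using that(2)
  proof
    assume D: "D = outer a (\<tau> *\<^sub>R e)"
    have "norm D \<le> \<rho>" using mult_mono[OF ae(1) that(1)] ae(2) \<open>0 < \<rho>\<close> by (simp add: D norm_outer)
    then show ?thesis using D ae(3)[OF that(1)] by simp
  next
    assume D: "D = outer a ((\<tau> * \<eta>) *\<^sub>R perp e)"
    have "norm D = norm a * (\<bar>\<tau>\<bar> * \<eta>)" using ae(2) \<eta>(1) by (simp add: D norm_outer abs_mult)
    also have "\<dots> \<le> \<rho> * (1 * \<eta>)" using ae(1) that(1) \<eta>(1) \<open>0 < \<rho>\<close> by (intro mult_mono) auto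
    finally have n: "norm D \<le> \<rho> * \<eta>" by simp
    then have "A + D \<in> ball A r" using \<eta>(3) by (simp add: dist_norm)
    moreover have "\<rho> * \<eta> \<le> \<rho>" using \<eta>(2) \<open>0 < \<rho>\<close> by simp
    ultimately show ?thesis using n r(2) by auto
  qed
  have wdir: "\<exists>D. w y - w x = D *v (y - x) \<and> A + D \<in> U \<and> norm D \<le> \<rho>" for x y
    using w(5)[of y x] dir by metis
  have "patch U C \<rho> \<sigma> S T w Z \<T> L"
  proof
    show "norm (w y - w x) \<le> \<rho> * norm (y - x)" for x y
    proof -
      obtain D where D: "w y - w x = D *v (y - x)" "norm D \<le> \<rho>" using wdir by blast
      then show ?thesis
        using norm_matrix_vector_mult_le[of D "y - x"] mult_right_mono[OF D(2), of "norm (y - x)"] by simp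
    qed
    show "norm (S x *v (y - x) + (w y - w x)) \<le> C * norm (y - x)" if "x \<in> T" for x y
    proof -
      obtain D where D: "w y - w x = D *v (y - x)" "A + D \<in> U" using wdir by blast
      then show ?thesis
        using norm_matrix_vector_mult_le[of "A + D" "y - x"] mult_right_mono[OF norm_U[OF D(2)], of "norm (y - x)"]
        by (simp add: Sx[OF that] matrix_vector_mult_add_rdistrib)
    qed
    have AZ: "A + Z x \<in> U" and nZ: "norm (Z x) \<le> \<rho>" for x using w(13)[of x] dir by blast+
    show "norm (Z x) \<le> \<rho>" for x by (rule nZ)
    show "S x + Z x \<in> U" if "x \<in> T" for x unfolding Sx[OF that] by (rule AZ)
    show "(w has_derivative (*v) (Z x)) (at x)" if "Q \<in> \<T>" "x \<in> Q" for Q x using w(12) that by blast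
    show "\<rho>\<^sup>2 * measure lebesgue {x \<in> T. movable U \<rho> (S x)} \<le> 4 * (LINT x|lebesgue. (norm (Z x))\<^sup>2)"
    proof (cases "movable U \<rho> A")
      case True
      then have "{x \<in> T. movable U \<rho> (S x)} = T" using Sx by auto
      then show ?thesis using w(18) ae(4)[OF True] by simp
    next
      case False
      then have "{x \<in> T. movable U \<rho> (S x)} = {}" using Sx by auto
      then show ?thesis by (simp only: measure_empty) simp
    qed
  qed (fact w)+
  then show ?thesis by (intro exI)
qed

text \<open>The corrections of all pieces are added; at each point at most one of them is nonzero.
  The 2 in \<open>2 * \<rho>\<close> accounts for two points that lie in no common piece.\<close>

lemma state_step:
  assumes st: "state \<Omega> U C \<phi> u S \<P>" and "0 < \<rho>" "0 < \<sigma>"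
  shows "\<exists>u' S' \<P>'. state \<Omega> U C \<phi> u' S' \<P>' \<and> (\<forall>T'\<in>\<P>'. \<exists>T\<in>\<P>. T' \<subseteq> T) \<and>
    (\<forall>T\<in>\<P>. (LINT x|lebesgue. indicator T x *\<^sub>R (S' x - S x)) = 0) \<and>
    (\<forall>x. norm (u' x - u x) \<le> \<sigma>) \<and>
    (\<forall>x y. norm ((u' y - u y) - (u' x - u x)) \<le> 2 * \<rho> * norm (y - x)) \<and>
    \<rho>\<^sup>2 * measure lebesgue {x\<in>\<Union>\<P>. movable U \<rho> (S x)} \<le> 4 * (LINT x|lebesgue. (norm (S' x - S x))\<^sup>2)"
proof -
  note S = state.finite_pieces[OF st] state.open_piece[OF st] state.piece_subset[OF st]
    state.pieces_disjoint[OF st] state.negligible_skeleton[OF st] state.S_const[OF st] state.S_in_U[OF st]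
    state.deriv_u[OF st] state.borel_S[OF st] state.norm_S[OF st] state.S_eq_0[OF st] state.u_outside[OF st]
    state.local_lipschitz_u[OF st]
  obtain w Z \<T> L where Q: "\<And>T. T \<in> \<P> \<Longrightarrow> patch U C \<rho> \<sigma> S T (w T) (Z T) (\<T> T) (L T)"
  proof -
    have "\<forall>T\<in>\<P>. \<exists>q. patch U C \<rho> \<sigma> S T (fst q) (fst (snd q)) (fst (snd (snd q))) (snd (snd (snd q)))"
    proof
      fix T assume "T \<in> \<P>"
      from patch_exists[OF assms this] obtain w Z \<T> L where "patch U C \<rho> \<sigma> S T w Z \<T> L" by (elim exE)
      then show "\<exists>q. patch U C \<rho> \<sigma> S T (fst q) (fst (snd q)) (fst (snd (snd q))) (snd (snd (snd q)))"
        by (intro exI[of _ "(w, Z, \<T>, L)"]) simp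
    qed
    from bchoice[OF this] obtain q where
      "\<forall>T\<in>\<P>. patch U C \<rho> \<sigma> S T (fst (q T)) (fst (snd (q T))) (fst (snd (snd (q T)))) (snd (snd (snd (q T))))" by blast
    then show ?thesis
      by (intro that[where w = "\<lambda>T. fst (q T)" and Z = "\<lambda>T. fst (snd (q T))" and
        \<T> = "\<lambda>T. fst (snd (snd (q T)))" and L = "\<lambda>T. snd (snd (snd (q T)))"]) (rule bspec)
  qed
  note W_closed_L = patch.closed_L[OF Q]
    and W_L_subset = patch.L_subset[OF Q]
    and W_w_eq_0 = patch.w_eq_0[OF Q]
    and W_norm_w = patch.norm_w[OF Q]
    and W_lipschitz_w = patch.lipschitz_w[OF Q]
    and W_lipschitz_sum = patch.lipschitz_sum[OF Q]
    and W_finite_\<T> = patch.finite_\<T>[OF Q]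
    and W_open_\<T> = patch.open_\<T>[OF Q]
    and W_\<T>_subset = patch.\<T>_subset[OF Q]
    and W_\<T>_disjoint = patch.\<T>_disjoint[OF Q]
    and W_negligible_rest = patch.negligible_rest[OF Q]
    and W_Z_const = patch.Z_const[OF Q]
    and W_deriv_w = patch.deriv_w[OF Q]
    and W_sum_in_U = patch.sum_in_U[OF Q]
    and W_norm_Z = patch.norm_Z[OF Q]
    and W_Z_eq_0 = patch.Z_eq_0[OF Q]
    and W_borel_Z = patch.borel_Z[OF Q]
    and W_integrable_Z = patch.integrable_Z[OF Q]
    and W_integral_Z = patch.integral_Z[OF Q]
    and W_energy_Z = patch.energy_Z[OF Q]
  have w0: "w T x = 0" if "T \<in> \<P>" "x \<notin> T" for T x     using W_w_eq_0[OF that(1), of x] W_L_subset[OF that(1)] that(2) by auto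
  note sum1 = state.sum_pieces[OF st]
  define w' where "w' x = (\<Sum>T\<in>\<P>. w T x)" for x
  define Z' where "Z' x = (\<Sum>T\<in>\<P>. Z T x)" for x
  have w'T: "w' x = w T x" if "T \<in> \<P>" "x \<in> T" for T x
    unfolding w'_def using that w0 by (intro sum1) auto
  have w'0: "w' x = 0" if "x \<notin> \<Union>\<P>" for x
    unfolding w'_def using that w0 by (intro sum.neutral) blast
  have Z'T: "Z' x = Z T x" if "T \<in> \<P>" "x \<in> T" for T x
    unfolding Z'_def using that W_Z_eq_0 by (intro sum1) auto
  have Z'0: "Z' x = 0" if "x \<notin> \<Union>\<P>" for x
    unfolding Z'_def using that W_Z_eq_0 by (intro sum.neutral) blast
  define \<P>' where "\<P>' = (\<Union>T\<in>\<P>. \<T> T)"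
  have sub: "\<exists>T\<in>\<P>. Q \<in> \<T> T \<and> Q \<subseteq> T" if "Q \<in> \<P>'" for Q
    using that W_\<T>_subset unfolding \<P>'_def by blast
  have "state \<Omega> U C \<phi> (\<lambda>x. u x + w' x) (\<lambda>x. S x + Z' x) \<P>'"
  proof (rule state.intro)
    show "finite \<P>'" unfolding \<P>'_def using S(1) W_finite_\<T> by blast
    show "open Q" if "Q \<in> \<P>'" for Q using that W_open_\<T> unfolding \<P>'_def by blast
    show "Q \<subseteq> \<Omega>" if "Q \<in> \<P>'" for Q using sub[OF that] S(3) by blast
    show "Q = Q'" if QQ: "Q \<in> \<P>'" "Q' \<in> \<P>'" "x \<in> Q" "x \<in> Q'" for Q Q' x
    proof -
      obtain T T' where T: "T \<in> \<P>" "Q \<in> \<T> T" "Q \<subseteq> T" "T' \<in> \<P>" "Q' \<in> \<T> T'" "Q' \<subseteq> T'"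
        using sub[OF QQ(1)] sub[OF QQ(2)] by blast
      then have "T = T'" using S(4)[OF T(1) T(4)] QQ by blast
      then show ?thesis using W_\<T>_disjoint[OF T(1)] T QQ by blast
    qed
    have "\<Omega> - \<Union>\<P>' \<subseteq> (\<Omega> - \<Union>\<P>) \<union> (\<Union>T\<in>\<P>. T - \<Union>(\<T> T))" unfolding \<P>'_def by blast
    moreover have "negligible ((\<Omega> - \<Union>\<P>) \<union> (\<Union>T\<in>\<P>. T - \<Union>(\<T> T)))"
      using S(1,5) W_negligible_rest by (intro negligible_Un negligible_Union) auto
    ultimately show "negligible (\<Omega> - \<Union>\<P>')" using negligible_subset by blast
    show "S x + Z' x = S y + Z' y" if QQ: "Q \<in> \<P>'" "x \<in> Q" "y \<in> Q" for Q x y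
    proof -
      obtain T where T: "T \<in> \<P>" "Q \<in> \<T> T" "Q \<subseteq> T" using sub[OF QQ(1)] by blast
      then have "x \<in> T" "y \<in> T" using QQ by auto
      then show ?thesis using S(6)[OF T(1)] W_Z_const[OF T(1,2)] Z'T[OF T(1)] QQ by metis
    qed
    have U': "S x + Z' x \<in> U" if "T \<in> \<P>" "x \<in> T" for T x
      using W_sum_in_U[OF that] Z'T[OF that] by simp
    show "S x + Z' x \<in> U" if QQ: "Q \<in> \<P>'" "x \<in> Q" for Q x
      using sub[OF QQ(1)] U' QQ(2) by blast
    show "((\<lambda>x. u x + w' x) has_derivative (*v) (S x + Z' x)) (at x)" if QQ: "Q \<in> \<P>'" "x \<in> Q" for Q x
    proof -
      obtain T where T: "T \<in> \<P>" "Q \<in> \<T> T" "Q \<subseteq> T" using sub[OF QQ(1)] by blast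
      then have x: "x \<in> T" using QQ by auto
      have "(\<lambda>h. S x *v h + Z T x *v h) = (*v) (S x + Z' x)"
        using Z'T[OF T(1) x] by (auto simp: matrix_vector_mult_add_rdistrib)
      then have "((\<lambda>x. u x + w T x) has_derivative (*v) (S x + Z' x)) (at x)"
        using has_derivative_add[OF S(8)[OF T(1) x] W_deriv_w[OF T(1,2) QQ(2)]] by simp
      then show ?thesis
        by (rule has_derivative_transform_within_open[OF _ S(2)[OF T(1)] x]) (simp add: w'T[OF T(1)])
    qed
    show "(\<lambda>x. S x + Z' x) \<in> borel_measurable borel"
      unfolding Z'_def using S(9) W_borel_Z by (intro borel_measurable_add borel_measurable_sum)
    show "norm (S x + Z' x) \<le> C" for x
    proof (cases "x \<in> \<Union>\<P>")
      case True then show ?thesis using U' norm_U by blast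
    next
      case False then show ?thesis using Z'0 S(10) by simp
    qed
    show "S x + Z' x = 0" if "x \<notin> \<Omega>" for x
      using S(11)[OF that] Z'0[of x] S(3) that by auto
    show "u x + w' x = \<phi> x" if "x \<notin> \<Omega>" for x
      using S(12)[OF that] w'0[of x] S(3) that by auto
    show "\<exists>r>0. \<forall>y\<in>ball x r. norm ((u y + w' y) - (u x + w' x)) \<le> C * norm (y - x)" for x
    proof (cases "x \<in> \<Union>\<P>")
      case True
      then obtain T where T: "T \<in> \<P>" "x \<in> T" by blast
      then obtain r where r: "0 < r" "ball x r \<subseteq> T" using S(2) open_contains_ball by blast
      have "norm ((u y + w' y) - (u x + w' x)) \<le> C * norm (y - x)" if y: "y \<in> ball x r" for y
      proof -
        have "(u has_derivative (*v) (S x)) (at z)" if "z \<in> ball x r" for z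
          using S(8)[OF T(1), of z] S(6)[OF T(1) T(2), of z] that r(2) by auto
        from affine_of_constant_derivative[OF this y] have "u y - u x = S x *v (y - x)" .
        moreover have "y \<in> T" using y r(2) by blast
        then have "w' y = w T y" "w' x = w T x" using w'T T by auto
        ultimately have "(u y + w' y) - (u x + w' x) = S x *v (y - x) + (w T y - w T x)" by simp
        then show ?thesis using W_lipschitz_sum[OF T, of y] by simp
      qed
      with r show ?thesis by blast
    next
      case False
      obtain r where r: "0 < r" "\<And>y. y \<in> ball x r \<Longrightarrow> norm (u y - u x) \<le> C * norm (y - x)"
        using S(13)[of x] by blast
      \<comment> \<open>Off the pieces every correction vanishes nearby, since it lives in a closed
        subset of its piece; the old bound for \<open>u\<close> therefore carries over.\<close>
      have "closed (\<Union>T\<in>\<P>. L T)" using S(1) W_closed_L by (intro closed_UN) auto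
      then have "open (- (\<Union>T\<in>\<P>. L T))" by (rule open_Compl)
      moreover have "x \<in> - (\<Union>T\<in>\<P>. L T)" using False W_L_subset by blast
      ultimately obtain r' where r': "0 < r'" "ball x r' \<subseteq> - (\<Union>T\<in>\<P>. L T)"
        by (rule openE)
      have "w' y = 0" if "y \<in> ball x r'" for y
        unfolding w'_def using r'(2) that W_w_eq_0 by (intro sum.neutral) blast
      moreover have "x \<in> ball x r'" using r'(1) by simp
      ultimately have "norm ((u y + w' y) - (u x + w' x)) \<le> C * norm (y - x)" if "y \<in> ball x (min r r')" for y
        using that r(2)[of y] by simp
      then show ?thesis using r(1) r'(1) by (intro exI[of _ "min r r'"]) simp
    qed
  qed
  moreover have "\<forall>Q\<in>\<P>'. \<exists>T\<in>\<P>. Q \<subseteq> T" using sub by blast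
  moreover have "(LINT x|lebesgue. indicator T x *\<^sub>R Z' x) = 0" if T: "T \<in> \<P>" for T
  proof -
    have "indicator T x *\<^sub>R Z' x = Z T x" for x
      using Z'T[OF T, of x] W_Z_eq_0[OF T, of x] by (auto simp: indicator_def)
    then show ?thesis using W_integral_Z[OF T] by simp
  qed
  moreover have "norm (w' x) \<le> \<sigma>" for x
  proof (cases "x \<in> \<Union>\<P>")
    case True
    then obtain T where T: "T \<in> \<P>" "x \<in> T" by blast
    show ?thesis unfolding w'T[OF T] by (rule W_norm_w[OF T(1)])
  next
    case False then show ?thesis using w'0 \<open>0 < \<sigma>\<close> by simp
  qed
  moreover have "norm (w' y - w' x) \<le> 2 * \<rho> * norm (y - x)" for x y
  proof (cases "\<exists>T\<in>\<P>. x \<in> T \<and> y \<in> T")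
    case True
    then obtain T where "T \<in> \<P>" "x \<in> T" "y \<in> T" by blast
    then have "norm (w' y - w' x) \<le> \<rho> * norm (y - x)" using w'T W_lipschitz_w[of T y x] by simp
    also have "\<dots> \<le> 2 * \<rho> * norm (y - x)" using \<open>0 < \<rho>\<close> by simp
    finally show ?thesis .
  next
    case False
    \<comment> \<open>The correction of the piece containing one point is 0 at the other point, so
      its size is a difference and costs \<rho>.\<close>
    have *: "norm (w' x) \<le> \<rho> * norm (y - x)" if "\<not> (\<exists>T\<in>\<P>. x \<in> T \<and> y \<in> T)" for x y
    proof (cases "x \<in> \<Union>\<P>")
      case True
      then obtain T where T: "T \<in> \<P>" "x \<in> T" by blast
      then have "w T y = 0" using that w0 by blast
      then show ?thesis using w'T[OF T] W_lipschitz_w[OF T(1), of y x] by simp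
    next
      case False then show ?thesis using w'0 \<open>0 < \<rho>\<close> by simp
    qed
    have "norm (w' x) \<le> \<rho> * norm (y - x)" "norm (w' y) \<le> \<rho> * norm (y - x)"
      using *[of x y] *[of y x] False by (auto simp: norm_minus_commute)
    then show ?thesis using norm_triangle_ineq4[of "w' y" "w' x"] by simp
  qed
  moreover have "\<rho>\<^sup>2 * measure lebesgue {x\<in>\<Union>\<P>. movable U \<rho> (S x)} \<le> 4 * (LINT x|lebesgue. (norm (Z' x))\<^sup>2)"
  proof -
    have sq: "(norm (Z' x))\<^sup>2 = (\<Sum>T\<in>\<P>. (norm (Z T x))\<^sup>2)" for x
    proof (cases "x \<in> \<Union>\<P>")
      case True
      then obtain T where T: "T \<in> \<P>" "x \<in> T" by blast
      then show ?thesis using Z'T[OF T] sum1[OF T, of "\<lambda>T. (norm (Z T x))\<^sup>2"] W_Z_eq_0 by simp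
    next
      case False then show ?thesis using Z'0 W_Z_eq_0 by (simp add: sum.neutral)
    qed
    have int: "integrable lebesgue (\<lambda>x. (norm (Z T x))\<^sup>2)" if "T \<in> \<P>" for T
    proof (rule Bochner_Integration.integrable_bound)
      show "integrable lebesgue (\<lambda>x. \<rho> * norm (Z T x))" using W_integrable_Z[OF that] by simp
      show "(\<lambda>x. (norm (Z T x))\<^sup>2) \<in> borel_measurable lebesgue"
        using W_integrable_Z[OF that] by (intro borel_measurable_power borel_measurable_norm) auto
      show "AE x in lebesgue. norm ((norm (Z T x))\<^sup>2) \<le> norm (\<rho> * norm (Z T x))"
        using W_norm_Z[OF that] \<open>0 < \<rho>\<close> by (auto simp: power2_eq_square abs_mult intro!: mult_right_mono)
    qed
    have lm: "{x\<in>T. movable U \<rho> (S x)} \<in> sets lebesgue" if T: "T \<in> \<P>" for T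
      by (rule state.sets_piece_where[OF st T])
    have "{x\<in>\<Union>\<P>. movable U \<rho> (S x)} = (\<Union>T\<in>\<P>. {x\<in>T. movable U \<rho> (S x)})" by blast
    then have "\<rho>\<^sup>2 * measure lebesgue {x\<in>\<Union>\<P>. movable U \<rho> (S x)}
        \<le> \<rho>\<^sup>2 * (\<Sum>T\<in>\<P>. measure lebesgue {x\<in>T. movable U \<rho> (S x)})"
      using S(1) lm by (intro mult_left_mono) (auto intro!: measure_UNION_le)
    also have "\<dots> = (\<Sum>T\<in>\<P>. \<rho>\<^sup>2 * measure lebesgue {x\<in>T. movable U \<rho> (S x)})"
      by (rule sum_distrib_left)
    also have "\<dots> \<le> (\<Sum>T\<in>\<P>. 4 * (LINT x|lebesgue. (norm (Z T x))\<^sup>2))"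
      by (rule sum_mono) (rule W_energy_Z)
    also have "\<dots> = 4 * (LINT x|lebesgue. (norm (Z' x))\<^sup>2)"
      unfolding sq using int by (simp add: sum_distrib_left Bochner_Integration.integral_sum)
    finally show ?thesis .
  qed
  ultimately show ?thesis
    by (intro exI[of _ "\<lambda>x. u x + w' x"] exI[of _ "\<lambda>x. S x + Z' x"] exI[of _ \<P>']) simp
qed

end

section \<open>Convergence of bounded martingales\<close>

text \<open>The martingale property is expressed by bounded test functions that are constant on the
  pieces of stage \<open>j\<close>, in place of conditional expectations. Off the pieces, a null set
  in the application, a test function is unrestricted.\<close>

locale refining_martingale = finite_measure M for M :: "'a measure" +
  fixes X :: "nat \<Rightarrow> 'a \<Rightarrow> real" and P :: "nat \<Rightarrow> 'a set set" and C :: real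
  assumes meas [measurable]: "X j \<in> borel_measurable M"
    and bound: "\<bar>X j x\<bar> \<le> C"
    and const: "T \<in> P j \<Longrightarrow> x \<in> T \<Longrightarrow> y \<in> T \<Longrightarrow> X j x = X j y"
    and refine: "T \<in> P (Suc j) \<Longrightarrow> \<exists>T'\<in>P j. T \<subseteq> T'"
    and mart: "g \<in> borel_measurable M \<Longrightarrow> (\<And>x. \<bar>g x\<bar> \<le> D) \<Longrightarrow>
      (\<And>T x y. T \<in> P j \<Longrightarrow> x \<in> T \<Longrightarrow> y \<in> T \<Longrightarrow> g x = g y) \<Longrightarrow>
      (\<integral>x. g x * (X (Suc j) x - X j x) \<partial>M) = 0"
begin

lemma const_le:
  assumes "i \<le> j" "T \<in> P j" "x \<in> T" "y \<in> T"
  shows "X i x = X i y"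
  using assms
proof (induction j arbitrary: T rule: dec_induct)
  case base then show ?case using const by blast
next
  case (step j) then show ?case using refine by blast
qed

lemma integrable_bounded:
  fixes h :: "'a \<Rightarrow> real"
  assumes [measurable]: "h \<in> borel_measurable M" and "\<And>x. \<bar>h x\<bar> \<le> D"
  shows "integrable M h"
  using assms by (intro integrable_const_bound[where B = D]) auto

lemma C_nonneg: "0 \<le> C"
  using bound[of 0 undefined] by linarith

lemma sq_bound: "\<bar>(X j x)\<^sup>2\<bar> \<le> C\<^sup>2"
  using bound[of j x] C_nonneg by (simp add: abs_le_square_iff[symmetric])

lemma diff_bound: "\<bar>X j x - X i x\<bar> \<le> 2 * C"
  using bound[of j x] bound[of i x] by linarith

lemma diff_sq_bound: "\<bar>(X j x - X i x)\<^sup>2\<bar> \<le> (2 * C)\<^sup>2"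
  using diff_bound[of j x i] C_nonneg abs_le_square_iff[of "X j x - X i x" "2 * C"] by simp

definition energy :: "nat \<Rightarrow> real" where "energy j = (\<integral>x. (X j x)\<^sup>2 \<partial>M)"

text \<open>\<open>X j\<close> is itself an admissible test function, so the mixed term vanishes:
  increments are orthogonal to the past.\<close>

lemma energy_step: "(\<integral>x. (X (Suc j) x - X j x)\<^sup>2 \<partial>M) = energy (Suc j) - energy j"
proof -
  have 0: "(\<integral>x. X j x * (X (Suc j) x - X j x) \<partial>M) = 0"
    by (rule mart[OF meas bound]) (rule const)
  have i: "integrable M (\<lambda>x. (X j x)\<^sup>2)" for j
    by (rule integrable_bounded[OF _ sq_bound]) measurable
  have i2: "integrable M (\<lambda>x. X j x * (X (Suc j) x - X j x))"
    by (rule integrable_bounded[where D = "C * (2 * C)"])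
       (auto simp: abs_mult intro!: mult_mono bound diff_bound C_nonneg)
  have "(\<integral>x. (X (Suc j) x - X j x)\<^sup>2 \<partial>M)
     = (\<integral>x. (X (Suc j) x)\<^sup>2 - (X j x)\<^sup>2 - 2 * (X j x * (X (Suc j) x - X j x)) \<partial>M)"
    by (rule Bochner_Integration.integral_cong) (auto simp: power2_eq_square algebra_simps)
  also have "\<dots> = energy (Suc j) - energy j"
    using 0 i i2 by (simp add: energy_def)
  finally show ?thesis .
qed

lemma energy_bound: "energy j \<le> C\<^sup>2 * measure M (space M)"
proof -
  have "energy j \<le> (\<integral>x. C\<^sup>2 \<partial>M)"
    unfolding energy_def
    by (intro integral_mono integrable_bounded[OF _ sq_bound]) (use sq_bound in auto)
  then show ?thesis by (simp add: mult.commute)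
qed

lemma energy_mono: "incseq energy"
proof (rule incseq_SucI)
  fix j
  have "0 \<le> (\<integral>x. (X (Suc j) x - X j x)\<^sup>2 \<partial>M)" by simp
  then show "energy j \<le> energy (Suc j)" using energy_step[of j] by linarith
qed

lemma energy_convergent: obtains L where "energy \<longlonglongrightarrow> L" "\<And>j. energy j \<le> L"
  by (rule incseq_convergent[OF energy_mono]) (use energy_bound in auto)

lemma maximal_inequality:
  assumes "n \<le> m" "0 < \<epsilon>"
  shows "\<epsilon>\<^sup>2 * measure M {x\<in>space M. \<exists>i\<in>{n..m}. \<epsilon> \<le> \<bar>X i x - X n x\<bar>} \<le> energy m - energy n"
proof -
  define bad where "bad j x \<longleftrightarrow> (\<exists>i\<in>{n..j}. \<epsilon> \<le> \<bar>X i x - X n x\<bar>)" for j x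
  have [measurable]: "Measurable.pred M (bad j)" for j
    unfolding bad_def by measurable
  txt \<open>\<open>V\<close> is a supermartingale up to the energy increments, and it equals
    \<open>\<epsilon>\<^sup>2\<close> on the exceptional set.\<close>
  define V where "V j x = (if bad j x then \<epsilon>\<^sup>2 else (X j x - X n x)\<^sup>2)" for j x
  have [measurable]: "V j \<in> borel_measurable M" for j unfolding V_def by measurable
  have Vb: "\<bar>V j x\<bar> \<le> \<epsilon>\<^sup>2 + (2*C)\<^sup>2" for j x
    using diff_sq_bound[of j x n] by (auto simp: V_def intro: add_increasing)
  have Vi: "integrable M (V j)" for j by (rule integrable_bounded[OF _ Vb]) measurable
  have V: "(\<integral>x. V m x \<partial>M) \<le> energy m - energy n"
    using \<open>n \<le> m\<close>
  proof (induction m rule: dec_induct)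
    case base
    have "V n x = 0" for x using \<open>0 < \<epsilon>\<close> by (auto simp: V_def bad_def)
    then show ?case by simp
  next
    case (step j)
    \<comment> \<open>Increments are switched off once the threshold has been reached. This is
      decided by stages up to \<open>j\<close>, so \<open>g\<close> is constant on the pieces of
      \<open>P j\<close> and admissible as a test function.\<close>
    define g where "g x = (if bad j x then 0 else X j x - X n x)" for x
    have [measurable]: "g \<in> borel_measurable M" unfolding g_def by measurable
    have gb: "\<bar>g x\<bar> \<le> 2 * C" for x using diff_bound[of j x n] C_nonneg by (auto simp: g_def)
    have 0: "(\<integral>x. g x * (X (Suc j) x - X j x) \<partial>M) = 0"
    proof (rule mart[OF _ gb])
      fix T x y assume T: "T \<in> P j" "x \<in> T" "y \<in> T"
      then have "i \<le> j \<Longrightarrow> X i x = X i y" for i using const_le by blast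
      then show "g x = g y" using \<open>n \<le> j\<close> by (auto simp: g_def bad_def)
    qed measurable
    have i1: "integrable M (\<lambda>x. g x * (X (Suc j) x - X j x))"
      by (rule integrable_bounded[where D = "(2 * C) * (2 * C)"])
         (measurable, unfold abs_mult, intro mult_mono gb diff_bound mult_nonneg_nonneg C_nonneg, use C_nonneg in auto)
    have i2: "integrable M (\<lambda>x. (X (Suc j) x - X j x)\<^sup>2)"
      by (rule integrable_bounded[OF _ diff_sq_bound]) measurable
    have "V (Suc j) x \<le> V j x + 2 * (g x * (X (Suc j) x - X j x)) + (X (Suc j) x - X j x)\<^sup>2" for x
    proof (cases "bad j x")
      case True
      then have "bad (Suc j) x" unfolding bad_def by fastforce
      with True show ?thesis by (simp add: V_def g_def)
    next
      case False
      have "\<epsilon>\<^sup>2 \<le> (X (Suc j) x - X n x)\<^sup>2" if "bad (Suc j) x"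
      proof -
        from that False have "\<epsilon> \<le> \<bar>X (Suc j) x - X n x\<bar>"
          unfolding bad_def using le_Suc_eq by force
        then show ?thesis using \<open>0 < \<epsilon>\<close> by (simp add: abs_le_square_iff[symmetric])
      qed
      then have "V (Suc j) x \<le> (X (Suc j) x - X n x)\<^sup>2" by (auto simp: V_def)
      with False show ?thesis by (simp add: V_def g_def power2_eq_square algebra_simps)
    qed
    then have "(\<integral>x. V (Suc j) x \<partial>M)
        \<le> (\<integral>x. V j x + 2 * (g x * (X (Suc j) x - X j x)) + (X (Suc j) x - X j x)\<^sup>2 \<partial>M)"
      using Vi i1 i2 by (intro integral_mono) auto
    also have "\<dots> = (\<integral>x. V j x \<partial>M) + (energy (Suc j) - energy j)"
      using Vi i1 i2 0 energy_step[of j] by simp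
    finally show ?case using step.IH by linarith
  qed
  have "\<epsilon>\<^sup>2 * measure M {x\<in>space M. bad m x} = (\<integral>x. \<epsilon>\<^sup>2 * indicator {x\<in>space M. bad m x} x \<partial>M)"
    by simp
  also have "\<dots> \<le> (\<integral>x. V m x \<partial>M)"
    by (intro integral_mono Vi integrable_bounded[where D = "\<epsilon>\<^sup>2"])
       (auto simp: V_def indicator_def)
  finally show ?thesis using V unfolding bad_def by linarith
qed

text \<open>The maximal inequality bounds the measure of an oscillation of size \<epsilon> after
  stage \<open>n\<close> by the energy still to come, which tends to 0; almost everywhere the
  sequence is then Cauchy.\<close>

lemma AE_convergent: "AE x in M. convergent (\<lambda>j. X j x)"
proof -
  obtain L where L: "energy \<longlonglongrightarrow> L" "\<And>j. energy j \<le> L" using energy_convergent by blast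
  define A where "A \<epsilon> n = {x\<in>space M. \<exists>i\<ge>n. \<epsilon> \<le> \<bar>X i x - X n x\<bar>}" for \<epsilon> n
  have Am [measurable]: "A \<epsilon> n \<in> sets M" for \<epsilon> n unfolding A_def by measurable
  have A: "\<epsilon>\<^sup>2 * measure M (A \<epsilon> n) \<le> L - energy n" if "0 < \<epsilon>" for \<epsilon> n
  proof -
    define B where "B m = {x\<in>space M. \<exists>i\<in>{n..m}. \<epsilon> \<le> \<bar>X i x - X n x\<bar>}" for m
    have "(\<lambda>m. measure M (B m)) \<longlonglongrightarrow> measure M (\<Union>m. B m)"
      by (rule finite_Lim_measure_incseq) (auto simp: B_def incseq_def)
    moreover have "(\<Union>m. B m) = A \<epsilon> n" unfolding A_def B_def by fastforce
    ultimately have "(\<lambda>m. \<epsilon>\<^sup>2 * measure M (B m)) \<longlonglongrightarrow> \<epsilon>\<^sup>2 * measure M (A \<epsilon> n)"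
      by (auto intro: tendsto_mult_left)
    then show ?thesis
    proof (rule LIMSEQ_le_const2, intro exI allI impI)
      fix m assume "n \<le> m"
      from maximal_inequality[OF this that] L(2)[of m]
      show "\<epsilon>\<^sup>2 * measure M (B m) \<le> L - energy n" unfolding B_def by linarith
    qed
  qed
  have null: "(\<Inter>n. A \<epsilon> n) \<in> null_sets M" if "0 < \<epsilon>" for \<epsilon>
  proof -
    have "\<epsilon>\<^sup>2 * measure M (\<Inter>n. A \<epsilon> n) \<le> L - energy n" for n
    proof -
      have "measure M (\<Inter>n. A \<epsilon> n) \<le> measure M (A \<epsilon> n)"
        by (rule finite_measure_mono) auto
      then have "\<epsilon>\<^sup>2 * measure M (\<Inter>n. A \<epsilon> n) \<le> \<epsilon>\<^sup>2 * measure M (A \<epsilon> n)"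
        by (simp add: mult_left_mono)
      then show ?thesis using A[OF that, of n] by linarith
    qed
    moreover have "(\<lambda>n. L - energy n) \<longlonglongrightarrow> L - L" by (intro tendsto_intros L)
    ultimately have "\<epsilon>\<^sup>2 * measure M (\<Inter>n. A \<epsilon> n) \<le> 0"
      by (intro LIMSEQ_le_const[of "\<lambda>n. L - energy n"]) auto
    then have "measure M (\<Inter>n. A \<epsilon> n) = 0"
      using that by (simp add: mult_le_0_iff measure_le_0_iff)
    then show ?thesis by (simp add: null_setsI emeasure_eq_measure)
  qed
  have "AE x in M. \<forall>k. x \<notin> (\<Inter>n. A (1 / Suc k) n)"
    unfolding AE_all_countable by (intro allI AE_not_in null) simp
  then show ?thesis
  proof (rule AE_mp[OF _ AE_I2], intro impI)
    fix x assume x: "x \<in> space M" and *: "\<forall>k. x \<notin> (\<Inter>n. A (1 / Suc k) n)"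
    have "Cauchy (\<lambda>j. X j x)"
    proof (rule metric_CauchyI)
      fix e :: real assume "0 < e"
      then obtain k where k: "1 / Suc k < e / 2" using reals_Archimedean[of "e/2"] by (auto simp: inverse_eq_divide)
      obtain n where "x \<notin> A (1 / Suc k) n" using * by blast
      then have n: "\<bar>X i x - X n x\<bar> < e / 2" if "i \<ge> n" for i
        using k that x unfolding A_def by fastforce
      show "\<exists>N. \<forall>i\<ge>N. \<forall>j\<ge>N. dist (X i x) (X j x) < e"
      proof (intro exI allI impI)
        fix i j assume "n \<le> i" "n \<le> j"
        from n[OF this(1)] n[OF this(2)] show "dist (X i x) (X j x) < e"
          unfolding dist_real_def by linarith
      qed
    qed
    then show "convergent (\<lambda>j. X j x)" by (rule Cauchy_convergent)
  qed
qed

end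

section \<open>The limit of the approximations\<close>

text \<open>Bisection along the segment: the estimate is additive over adjacent parameter intervals
  and holds on short ones. The segment may leave \<Omega>, which is why a state is bounded locally
  at every point of the plane.\<close>

lemma lipschitz_of_local:
  fixes u :: "'a::real_normed_vector \<Rightarrow> 'b::real_normed_vector"
  assumes loc: "\<And>x. \<exists>r>0. \<forall>y\<in>ball x r. norm (u y - u x) \<le> C * norm (y - x)"
  shows "norm (u y - u x) \<le> C * norm (y - x)"
proof -
  define \<gamma> where "\<gamma> t = x + t *\<^sub>R (y - x)" for t :: real
  have \<gamma>: "norm (\<gamma> t - \<gamma> s) = \<bar>t - s\<bar> * norm (y - x)" for s t
  proof -
    have "\<gamma> t - \<gamma> s = (t - s) *\<^sub>R (y - x)" by (simp add: \<gamma>_def algebra_simps)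
    then show ?thesis by simp
  qed
  have "norm (u (\<gamma> 1) - u (\<gamma> 0)) \<le> C * norm (y - x) * (1 - 0)"
  proof (rule Bolzano[of 0 1 "\<lambda>s t. norm (u (\<gamma> t) - u (\<gamma> s)) \<le> C * norm (y - x) * (t - s)"])
    fix a b c :: real
    assume "norm (u (\<gamma> b) - u (\<gamma> a)) \<le> C * norm (y - x) * (b - a)"
      "norm (u (\<gamma> c) - u (\<gamma> b)) \<le> C * norm (y - x) * (c - b)"
    moreover have "norm (u (\<gamma> c) - u (\<gamma> a)) \<le> norm (u (\<gamma> c) - u (\<gamma> b)) + norm (u (\<gamma> b) - u (\<gamma> a))"
      using norm_triangle_ineq[of "u (\<gamma> c) - u (\<gamma> b)" "u (\<gamma> b) - u (\<gamma> a)"] by simp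
    ultimately show "norm (u (\<gamma> c) - u (\<gamma> a)) \<le> C * norm (y - x) * (c - a)"
      by (simp add: algebra_simps)
  next
    fix t :: real
    obtain r where r: "0 < r" "\<And>z. z \<in> ball (\<gamma> t) r \<Longrightarrow> norm (u z - u (\<gamma> t)) \<le> C * norm (z - \<gamma> t)"
      using loc[of "\<gamma> t"] by blast
    define d where "d = r / (norm (y - x) + 1)"
    have d: "0 < d" using r(1) by (simp add: d_def add_nonneg_pos)
    have "norm (u (\<gamma> b) - u (\<gamma> a)) \<le> C * norm (y - x) * (b - a)" if ab: "a \<le> t" "t \<le> b" "b - a < d" for a b
    proof -
      have *: "norm (u (\<gamma> s) - u (\<gamma> t)) \<le> C * (\<bar>s - t\<bar> * norm (y - x))" if "\<bar>s - t\<bar> < d" for s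
      proof -
        have "\<bar>s - t\<bar> * norm (y - x) \<le> \<bar>s - t\<bar> * (norm (y - x) + 1)" by (simp add: mult_left_mono)
        also have "\<dots> < d * (norm (y - x) + 1)" using that by (intro mult_strict_right_mono) (simp_all add: add_nonneg_pos)
        also have "\<dots> = r"
        proof -
          have "norm (y - x) + 1 \<noteq> 0" using norm_ge_zero[of "y - x"] by linarith
          then show ?thesis by (simp add: d_def)
        qed
        finally have "\<gamma> s \<in> ball (\<gamma> t) r" using \<gamma>[of s t] by (simp add: dist_norm norm_minus_commute)
        from r(2)[OF this] show ?thesis by (simp add: \<gamma>)
      qed
      have "norm (u (\<gamma> b) - u (\<gamma> a)) \<le> norm (u (\<gamma> b) - u (\<gamma> t)) + norm (u (\<gamma> a) - u (\<gamma> t))"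
        using norm_triangle_ineq4[of "u (\<gamma> b) - u (\<gamma> t)" "u (\<gamma> a) - u (\<gamma> t)"] by simp
      also have "\<dots> \<le> C * (\<bar>b - t\<bar> * norm (y - x)) + C * (\<bar>a - t\<bar> * norm (y - x))"
        using ab by (intro add_mono *) auto
      also have "\<dots> = C * norm (y - x) * (b - a)" using ab by (simp add: algebra_simps)
      finally show ?thesis .
    qed
    with d show "\<exists>d>0. \<forall>a b. a \<le> t \<and> t \<le> b \<and> b - a < d \<longrightarrow>
        norm (u (\<gamma> b) - u (\<gamma> a)) \<le> C * norm (y - x) * (b - a)" by blast
  qed simp
  then show ?thesis by (simp add: \<gamma>_def)
qed

text \<open>Lets one fixed \<delta> serve all stages at which \<open>\<rho> j\<close> has dropped
  below it.\<close>

lemma movable_mono: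
  assumes "movable U \<delta> A" "0 \<le> \<rho>" "\<rho> \<le> \<delta>" "0 < \<delta>"
  shows "movable U \<rho> A"
proof -
  obtain a e where ae: "norm a = \<delta>" "norm e = 1" "\<And>\<tau>. \<bar>\<tau>\<bar> \<le> 1 \<Longrightarrow> A + outer a (\<tau> *\<^sub>R e) \<in> U"
    using assms(1) unfolding movable_def by blast
  have "A + outer ((\<rho> / \<delta>) *\<^sub>R a) (\<tau> *\<^sub>R e) \<in> U" if "\<bar>\<tau>\<bar> \<le> 1" for \<tau>
  proof -
    have "\<bar>\<rho> / \<delta> * \<tau>\<bar> \<le> 1 * 1" unfolding abs_mult
      using assms that by (intro mult_mono) auto
    from ae(3)[of "\<rho> / \<delta> * \<tau>"] this show ?thesis by (simp add: outer_scaleR mult.commute)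
  qed
  moreover have "norm ((\<rho> / \<delta>) *\<^sub>R a) = \<rho>" using assms ae by simp
  ultimately show ?thesis using ae(2) unfolding movable_def by blast
qed

lemma bounded_linear_matrix_nth: "bounded_linear (\<lambda>A :: real^2^2. A $ i $ k)"
  by (rule bounded_linear_compose[OF bounded_linear_vec_nth bounded_linear_vec_nth])

lemma matrix_nth_le_norm: "\<bar>(A :: real^2^2) $ i $ k\<bar> \<le> norm A"
  using component_le_norm_cart[of "A $ i" k] Finite_Cartesian_Product.norm_nth_le[of A i] by linarith

lemma norm_matrix_sq: "(norm (A :: real^2^2))\<^sup>2 = (\<Sum>i\<in>UNIV. \<Sum>k\<in>UNIV. (A $ i $ k)\<^sup>2)"
  by (simp add: norm_vec_def L2_set_def sum_nonneg)

lemma (in gradient_inclusion) sets_bad: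
  assumes "finite \<P>"
  shows "{x\<in>\<Omega>. \<not> (\<exists>T\<in>\<P>. ball x r \<subseteq> T)} \<in> sets lebesgue"
proof -
  have "closed {x. ball x r \<subseteq> T}" for T :: "(real^2) set"
  proof -
    have "- {x. ball x r \<subseteq> T} = (\<Union>y\<in>-T. ball y r)" by (auto simp: dist_commute subset_iff)
    moreover have "open (\<Union>y\<in>-T. ball y r)" by (intro open_UN) auto
    ultimately show ?thesis unfolding closed_def by simp
  qed
  then have "closed (\<Union>T\<in>\<P>. {x. ball x r \<subseteq> T})" using assms by (intro closed_UN) auto
  moreover have "{x\<in>\<Omega>. \<not> (\<exists>T\<in>\<P>. ball x r \<subseteq> T)} = \<Omega> - (\<Union>T\<in>\<P>. {x. ball x r \<subseteq> T})" by auto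
  ultimately show ?thesis using open_\<Omega> by (simp add: open_Diff)
qed

text \<open>For most points, \<open>r j\<close> is a radius on which \<open>u j\<close> is affine. All later corrections together are
  smaller than \<open>(1/2) ^ j * r j\<close>, so at distances between \<open>r (Suc j)\<close> and \<open>r j\<close> only the \<open>j\<close>th
  correction matters, and its Lipschitz constant \<open>2 * \<rho> j\<close> tends to 0. Divergence of the squares of
  \<open>\<rho>\<close> makes the total energy gain infinite unless the gradients approach \<open>E\<close>.\<close>

locale inclusion_sequence = gradient_inclusion +
  fixes u :: "nat \<Rightarrow> real^2 \<Rightarrow> real^2" and S :: "nat \<Rightarrow> real^2 \<Rightarrow> real^2^2"
    and \<P> :: "nat \<Rightarrow> (real^2) set set" and r \<rho> :: "nat \<Rightarrow> real"
  assumes st: "state \<Omega> U C \<phi> (u j) (S j) (\<P> j)"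
    and refine: "T' \<in> \<P> (Suc j) \<Longrightarrow> \<exists>T\<in>\<P> j. T' \<subseteq> T"
    and mean_zero: "T \<in> \<P> j \<Longrightarrow> (LINT x|lebesgue. indicator T x *\<^sub>R (S (Suc j) x - S j x)) = 0"
    and close: "norm (u (Suc j) x - u j x) \<le> r j * (1/2) ^ Suc j"
    and lip: "norm ((u (Suc j) y - u j y) - (u (Suc j) x - u j x)) \<le> 2 * \<rho> j * norm (y - x)"
    and gain: "(\<rho> j)\<^sup>2 * measure lebesgue {x\<in>\<Union>(\<P> j). movable U (\<rho> j) (S j x)}
                \<le> 4 * (LINT x|lebesgue. (norm (S (Suc j) x - S j x))\<^sup>2)"
    and r_pos: "0 < r j" and r_Suc: "r (Suc j) \<le> r j" and r_le: "r j \<le> (1/2) ^ j"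
    and r_good: "measure lebesgue {x\<in>\<Omega>. \<not> (\<exists>T\<in>\<P> j. ball x (r j) \<subseteq> T)} \<le> (1/2) ^ j"
    and \<rho>_pos: "0 < \<rho> j" and \<rho>_lim: "\<rho> \<longlonglongrightarrow> 0" and \<rho>_div: "\<not> summable (\<lambda>j. (\<rho> j)\<^sup>2)"
begin

abbreviation M where "M \<equiv> lebesgue_on \<Omega>"

lemma sets_\<Omega> [measurable]: "\<Omega> \<in> sets lebesgue" using open_\<Omega> by simp

lemma lmeasurable_\<Omega>: "\<Omega> \<in> lmeasurable"
  using open_\<Omega> bounded_\<Omega> by (simp add: bounded_set_imp_lmeasurable borel_open)

lemma finite_M: "finite_measure M"
  by (rule finite_measure_lebesgue_on[OF lmeasurable_\<Omega>])

lemma S_lebesgue: "S j \<in> borel_measurable lebesgue"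
  using state.borel_S[OF st] by (intro measurable_completion) simp

lemma comp_measurable: "(\<lambda>x. S j x $ i $ k) \<in> borel_measurable lebesgue"
proof -
  have "(\<lambda>A :: real^2^2. A $ i $ k) \<in> borel_measurable borel"
    by (intro borel_measurable_continuous_onI linear_continuous_on bounded_linear_matrix_nth)
  then show ?thesis by (rule measurable_compose[OF S_lebesgue])
qed

lemma diff_integrable:
  assumes "T \<in> \<P> j"
  shows "integrable lebesgue (\<lambda>x. indicator T x *\<^sub>R (S (Suc j) x - S j x))"
proof (rule Bochner_Integration.integrable_bound)
  have T: "open T" "bounded T"
    using state.open_piece[OF st assms] bounded_subset[OF bounded_\<Omega> state.piece_subset[OF st assms]] by auto
  then have Tlm: "T \<in> lmeasurable" by (simp add: bounded_set_imp_lmeasurable borel_open)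
  then show "integrable lebesgue (\<lambda>x. 2 * C * indicator T x)"
    by (intro integrable_mult_right integrable_real_indicator) (auto simp: fmeasurable_def)
  show "(\<lambda>x. indicator T x *\<^sub>R (S (Suc j) x - S j x)) \<in> borel_measurable lebesgue"
    using T by (intro borel_measurable_scaleR borel_measurable_indicator borel_measurable_diff S_lebesgue) auto
  have "norm (S (Suc j) x - S j x) \<le> 2 * C" for x
    using norm_triangle_ineq4[of "S (Suc j) x" "S j x"] state.norm_S[OF st, of "Suc j" x] state.norm_S[OF st, of j x]
    by linarith
  then show "AE x in lebesgue. norm (indicator T x *\<^sub>R (S (Suc j) x - S j x)) \<le> norm (2 * C * indicator T x)"
    using C_nonneg by (intro AE_I2) (simp add: indicator_def)
qed

lemma S_diff_outside: "x \<notin> \<Omega> \<Longrightarrow> S (Suc j) x - S j x = 0"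
  using state.S_eq_0[OF st] by simp

lemma AE_in_pieces: "AE x in M. x \<in> \<Union>(\<P> j)"
proof -
  have "AE x in lebesgue. x \<notin> \<Omega> - \<Union>(\<P> j)"
    using state.negligible_skeleton[OF st] by (intro AE_not_in) (simp add: negligible_iff_null_sets)
  then show ?thesis by (subst AE_restrict_space_iff) auto
qed

text \<open>Since the skeleton is null, \<open>g\<close> times the increment is almost everywhere a
  finite combination of increments cut off to single pieces, and \<open>mean_zero\<close> makes each
  of these integrate to 0.\<close>

lemma martingale: "refining_martingale M (\<lambda>j x. S j x $ i $ k) \<P> C"
proof (intro refining_martingale.intro[OF finite_M] refining_martingale_axioms.intro)
  show meas: "(\<lambda>x. S j x $ i $ k) \<in> borel_measurable M" for j
    by (rule measurable_restrict_space1[OF comp_measurable])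
  show "\<bar>S j x $ i $ k\<bar> \<le> C" for j x
    using matrix_nth_le_norm[of "S j x" i k] state.norm_S[OF st, of j x] by linarith
  show "S j x $ i $ k = S j y $ i $ k" if "T \<in> \<P> j" "x \<in> T" "y \<in> T" for T j x y
    using state.S_const[OF st that] by simp
  show "\<exists>T'\<in>\<P> j. T \<subseteq> T'" if "T \<in> \<P> (Suc j)" for T j using refine[OF that] .
  fix g :: "real^2 \<Rightarrow> real" and D j
  assume g: "g \<in> borel_measurable M" "\<And>x. \<bar>g x\<bar> \<le> D"
    "\<And>T x y. T \<in> \<P> j \<Longrightarrow> x \<in> T \<Longrightarrow> y \<in> T \<Longrightarrow> g x = g y"
  define d where "d x = S (Suc j) x - S j x" for x
  \<comment> \<open>For an empty piece the chosen value is arbitrary, but there the indicator in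
    \<open>h\<close> vanishes.\<close>
  define c where "c T = g (SOME y. y \<in> T)" for T
  have c: "g x = c T" if "T \<in> \<P> j" "x \<in> T" for T x
    unfolding c_def by (rule g(3)[OF that]) (rule someI[of "\<lambda>y. y \<in> T", OF that(2)])
  define h where "h T x = (indicator T x *\<^sub>R d x) $ i $ k" for T x
  have hi: "integrable lebesgue (h T)" "(LINT x|lebesgue. h T x) = 0" if T: "T \<in> \<P> j" for T
  proof -
    have int: "integrable lebesgue (\<lambda>x. indicator T x *\<^sub>R d x)" unfolding d_def by (rule diff_integrable[OF T])
    show "integrable lebesgue (h T)"
      unfolding h_def by (rule integrable_bounded_linear[OF bounded_linear_matrix_nth int])
    have "(LINT x|lebesgue. h T x) = (LINT x|lebesgue. indicator T x *\<^sub>R d x) $ i $ k"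
      unfolding h_def by (rule integral_bounded_linear[OF bounded_linear_matrix_nth int])
    then show "(LINT x|lebesgue. h T x) = 0" using mean_zero[OF T] unfolding d_def by simp
  qed
  have hM: "h T \<in> borel_measurable M" if "T \<in> \<P> j" for T
    using hi(1)[OF that] by (intro measurable_restrict_space1) simp
  have h\<Omega>: "(\<lambda>x. indicator \<Omega> x *\<^sub>R h T x) = h T" for T
  proof
    fix x show "indicator \<Omega> x *\<^sub>R h T x = h T x"
      by (cases "x \<in> \<Omega>") (simp_all add: h_def d_def S_diff_outside)
  qed
  have hiM: "integrable M (h T)" "(LINT x|M. h T x) = 0" if "T \<in> \<P> j" for T
    using hi[OF that]
    by (simp_all add: integrable_restrict_space integral_restrict_space h\<Omega> del: real_scaleR_def)
  have "(LINT x|M. g x * (S (Suc j) x $ i $ k - S j x $ i $ k)) = (LINT x|M. (\<Sum>T\<in>\<P> j. c T * h T x))"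
  proof (rule integral_cong_AE)
    show "(\<lambda>x. g x * (S (Suc j) x $ i $ k - S j x $ i $ k)) \<in> borel_measurable M"
      using g(1) meas by (intro borel_measurable_times borel_measurable_diff)
    show "(\<lambda>x. \<Sum>T\<in>\<P> j. c T * h T x) \<in> borel_measurable M"
      using hM by (intro borel_measurable_sum borel_measurable_times) auto
    show "AE x in M. g x * (S (Suc j) x $ i $ k - S j x $ i $ k) = (\<Sum>T\<in>\<P> j. c T * h T x)"
      using AE_in_pieces[of j]
    proof (rule AE_mp[OF _ AE_I2], intro impI)
      fix x assume "x \<in> \<Union>(\<P> j)"
      then obtain T where T: "T \<in> \<P> j" "x \<in> T" by blast
      have "(\<Sum>T\<in>\<P> j. c T * h T x) = c T * h T x"
        by (rule state.sum_pieces[OF st T]) (simp add: h_def)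
      then show "g x * (S (Suc j) x $ i $ k - S j x $ i $ k) = (\<Sum>T\<in>\<P> j. c T * h T x)"
        using c[OF T] T(2) by (simp add: h_def d_def)
    qed
  qed
  also have "\<dots> = 0" using hiM by simp
  finally show "(LINT x|M. g x * (S (Suc j) x $ i $ k - S j x $ i $ k)) = 0" .
qed

lemma AE_convergent_S: "AE x in M. convergent (\<lambda>j. S j x)"
proof -
  have "AE x in M. \<forall>i k. convergent (\<lambda>j. S j x $ i $ k)"
    unfolding AE_all_countable by (intro allI refining_martingale.AE_convergent[OF martingale])
  then show ?thesis
  proof (rule AE_mp[OF _ AE_I2], intro impI)
    fix x assume "\<forall>i k. convergent (\<lambda>j. S j x $ i $ k)"
    then have "(\<lambda>j. S j x $ i $ k) \<longlonglongrightarrow> lim (\<lambda>j. S j x $ i $ k)" for i k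
      by (simp add: convergent_LIMSEQ_iff)
    then have "(\<lambda>j. S j x) \<longlonglongrightarrow> (\<chi> i k. lim (\<lambda>j. S j x $ i $ k))"
      by (intro vec_tendstoI) simp
    then show "convergent (\<lambda>j. S j x)" unfolding convergent_def by blast
  qed
qed

definition active :: "nat \<Rightarrow> (real^2) set" where
  "active j = {x\<in>\<Union>(\<P> j). movable U (\<rho> j) (S j x)}"

lemma sets_active [measurable]: "active j \<in> sets lebesgue"
proof -
  have "{x\<in>T. movable U (\<rho> j) (S j x)} \<in> sets lebesgue" if T: "T \<in> \<P> j" for T
    by (rule state.sets_piece_where[OF st T])
  moreover have "active j = (\<Union>T\<in>\<P> j. {x\<in>T. movable U (\<rho> j) (S j x)})" unfolding active_def by blast
  ultimately show ?thesis using state.finite_pieces[OF st] by (auto intro!: sets.finite_UN)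
qed

lemma emeasure_active: "emeasure lebesgue (active j) = ennreal (measure lebesgue (active j))"
proof -
  have "active j \<subseteq> \<Omega>" using state.piece_subset[OF st] unfolding active_def by blast
  then have "active j \<in> lmeasurable" by (rule fmeasurableI2[OF lmeasurable_\<Omega> _ sets_active])
  then show ?thesis by (simp add: emeasure_eq_measure2)
qed

text \<open>Each gain is paid for by the energies of the matrix entries; their increments telescope
  and each entry has energy at most \<open>C^2\<close> times the measure of \<Omega>. The 16 is the
  4 of \<open>gain\<close> times four entries.\<close>

lemma summable_active: "summable (\<lambda>j. (\<rho> j)\<^sup>2 * measure lebesgue (active j))"
proof (rule summableI_nonneg_bounded)
  define e where "e i k j = refining_martingale.energy M (\<lambda>j x. S j x $ i $ k) j" for i k j
  have step: "(\<rho> j)\<^sup>2 * measure lebesgue (active j) \<le> 4 * (\<Sum>i\<in>UNIV. \<Sum>k\<in>UNIV. e i k (Suc j) - e i k j)" for j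
  proof -
    have "(LINT x|lebesgue. (norm (S (Suc j) x - S j x))\<^sup>2) = (LINT x|M. (norm (S (Suc j) x - S j x))\<^sup>2)"
      using S_diff_outside by (subst integral_restrict_space) (auto simp: indicator_def intro!: Bochner_Integration.integral_cong)
    also have "\<dots> = (LINT x|M. (\<Sum>i\<in>UNIV. \<Sum>k\<in>UNIV. (S (Suc j) x $ i $ k - S j x $ i $ k)\<^sup>2))"
      by (simp add: norm_matrix_sq)
    also have "\<dots> = (\<Sum>i\<in>UNIV. \<Sum>k\<in>UNIV. (LINT x|M. (S (Suc j) x $ i $ k - S j x $ i $ k)\<^sup>2))"
    proof -
      have "integrable M (\<lambda>x. (S (Suc j) x $ i $ k - S j x $ i $ k)\<^sup>2)" for i k
        by (rule refining_martingale.integrable_bounded[OF martingale _ refining_martingale.diff_sq_bound[OF martingale]])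
           (intro borel_measurable_power borel_measurable_diff measurable_restrict_space1[OF comp_measurable])
      then show ?thesis by (simp add: Bochner_Integration.integral_sum)
    qed
    also have "\<dots> = (\<Sum>i\<in>UNIV. \<Sum>k\<in>UNIV. e i k (Suc j) - e i k j)"
      unfolding e_def by (simp add: refining_martingale.energy_step[OF martingale])
    finally show ?thesis using gain[of j] unfolding active_def by simp
  qed
  show "0 \<le> (\<rho> j)\<^sup>2 * measure lebesgue (active j)" for j by simp
  show "(\<Sum>j<n. (\<rho> j)\<^sup>2 * measure lebesgue (active j)) \<le> 16 * (C\<^sup>2 * measure M (space M))" for n
  proof -
    have e: "e i k n - e i k 0 \<le> C\<^sup>2 * measure M (space M)" for i k
    proof -
      have "0 \<le> e i k 0" unfolding e_def refining_martingale.energy_def[OF martingale] by simp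
      then show ?thesis using refining_martingale.energy_bound[OF martingale, of i k n] unfolding e_def by linarith
    qed
    have "(\<Sum>j<n. (\<rho> j)\<^sup>2 * measure lebesgue (active j))
        \<le> (\<Sum>j<n. 4 * (\<Sum>i\<in>UNIV. \<Sum>k\<in>UNIV. e i k (Suc j) - e i k j))" by (intro sum_mono step)
    also have "\<dots> = 4 * (\<Sum>j<n. \<Sum>i\<in>UNIV. \<Sum>k\<in>UNIV. e i k (Suc j) - e i k j)"
      by (rule sum_distrib_left[symmetric])
    also have "\<dots> = 4 * (\<Sum>i\<in>UNIV. \<Sum>j<n. \<Sum>k\<in>UNIV. e i k (Suc j) - e i k j)"
      by (subst sum.swap) (rule refl)
    also have "\<dots> = 4 * (\<Sum>i\<in>UNIV. \<Sum>k\<in>UNIV. (\<Sum>j<n. e i k (Suc j) - e i k j))"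
      by (subst (2) sum.swap) (rule refl)
    also have "\<dots> = 4 * (\<Sum>i\<in>UNIV. \<Sum>k\<in>UNIV. e i k n - e i k 0)" by (simp add: sum_lessThan_telescope)
    also have "\<dots> \<le> 4 * (\<Sum>i\<in>(UNIV :: 2 set). \<Sum>k\<in>(UNIV :: 2 set). C\<^sup>2 * measure M (space M))"
      by (intro mult_left_mono sum_mono e) simp
    also have "\<dots> = 16 * (C\<^sup>2 * measure M (space M))" by simp
    finally show ?thesis .
  qed
qed

text \<open>Summing under the integral turns the summable measures into a sum that is finite at
  almost every point.\<close>

lemma AE_summable_active: "AE x in lebesgue. summable (\<lambda>j. (\<rho> j)\<^sup>2 * indicator (active j) x)"
proof -
  have "(\<integral>\<^sup>+x. (\<Sum>j. ennreal ((\<rho> j)\<^sup>2 * indicator (active j) x)) \<partial>lebesgue)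
      = (\<Sum>j. \<integral>\<^sup>+x. ennreal ((\<rho> j)\<^sup>2 * indicator (active j) x) \<partial>lebesgue)"
    by (rule nn_integral_suminf) measurable
  also have "\<dots> = (\<Sum>j. ennreal ((\<rho> j)\<^sup>2 * measure lebesgue (active j)))"
  proof (rule suminf_cong)
    fix j
    have "(\<integral>\<^sup>+x. ennreal ((\<rho> j)\<^sup>2 * indicator (active j) x) \<partial>lebesgue)
        = (\<integral>\<^sup>+x. ennreal ((\<rho> j)\<^sup>2) * indicator (active j) x \<partial>lebesgue)"
      by (intro nn_integral_cong) (simp add: indicator_def)
    also have "\<dots> = ennreal ((\<rho> j)\<^sup>2) * emeasure lebesgue (active j)"
      by (rule nn_integral_cmult_indicator) (rule sets_active)
    also have "\<dots> = ennreal ((\<rho> j)\<^sup>2 * measure lebesgue (active j))"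
      by (simp add: emeasure_active ennreal_mult)
    finally show "(\<integral>\<^sup>+x. ennreal ((\<rho> j)\<^sup>2 * indicator (active j) x) \<partial>lebesgue)
        = ennreal ((\<rho> j)\<^sup>2 * measure lebesgue (active j))" .
  qed
  also have "\<dots> \<noteq> \<infinity>"
    unfolding infinity_ennreal_def by (rule ennreal_suminf_neq_top[OF summable_active]) simp
  finally have "AE x in lebesgue. (\<Sum>j. ennreal ((\<rho> j)\<^sup>2 * indicator (active j) x)) \<noteq> \<infinity>"
    by (intro nn_integral_noteq_infinite) measurable
  then show ?thesis
  proof (rule AE_mp[OF _ AE_I2], intro impI)
    fix x assume "(\<Sum>j. ennreal ((\<rho> j)\<^sup>2 * indicator (active j) x)) \<noteq> \<infinity>"
    then show "summable (\<lambda>j. (\<rho> j)\<^sup>2 * indicator (active j) x)"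
      unfolding infinity_ennreal_def by (intro summable_suminf_not_top) simp_all
  qed
qed

text \<open>Borel-Cantelli for the exceptional sets, whose measures are bounded by a geometric
  series.\<close>

lemma AE_eventually_good: "AE x in lebesgue. x \<in> \<Omega> \<longrightarrow> (\<forall>\<^sub>F j in sequentially. \<exists>T\<in>\<P> j. ball x (r j) \<subseteq> T)"
proof -
  define B where "B j = {x\<in>\<Omega>. \<not> (\<exists>T\<in>\<P> j. ball x (r j) \<subseteq> T)}" for j
  have B: "B j \<in> sets lebesgue" for j
    unfolding B_def by (rule sets_bad[OF state.finite_pieces[OF st]])
  have "B j \<in> lmeasurable" for j
    by (rule fmeasurableI2[OF lmeasurable_\<Omega> _ B]) (auto simp: B_def)
  moreover have "summable (\<lambda>j. measure lebesgue (B j))"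
    using r_good by (intro summable_comparison_test'[OF summable_geometric[of "1/2"]]) (auto simp: B_def)
  ultimately have "AE x in lebesgue. \<forall>\<^sub>F j in sequentially. x \<in> space lebesgue - B j"
    by (intro borel_cantelli_AE1 B) (auto simp: fmeasurable_def simp del: emeasure_completion)
  then show ?thesis
    by (rule AE_mp[OF _ AE_I2]) (auto simp: B_def elim: eventually_mono)
qed

definition v :: "real^2 \<Rightarrow> real^2" where "v x = lim (\<lambda>j. u j x)"

lemma decseq_r: "decseq r" by (rule decseq_SucI) (rule r_Suc)

lemma r_lim: "r \<longlonglongrightarrow> 0"
  by (rule tendsto_sandwich[OF _ _ tendsto_const LIMSEQ_power_zero[of "1/2"]])
     (use r_pos r_le in \<open>auto simp: less_imp_le\<close>)

text \<open>The difference of powers is the exact geometric partial sum, so the induction closes;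
  \<open>r\<close> decreases and can be frozen at \<open>j\<close>.\<close>

lemma u_cauchy:
  assumes "j \<le> i"
  shows "norm (u i x - u j x) \<le> r j * ((1/2) ^ j - (1/2) ^ i)"
  using assms
proof (induction i rule: dec_induct)
  case (step i)
  have "norm (u (Suc i) x - u j x) \<le> norm (u (Suc i) x - u i x) + norm (u i x - u j x)"
    using norm_triangle_ineq[of "u (Suc i) x - u i x" "u i x - u j x"] by simp
  also have "\<dots> \<le> r j * (1/2) ^ Suc i + r j * ((1/2) ^ j - (1/2) ^ i)"
    using close[of i x] decseqD[OF decseq_r \<open>j \<le> i\<close>] step.IH
    by (intro add_mono order_trans[OF close] mult_right_mono) auto
  also have "\<dots> = r j * ((1/2) ^ j - (1/2) ^ Suc i)" by (simp add: algebra_simps)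
  finally show ?case .
qed simp

lemma u_bound:
  assumes "j \<le> i"
  shows "norm (u i x - u j x) \<le> r j * (1/2) ^ j"
  using u_cauchy[OF assms, of x] r_pos[of j] by (elim order_trans) (simp add: mult_left_mono)

lemma u_lim: "(\<lambda>j. u j x) \<longlonglongrightarrow> v x"
proof -
  have "Cauchy (\<lambda>j. u j x)"
  proof (rule CauchyI)
    fix e :: real assume "0 < e"
    then obtain N where N: "r N < e / 2" using order_tendstoD(2)[OF r_lim, of "e/2"] by (auto simp: eventually_sequentially)
    have *: "norm (u i x - u N x) < e / 2" if "N \<le> i" for i
    proof -
      have "r N * (1/2) ^ N \<le> r N * 1" using r_pos[of N] by (intro mult_left_mono) (auto simp: power_le_one)
      then show ?thesis using u_bound[OF that, of x] N by linarith
    qed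
    show "\<exists>N. \<forall>m\<ge>N. \<forall>n\<ge>N. norm (u m x - u n x) < e"
    proof (intro exI allI impI)
      fix m n assume "N \<le> m" "N \<le> n"
      then show "norm (u m x - u n x) < e"
        using *[of m] *[of n] norm_triangle_ineq4[of "u m x - u N x" "u n x - u N x"] by simp
    qed
  qed
  then show ?thesis unfolding v_def by (simp add: Cauchy_convergent_iff convergent_LIMSEQ_iff)
qed

lemma v_bound: "norm (v x - u j x) \<le> r j * (1/2) ^ j"
proof (rule LIMSEQ_le_const2)
  show "(\<lambda>i. norm (u i x - u j x)) \<longlonglongrightarrow> norm (v x - u j x)" by (intro tendsto_intros u_lim)
  show "\<exists>N. \<forall>i\<ge>N. norm (u i x - u j x) \<le> r j * (1/2) ^ j" using u_bound by blast
qed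

lemma v_lipschitz: "C-lipschitz_on UNIV v"
proof (rule lipschitz_onI[OF _ C_nonneg])
  fix x y
  have "norm (v x - v y) \<le> C * norm (x - y)"
  proof (rule LIMSEQ_le_const2)
    show "(\<lambda>j. norm (u j x - u j y)) \<longlonglongrightarrow> norm (v x - v y)" by (intro tendsto_intros u_lim)
    show "\<exists>N. \<forall>j\<ge>N. norm (u j x - u j y) \<le> C * norm (x - y)"
      using lipschitz_of_local[OF state.local_lipschitz_u[OF st]] by blast
  qed
  then show "dist (v x) (v y) \<le> C * dist x y" by (simp add: dist_norm)
qed

lemma v_outside: "x \<notin> \<Omega> \<Longrightarrow> v x = \<phi> x"
  using state.u_outside[OF st] unfolding v_def by simp

lemma v_derivative:
  assumes good: "\<forall>\<^sub>F j in sequentially. \<exists>T\<in>\<P> j. ball x (r j) \<subseteq> T" and G: "(\<lambda>j. S j x) \<longlonglongrightarrow> G"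
  shows "(v has_derivative (*v) G) (at x)"
  unfolding has_derivative_at_alt
proof (intro conjI allI impI)
  show "bounded_linear ((*v) G)" by simp
  fix e :: real assume "0 < e"
  have "\<forall>\<^sub>F j in sequentially. dist (S j x) G < e / 4" using tendstoD[OF G, of "e/4"] \<open>0 < e\<close> by simp
  moreover have "\<forall>\<^sub>F j in sequentially. \<rho> j < e / 8" using order_tendstoD(2)[OF \<rho>_lim, of "e/8"] \<open>0 < e\<close> by simp
  moreover have "\<forall>\<^sub>F j in sequentially. (1/2::real) ^ j < e / 4"
    using order_tendstoD(2)[OF LIMSEQ_power_zero[of "1/2::real"], of "e/4"] \<open>0 < e\<close> by simp
  ultimately have "\<forall>\<^sub>F j in sequentially. dist (S j x) G < e / 4 \<and> \<rho> j < e / 8 \<and> (1/2::real) ^ j < e / 4 \<and>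
      (\<exists>T\<in>\<P> j. ball x (r j) \<subseteq> T)" using good by eventually_elim blast
  then obtain N where N: "\<And>j. N \<le> j \<Longrightarrow> dist (S j x) G < e / 4 \<and> \<rho> j < e / 8 \<and> (1/2::real) ^ j < e / 4 \<and>
      (\<exists>T\<in>\<P> j. ball x (r j) \<subseteq> T)" by (auto simp: eventually_sequentially)
  have "norm (v y - v x - G *v (y - x)) \<le> e * norm (y - x)" if y: "norm (y - x) < r N" for y
  proof (cases "y = x")
    case False
    then have "0 < norm (y - x)" by simp
    then obtain n where "r n < norm (y - x)"
      using order_tendstoD(2)[OF r_lim, of "norm (y - x)"] unfolding eventually_sequentially by blast
    then have ex: "\<exists>n. r n \<le> norm (y - x)" using less_imp_le by blast
    \<comment> \<open>\<open>n - 1\<close> is the scale of \<open>y\<close>: minimality gives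
      \<open>norm (y - x) < r (n - 1)\<close>, and \<open>N < n\<close> makes the eventual bounds
      available at that stage.\<close>
    define n where "n = (LEAST n. r n \<le> norm (y - x))"
    have n: "r n \<le> norm (y - x)" unfolding n_def by (rule LeastI_ex[OF ex])
    have nN: "N < n"
    proof (rule ccontr)
      assume "\<not> N < n"
      then have "r N \<le> r n" using decseqD[OF decseq_r, of n N] by simp
      then show False using n y by linarith
    qed
    then obtain j where j: "n = Suc j" "N \<le> j" by (cases n) auto
    have jy: "norm (y - x) < r j"
      using not_less_Least[of j "\<lambda>n. r n \<le> norm (y - x)"] j(1) unfolding n_def by simp
    obtain T where T: "T \<in> \<P> j" "ball x (r j) \<subseteq> T" using N[OF j(2)] by blast
    have xT: "x \<in> T" using T(2) r_pos[of j] by auto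
    have "(u j has_derivative (*v) (S j x)) (at z)" if "z \<in> ball x (r j)" for z
      using state.deriv_u[OF st T(1), of z] state.S_const[OF st T(1) xT, of z] that T(2) by auto
    moreover have "y \<in> ball x (r j)" using jy by (simp add: dist_norm norm_minus_commute)
    ultimately have lin: "u j y - u j x = S j x *v (y - x)" by (rule affine_of_constant_derivative)
    have vb: "norm (v z - u (Suc j) z) \<le> norm (y - x) * (e / 8)" for z
    proof -
      have "norm (v z - u (Suc j) z) \<le> r (Suc j) * (1/2) ^ Suc j" by (rule v_bound)
      also have "\<dots> \<le> norm (y - x) * (e / 8)"
        using n j N[OF j(2)] r_pos[of "Suc j"] by (intro mult_mono) auto
      finally show ?thesis .
    qed
    have lp: "norm ((u (Suc j) y - u j y) - (u (Suc j) x - u j x)) \<le> (e / 4) * norm (y - x)"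
      using N[OF j(2)] by (intro order_trans[OF lip] mult_right_mono) auto
    have sg: "norm ((S j x - G) *v (y - x)) \<le> (e / 4) * norm (y - x)"
      using N[OF j(2)] by (intro order_trans[OF norm_matrix_vector_mult_le] mult_right_mono) (auto simp: dist_norm)
    have "v y - v x - G *v (y - x) = (v y - u (Suc j) y) - (v x - u (Suc j) x)
        + ((u (Suc j) y - u j y) - (u (Suc j) x - u j x)) + (S j x - G) *v (y - x)"
      using lin by (simp add: matrix_vector_mult_diff_rdistrib algebra_simps)
    also have "norm \<dots> \<le> norm (v y - u (Suc j) y) + norm (v x - u (Suc j) x)
        + norm ((u (Suc j) y - u j y) - (u (Suc j) x - u j x)) + norm ((S j x - G) *v (y - x))"
      by (intro order_trans[OF norm_triangle_ineq] add_mono norm_triangle_ineq4 order_refl)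
    \<comment> \<open>The budget: \<open>e / 8\<close> for each of two tails, \<open>e / 4\<close>
      for the \<open>j\<close>th correction and \<open>e / 4\<close> for the distance of
      \<open>S j x\<close> to \<open>G\<close>, together \<open>3 e / 4\<close>.\<close>
    also have "\<dots> \<le> norm (y - x) * (e / 8) + norm (y - x) * (e / 8) + (e / 4) * norm (y - x) + (e / 4) * norm (y - x)"
      by (intro add_mono vb lp sg)
    also have "\<dots> \<le> e * norm (y - x)" using \<open>0 < e\<close> by (simp add: field_simps)
    finally show ?thesis .
  qed simp
  then show "\<exists>d>0. \<forall>y. norm (y - x) < d \<longrightarrow> norm (v y - v x - G *v (y - x)) \<le> e * norm (y - x)"
    using r_pos by blast
qed

text \<open>A limit gradient outside \<open>E\<close> would keep the late gradients movable with one
  fixed \<delta>, so the point would be active at all late stages. Pointwise summability over the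
  active stages then contradicts \<open>\<rho>_div\<close>.\<close>

lemma AE_derivative_in:
  assumes "closed E" and P: "\<And>\<epsilon>. 0 < \<epsilon> \<Longrightarrow> \<exists>\<delta>>0. \<forall>A\<in>U. (\<forall>B\<in>E. \<epsilon> \<le> dist A B) \<longrightarrow> movable U \<delta> A"
  shows "AE x in lebesgue. x \<in> \<Omega> \<longrightarrow> (\<exists>A\<in>E. (v has_derivative (\<lambda>h. A *v h)) (at x))"
proof -
  have "AE x in lebesgue. x \<in> \<Omega> \<longrightarrow> convergent (\<lambda>j. S j x)"
    using AE_convergent_S by (subst (asm) AE_restrict_space_iff) auto
  moreover note AE_summable_active AE_eventually_good
  ultimately show ?thesis
  proof eventually_elim
    case (elim x)
    show ?case
    proof
      assume "x \<in> \<Omega>"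
      then obtain G where G: "(\<lambda>j. S j x) \<longlonglongrightarrow> G" and good: "\<forall>\<^sub>F j in sequentially. \<exists>T\<in>\<P> j. ball x (r j) \<subseteq> T"
        using elim unfolding convergent_def by blast
      have "G \<in> E"
      proof (rule ccontr)
        assume "G \<notin> E"
        then obtain \<epsilon> where \<epsilon>: "0 < \<epsilon>" "ball G \<epsilon> \<subseteq> - E" using \<open>closed E\<close> by (metis ComplI open_Compl openE)
        obtain \<delta> where \<delta>: "0 < \<delta>" "\<And>A. A \<in> U \<Longrightarrow> (\<And>B. B \<in> E \<Longrightarrow> \<epsilon> / 2 \<le> dist A B) \<Longrightarrow> movable U \<delta> A"
          using P[of "\<epsilon> / 2"] \<epsilon>(1) by auto
        have "\<forall>\<^sub>F j in sequentially. dist (S j x) G < \<epsilon> / 2" using tendstoD[OF G, of "\<epsilon> / 2"] \<epsilon>(1) by simp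
        moreover have "\<forall>\<^sub>F j in sequentially. \<rho> j < \<delta>" using order_tendstoD(2)[OF \<rho>_lim \<delta>(1)] .
        ultimately have "\<forall>\<^sub>F j in sequentially. x \<in> active j"
          using good
        proof eventually_elim
          case (elim j)
          then obtain T where T: "T \<in> \<P> j" "ball x (r j) \<subseteq> T" by blast
          then have xT: "x \<in> T" using r_pos[of j] by auto
          have "\<epsilon> / 2 \<le> dist (S j x) B" if "B \<in> E" for B
          proof -
            have "\<epsilon> \<le> dist G B" using \<epsilon>(2) that by (auto simp: subset_iff not_less)
            then show ?thesis using dist_triangle[of G B "S j x"] elim(1) by (simp add: dist_commute)
          qed
          then have "movable U \<delta> (S j x)" using \<delta>(2) state.S_in_U[OF st T(1) xT] by blast
          then have "movable U (\<rho> j) (S j x)" using movable_mono elim(2) \<delta>(1) \<rho>_pos[of j] by (meson less_imp_le)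
          then show ?case using T(1) xT unfolding active_def by blast
        qed
        then have ev: "\<forall>\<^sub>F j in sequentially. (\<rho> j)\<^sup>2 * indicator (active j) x = (\<rho> j)\<^sup>2"
          by eventually_elim simp
        have "summable (\<lambda>j. (\<rho> j)\<^sup>2)" using summable_cong[OF ev] elim(2) by blast
        then show False using \<rho>_div by blast
      qed
      then show "\<exists>A\<in>E. (v has_derivative (\<lambda>h. A *v h)) (at x)" using v_derivative[OF good G] by blast
    qed
  qed
qed

end

section \<open>Construction of the sequence by dependent choice\<close>

context gradient_inclusion
begin

text \<open>The exceptional sets decrease with the radius, and since pieces are open their
  intersection lies in the null skeleton.\<close>

lemma good_radius:
  assumes st: "state \<Omega> U C \<phi> u S \<P>" and "0 < \<kappa>" "0 < m"
  shows "\<exists>r>0. r \<le> \<kappa> \<and> measure lebesgue {x\<in>\<Omega>. \<not> (\<exists>T\<in>\<P>. ball x r \<subseteq> T)} \<le> m"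
proof -
  define B where "B n = {x\<in>\<Omega>. \<not> (\<exists>T\<in>\<P>. ball x (\<kappa> / Suc n) \<subseteq> T)}" for n
  have Bs: "B n \<in> sets lebesgue" for n unfolding B_def by (rule sets_bad[OF state.finite_pieces[OF st]])
  have \<Omega>: "\<Omega> \<in> lmeasurable" using open_\<Omega> bounded_\<Omega> by (simp add: bounded_set_imp_lmeasurable borel_open)
  have Bl: "B n \<in> lmeasurable" for n by (rule fmeasurableI2[OF \<Omega> _ Bs]) (auto simp: B_def)
  have "decseq B"
  proof (rule decseq_SucI)
    fix n
    have "\<kappa> / Suc (Suc n) \<le> \<kappa> / Suc n" using \<open>0 < \<kappa>\<close> by (simp add: frac_le)
    then have "ball x (\<kappa> / Suc (Suc n)) \<subseteq> ball x (\<kappa> / Suc n)" for x :: "real^2" by (rule subset_ball)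
    then show "B (Suc n) \<subseteq> B n" unfolding B_def by blast
  qed
  moreover have "emeasure lebesgue (B n) \<noteq> \<infinity>" for n using fmeasurableD2[OF Bl] by simp
  ultimately have "(\<lambda>n. measure lebesgue (B n)) \<longlonglongrightarrow> measure lebesgue (\<Inter>n. B n)"
    using Bs by (intro Lim_measure_decseq) auto
  moreover have "(\<Inter>n. B n) \<subseteq> \<Omega> - \<Union>\<P>"
  proof
    fix x assume x: "x \<in> (\<Inter>n. B n)"
    have "x \<notin> T" if T: "T \<in> \<P>" for T
    proof
      assume "x \<in> T"
      then obtain e where e: "0 < e" "ball x e \<subseteq> T" using state.open_piece[OF st T] openE by blast
      obtain n where "inverse (Suc n) < e / \<kappa>" using reals_Archimedean[of "e / \<kappa>"] e(1) \<open>0 < \<kappa>\<close> by auto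
      then have "\<kappa> / Suc n \<le> e" using \<open>0 < \<kappa>\<close> by (simp add: field_simps)
      then have "ball x (\<kappa> / Suc n) \<subseteq> T" using subset_ball[of "\<kappa> / Suc n" e x] e(2) by blast
      moreover have "x \<in> B n" using x by blast
      ultimately show False using T unfolding B_def by blast
    qed
    moreover have "x \<in> \<Omega>" using x unfolding B_def by blast
    ultimately show "x \<in> \<Omega> - \<Union>\<P>" by blast
  qed
  then have "measure lebesgue (\<Inter>n. B n) = 0"
    using state.negligible_skeleton[OF st] negligible_subset negligible_imp_measure0 by blast
  ultimately have "\<forall>\<^sub>F n in sequentially. measure lebesgue (B n) < m"
    using order_tendstoD(2) \<open>0 < m\<close> by fastforce
  then obtain n where "measure lebesgue (B n) < m" by (auto simp: eventually_sequentially)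
  then show ?thesis using \<open>0 < \<kappa>\<close> unfolding B_def
    by (intro exI[of _ "\<kappa> / Suc n"]) (simp add: field_simps)
qed

lemma state_affine:
  assumes "\<xi> \<in> U" and \<phi>: "\<phi> = (\<lambda>x. \<xi> *v x + b)"
  shows "state \<Omega> U C \<phi> \<phi> (\<lambda>x. if x \<in> \<Omega> then \<xi> else 0) {\<Omega>}"
proof
  show "(\<phi> has_derivative (*v) (if x \<in> \<Omega> then \<xi> else 0)) (at x)" if "T \<in> {\<Omega>}" "x \<in> T" for T x
  proof -
    have "((*v) \<xi> has_derivative (*v) \<xi>) (at x)"
      by (rule linear_imp_has_derivative) (rule matrix_vector_mul_linear)
    then show ?thesis using that unfolding \<phi> by (auto intro!: derivative_eq_intros)
  qed
  show "(\<lambda>x. if x \<in> \<Omega> then \<xi> else 0) \<in> borel_measurable borel"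
    using open_\<Omega> by (intro measurable_If_set) auto
  show "norm (if x \<in> \<Omega> then \<xi> else 0) \<le> C" for x using norm_U[OF assms(1)] C_nonneg by simp
  have "norm (\<phi> y - \<phi> x) \<le> C * norm (y - x)" for x y
  proof -
    have "\<phi> y - \<phi> x = \<xi> *v (y - x)" by (simp add: \<phi> matrix_vector_mult_diff_distrib)
    then show ?thesis
      using norm_matrix_vector_mult_le[of \<xi> "y - x"] mult_right_mono[OF norm_U[OF assms(1)], of "norm (y - x)"] by simp
  qed
  then show "\<exists>r>0. \<forall>y\<in>ball x r. norm (\<phi> y - \<phi> x) \<le> C * norm (y - x)" for x
    by (intro exI[of _ 1]) simp
qed (use open_\<Omega> assms(1) in auto)

theorem inclusion_solvable:
  assumes "\<xi> \<in> U" and \<phi>: "\<phi> = (\<lambda>x. \<xi> *v x + b)" and "closed E"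
    and P: "\<And>\<epsilon>. 0 < \<epsilon> \<Longrightarrow> \<exists>\<delta>>0. \<forall>A\<in>U. (\<forall>B\<in>E. \<epsilon> \<le> dist A B) \<longrightarrow> movable U \<delta> A"
  shows "\<exists>v. C-lipschitz_on UNIV v \<and> (\<forall>x. x \<notin> \<Omega> \<longrightarrow> v x = \<phi> x) \<and>
    (AE x in lebesgue. x \<in> \<Omega> \<longrightarrow> (\<exists>A\<in>E. (v has_derivative (\<lambda>h. A *v h)) (at x)))"
proof -
  \<comment> \<open>Tends to 0, while its squares form the harmonic series.\<close>
  define \<rho> where "\<rho> j = 1 / sqrt (Suc j)" for j
  have \<rho>: "0 < \<rho> j" for j by (simp add: \<rho>_def)
  have \<rho>_lim: "\<rho> \<longlonglongrightarrow> 0"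
  proof -
    have "(\<lambda>j. sqrt (1 / Suc j)) \<longlonglongrightarrow> sqrt 0"
      by (intro tendsto_real_sqrt lim_1_over_n[THEN LIMSEQ_Suc])
    then show ?thesis unfolding \<rho>_def by (simp add: real_sqrt_divide)
  qed
  have \<rho>_div: "\<not> summable (\<lambda>j. (\<rho> j)\<^sup>2)"
  proof
    assume "summable (\<lambda>j. (\<rho> j)\<^sup>2)"
    then have "summable (\<lambda>j. inverse (real (Suc j)))" by (simp add: \<rho>_def power_divide inverse_eq_divide)
    then show False using not_summable_harmonic[where 'a = real] summable_Suc_iff[of "\<lambda>j. inverse (real j)"] by blast
  qed
  \<comment> \<open>The radius is part of the data because of the order of choices: it depends on
    the current map, and the amplitude of the next correction depends on it.\<close>
  define good where "good j q \<longleftrightarrow> (case q of (u, S, \<P>, r) \<Rightarrow> state \<Omega> U C \<phi> u S \<P> \<and> 0 < r \<and> r \<le> (1/2) ^ j \<and>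
      measure lebesgue {x\<in>\<Omega>. \<not> (\<exists>T\<in>\<P>. ball x r \<subseteq> T)} \<le> (1/2) ^ j)" for j :: nat and q
  define nxt where "nxt j q q' \<longleftrightarrow> (case q of (u, S, \<P>, r) \<Rightarrow> case q' of (u', S', \<P>', r') \<Rightarrow>
      (\<forall>T'\<in>\<P>'. \<exists>T\<in>\<P>. T' \<subseteq> T) \<and>
      (\<forall>T\<in>\<P>. (LINT x|lebesgue. indicator T x *\<^sub>R (S' x - S x)) = 0) \<and>
      (\<forall>x. norm (u' x - u x) \<le> r * (1/2) ^ Suc j) \<and>
      (\<forall>x y. norm ((u' y - u y) - (u' x - u x)) \<le> 2 * \<rho> j * norm (y - x)) \<and>
      (\<rho> j)\<^sup>2 * measure lebesgue {x\<in>\<Union>\<P>. movable U (\<rho> j) (S x)} \<le> 4 * (LINT x|lebesgue. (norm (S' x - S x))\<^sup>2) \<and>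
      r' \<le> r)" for j :: nat and q q' :: "(real^2 \<Rightarrow> real^2) \<times> (real^2 \<Rightarrow> real^2^2) \<times> (real^2) set set \<times> real"
  have "\<exists>f. \<forall>j. good j (f j) \<and> nxt j (f j) (f (Suc j))"
  proof (rule dependent_nat_choice)
    note st = state_affine[OF assms(1) \<phi>]
    obtain r where "0 < r" "r \<le> 1" "measure lebesgue {x\<in>\<Omega>. \<not> (\<exists>T\<in>{\<Omega>}. ball x r \<subseteq> T)} \<le> 1"
      using good_radius[OF st, of 1 1] by auto
    then have "good 0 (\<phi>, \<lambda>x. if x \<in> \<Omega> then \<xi> else 0, {\<Omega>}, r)"
      using st unfolding good_def by simp
    then show "\<exists>q. good 0 q" by blast
  next
    fix q j assume "good j q"
    obtain u S \<P> r where q: "q = (u, S, \<P>, r)" by (rule prod_cases4)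
    then have st: "state \<Omega> U C \<phi> u S \<P>" and r: "0 < r" using \<open>good j q\<close> by (auto simp: good_def)
    from r have "0 < r * (1/2) ^ Suc j" by simp
    from state_step[OF st \<rho>[of j] this] obtain u' S' \<P>' where st': "state \<Omega> U C \<phi> u' S' \<P>'"
      and n: "\<forall>T'\<in>\<P>'. \<exists>T\<in>\<P>. T' \<subseteq> T" "\<forall>T\<in>\<P>. (LINT x|lebesgue. indicator T x *\<^sub>R (S' x - S x)) = 0"
      "\<forall>x. norm (u' x - u x) \<le> r * (1/2) ^ Suc j"
      "\<forall>x y. norm ((u' y - u y) - (u' x - u x)) \<le> 2 * \<rho> j * norm (y - x)"
      "(\<rho> j)\<^sup>2 * measure lebesgue {x\<in>\<Union>\<P>. movable U (\<rho> j) (S x)} \<le> 4 * (LINT x|lebesgue. (norm (S' x - S x))\<^sup>2)"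
      by (elim exE conjE)
    have "0 < min r ((1/2) ^ Suc j)" "0 < (1/2::real) ^ Suc j" using r by auto
    from good_radius[OF st' this] obtain r' where r': "0 < r'" "r' \<le> min r ((1/2) ^ Suc j)"
      "measure lebesgue {x\<in>\<Omega>. \<not> (\<exists>T\<in>\<P>'. ball x r' \<subseteq> T)} \<le> (1/2) ^ Suc j" by (elim exE conjE)
    have "good (Suc j) (u', S', \<P>', r')" unfolding good_def prod.case
      using st' r' by (intro conjI; simp)
    moreover have "nxt j q (u', S', \<P>', r')" unfolding nxt_def q prod.case
      using r'(2) by (intro conjI n) simp
    ultimately show "\<exists>q'. good (Suc j) q' \<and> nxt j q q'" by (intro exI conjI)
  qed
  then obtain f where f: "\<And>j. good j (f j)" "\<And>j. nxt j (f j) (f (Suc j))" by blast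
  define u where "u j = fst (f j)" for j
  define S where "S j = fst (snd (f j))" for j
  define \<P> where "\<P> j = fst (snd (snd (f j)))" for j
  define r where "r j = snd (snd (snd (f j)))" for j
  have fj: "f j = (u j, S j, \<P> j, r j)" for j by (simp add: u_def S_def \<P>_def r_def)
  have g: "state \<Omega> U C \<phi> (u j) (S j) (\<P> j)" "0 < r j" "r j \<le> (1/2) ^ j"
    "measure lebesgue {x\<in>\<Omega>. \<not> (\<exists>T\<in>\<P> j. ball x (r j) \<subseteq> T)} \<le> (1/2) ^ j" for j
    using f(1)[of j] unfolding good_def fj prod.case by - ((elim conjE, assumption)+)
  have n: "\<forall>T'\<in>\<P> (Suc j). \<exists>T\<in>\<P> j. T' \<subseteq> T"
    "\<forall>T\<in>\<P> j. (LINT x|lebesgue. indicator T x *\<^sub>R (S (Suc j) x - S j x)) = 0"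
    "\<forall>x. norm (u (Suc j) x - u j x) \<le> r j * (1/2) ^ Suc j"
    "\<forall>x y. norm ((u (Suc j) y - u j y) - (u (Suc j) x - u j x)) \<le> 2 * \<rho> j * norm (y - x)"
    "(\<rho> j)\<^sup>2 * measure lebesgue {x\<in>\<Union>(\<P> j). movable U (\<rho> j) (S j x)} \<le> 4 * (LINT x|lebesgue. (norm (S (Suc j) x - S j x))\<^sup>2)"
    "r (Suc j) \<le> r j" for j
    using f(2)[of j] unfolding nxt_def fj prod.case by - ((elim conjE, assumption)+)
  interpret inclusion_sequence \<Omega> U C \<phi> u S \<P> r \<rho>
  proof (rule inclusion_sequence.intro[OF gradient_inclusion_axioms], rule inclusion_sequence_axioms.intro)
    show "\<exists>T\<in>\<P> j. T' \<subseteq> T" if "T' \<in> \<P> (Suc j)" for T' j using n(1) that by blast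
    show "(LINT x|lebesgue. indicator T x *\<^sub>R (S (Suc j) x - S j x)) = 0" if "T \<in> \<P> j" for T j
      by (rule bspec[OF n(2) that])
    show "norm (u (Suc j) x - u j x) \<le> r j * (1/2) ^ Suc j" for j x by (rule spec[OF n(3)])
    show "norm ((u (Suc j) y - u j y) - (u (Suc j) x - u j x)) \<le> 2 * \<rho> j * norm (y - x)" for j x y
      by (rule spec[OF spec[OF n(4)]])
  qed (rule n g \<rho> \<rho>_lim \<rho>_div)+
  show ?thesis
    using v_lipschitz v_outside AE_derivative_in[OF assms(3) P] by blast
qed

end

section \<open>Singular values in conformal coordinates\<close>

text \<open>Identifying the plane with the complex numbers, \<open>A v = cpart A * v + apart A * cnj v\<close>.\<close>

definition cpart :: "real^2^2 \<Rightarrow> complex" where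
  "cpart A = Complex ((A$1$1 + A$2$2) / 2) ((A$2$1 - A$1$2) / 2)"

definition apart :: "real^2^2 \<Rightarrow> complex" where
  "apart A = Complex ((A$1$1 - A$2$2) / 2) ((A$2$1 + A$1$2) / 2)"

definition of_parts :: "complex \<Rightarrow> complex \<Rightarrow> real^2^2" where
  "of_parts z w = vector [vector [Re z + Re w, Im w - Im z], vector [Im z + Im w, Re z - Re w]]"

lemma parts_of_parts [simp]: "cpart (of_parts z w) = z" "apart (of_parts z w) = w"
  by (simp_all add: cpart_def apart_def of_parts_def complex_eq_iff field_simps)

lemma of_parts_parts [simp]: "of_parts (cpart A) (apart A) = A"
  by (simp add: cpart_def apart_def of_parts_def vec_eq_iff forall_2 field_simps)

lemma parts_add: "cpart (A + B) = cpart A + cpart B" "apart (A + B) = apart A + apart B"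
  by (simp_all add: cpart_def apart_def complex_eq_iff field_simps)

lemma parts_scaleR: "cpart (r *\<^sub>R A) = r *\<^sub>R cpart A" "apart (r *\<^sub>R A) = r *\<^sub>R apart A"
  by (simp_all add: cpart_def apart_def complex_eq_iff field_simps)

lemma linear_parts: "linear cpart" "linear apart"
  by (auto intro!: linearI simp: parts_add parts_scaleR)

lemma continuous_on_parts [continuous_intros]:
  assumes "continuous_on X f"
  shows "continuous_on X (\<lambda>x. cpart (f x))" "continuous_on X (\<lambda>x. apart (f x))"
proof -
  have "continuous_on UNIV cpart" "continuous_on UNIV apart"
    using linear_parts by (auto intro!: linear_continuous_on simp: linear_conv_bounded_linear)
  then show "continuous_on X (\<lambda>x. cpart (f x))" "continuous_on X (\<lambda>x. apart (f x))"
    using continuous_on_compose2[OF _ assms] by blast+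
qed

lemma det_parts: "det A = (cmod (cpart A))\<^sup>2 - (cmod (apart A))\<^sup>2"
  unfolding det_2 cpart_def apart_def cmod_power2 complex.sel
  by (simp add: power2_eq_square field_simps)

lemma norm_parts: "(norm A)\<^sup>2 = 2 * ((cmod (cpart A))\<^sup>2 + (cmod (apart A))\<^sup>2)"
  unfolding norm_matrix_sq UNIV_2 cpart_def apart_def cmod_power2 complex.sel
  by (simp add: power2_eq_square field_simps)

lemma norm_le_parts: "norm A \<le> 2 * (cmod (cpart A) + cmod (apart A))"
proof (rule power2_le_imp_le)
  show "(norm A)\<^sup>2 \<le> (2 * (cmod (cpart A) + cmod (apart A)))\<^sup>2"
    unfolding norm_parts by (simp add: power2_sum algebra_simps)
qed simp

lemma eigenvector_2_iff:
  fixes \<alpha> \<beta> \<gamma> :: real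
  shows "(\<exists>x y. (x, y) \<noteq> (0, 0) \<and> \<alpha> * x + \<beta> * y = l * x \<and> \<beta> * x + \<gamma> * y = l * y) \<longleftrightarrow>
    (\<alpha> - l) * (\<gamma> - l) - \<beta>\<^sup>2 = 0" (is "?L \<longleftrightarrow> ?R")
proof
  assume ?L
  then obtain x y where xy: "(x, y) \<noteq> (0, 0)" "\<alpha> * x + \<beta> * y = l * x" "\<beta> * x + \<gamma> * y = l * y" by blast
  then have "(\<alpha> - l) * x = - \<beta> * y" "(\<gamma> - l) * y = - \<beta> * x" by (simp_all add: algebra_simps)
  note eqs = this
  have "((\<alpha> - l) * (\<gamma> - l) - \<beta>\<^sup>2) * x = (\<gamma> - l) * ((\<alpha> - l) * x) + \<beta> * (- \<beta> * x)"
    "((\<alpha> - l) * (\<gamma> - l) - \<beta>\<^sup>2) * y = (\<alpha> - l) * ((\<gamma> - l) * y) + \<beta> * (- \<beta> * y)"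
    by (simp_all add: power2_eq_square algebra_simps)
  moreover have "(\<gamma> - l) * (- \<beta> * y) = - \<beta> * ((\<gamma> - l) * y)" "(\<alpha> - l) * (- \<beta> * x) = - \<beta> * ((\<alpha> - l) * x)"
    by simp_all
  ultimately have "((\<alpha> - l) * (\<gamma> - l) - \<beta>\<^sup>2) * x = 0" "((\<alpha> - l) * (\<gamma> - l) - \<beta>\<^sup>2) * y = 0"
    unfolding eqs by simp_all
  then show ?R using xy(1) by (auto simp only: mult_eq_0_iff prod.inject)
next
  assume R: ?R
  show ?L
  proof (cases "\<alpha> = l \<and> \<beta> = 0")
    case True then show ?thesis by (intro exI[of _ 1] exI[of _ 0]) simp
  next
    case False
    have "\<beta> * (- \<beta>) + \<gamma> * (\<alpha> - l) = l * (\<alpha> - l)" using R by (simp add: power2_eq_square algebra_simps)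
    \<comment> \<open>The vector is orthogonal to the first row of the shifted matrix, a row that is
      nonzero in this case.\<close>
    then show ?thesis using False by (intro exI[of _ "- \<beta>"] exI[of _ "\<alpha> - l"]) (auto simp: algebra_simps)
  qed
qed

text \<open>The trace of \<open>transpose A ** A\<close> is \<open>2 (Z^2 + m^2)\<close> and its
  determinant is \<open>(det A)^2 = (Z^2 - m^2)^2\<close>, so the characteristic polynomial has the
  roots \<open>(Z + m)^2\<close> and \<open>(Z - m)^2\<close>.\<close>

lemma singular_values_eq:
  "singular_values A = {\<bar>cmod (cpart A) - cmod (apart A)\<bar>, cmod (cpart A) + cmod (apart A)}"
proof -
  define Z m where "Z = cmod (cpart A)" and "m = cmod (apart A)"
  define \<alpha> \<beta> \<gamma> where "\<alpha> = (A$1$1)\<^sup>2 + (A$2$1)\<^sup>2" and "\<beta> = A$1$1 * A$1$2 + A$2$1 * A$2$2"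
    and "\<gamma> = (A$1$2)\<^sup>2 + (A$2$2)\<^sup>2"
  have ev: "(\<exists>v::real^2. v \<noteq> 0 \<and> (transpose A ** A) *v v = l *s v) \<longleftrightarrow>
      (\<exists>x y. (x, y) \<noteq> (0, 0) \<and> \<alpha> * x + \<beta> * y = l * x \<and> \<beta> * x + \<gamma> * y = l * y)" for l
  proof -
    have eq: "(transpose A ** A) *v v = l *s v \<longleftrightarrow>
      \<alpha> * v$1 + \<beta> * v$2 = l * v$1 \<and> \<beta> * v$1 + \<gamma> * v$2 = l * v$2" for v :: "real^2"
      by (simp add: vec_eq_iff forall_2 matrix_vector_mult_def matrix_matrix_mult_def transpose_def UNIV_2
        \<alpha>_def \<beta>_def \<gamma>_def power2_eq_square algebra_simps)
    have nz: "v \<noteq> 0 \<longleftrightarrow> (v$1, v$2) \<noteq> (0, 0)" for v :: "real^2" by (simp add: vec_eq_iff forall_2)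
    have ex: "(\<exists>v::real^2. Q (v$1) (v$2)) \<longleftrightarrow> (\<exists>x y. Q x y)" for Q
      by (metis vector_2)
    show ?thesis unfolding eq nz by (rule ex)
  qed
  have tr: "\<alpha> + \<gamma> = 2 * (Z\<^sup>2 + m\<^sup>2)"
    using norm_parts[of A] by (simp add: norm_matrix_sq UNIV_2 \<alpha>_def \<gamma>_def Z_def m_def)
  have dt: "\<alpha> * \<gamma> - \<beta>\<^sup>2 = (Z\<^sup>2 - m\<^sup>2)\<^sup>2"
  proof -
    have "\<alpha> * \<gamma> - \<beta>\<^sup>2 = (det A)\<^sup>2"
      by (simp add: \<alpha>_def \<beta>_def \<gamma>_def det_2 power2_eq_square algebra_simps)
    then show ?thesis by (simp add: det_parts Z_def m_def)
  qed
  have "(\<alpha> - l) * (\<gamma> - l) - \<beta>\<^sup>2 = (l - (Z + m)\<^sup>2) * (l - (Z - m)\<^sup>2)" for l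
  proof -
    have "(\<alpha> - l) * (\<gamma> - l) - \<beta>\<^sup>2 = (\<alpha> * \<gamma> - \<beta>\<^sup>2) - (\<alpha> + \<gamma>) * l + l\<^sup>2"
      by (simp add: power2_eq_square algebra_simps)
    also have "\<dots> = (l - (Z + m)\<^sup>2) * (l - (Z - m)\<^sup>2)"
      unfolding tr dt by (simp add: power2_eq_square algebra_simps)
    finally show ?thesis .
  qed
  then have "singular_values A = {s. 0 \<le> s \<and> (s\<^sup>2 = (Z + m)\<^sup>2 \<or> s\<^sup>2 = (Z - m)\<^sup>2)}"
    unfolding singular_values_def ev eigenvector_2_iff by simp
  also have "\<dots> = {\<bar>Z - m\<bar>, Z + m}"
  proof -
    have "0 \<le> Z" "0 \<le> m" by (simp_all add: Z_def m_def)
    then have "s\<^sup>2 = (Z + m)\<^sup>2 \<longleftrightarrow> s = Z + m" "s\<^sup>2 = (Z - m)\<^sup>2 \<longleftrightarrow> s = \<bar>Z - m\<bar>" if "0 \<le> s" for s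
      using that power2_eq_iff_nonneg[of s "Z + m"] power2_eq_iff_nonneg[of s "\<bar>Z - m\<bar>"] by simp_all
    then show ?thesis using \<open>0 \<le> Z\<close> \<open>0 \<le> m\<close> by auto
  qed
  finally show ?thesis by (simp add: Z_def m_def)
qed

lemma sv1_eq: "sv1 A = \<bar>cmod (cpart A) - cmod (apart A)\<bar>"
proof -
  have "\<bar>cmod (cpart A) - cmod (apart A)\<bar> \<le> cmod (cpart A) + cmod (apart A)"
    using norm_ge_zero[of "cpart A"] norm_ge_zero[of "apart A"] by linarith
  then show ?thesis unfolding sv1_def singular_values_eq by simp
qed

lemma sv2_eq: "sv2 A = cmod (cpart A) + cmod (apart A)"
proof -
  have "\<bar>cmod (cpart A) - cmod (apart A)\<bar> \<le> cmod (cpart A) + cmod (apart A)"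
    using norm_ge_zero[of "cpart A"] norm_ge_zero[of "apart A"] by linarith
  then show ?thesis unfolding sv2_def singular_values_eq by simp
qed

lemma of_parts_line:
  "of_parts (z + t *\<^sub>R p) (w + t *\<^sub>R q) = of_parts z w + t *\<^sub>R of_parts p q"
  by (simp add: of_parts_def vec_eq_iff forall_2 algebra_simps)

text \<open>In complex notation \<open>outer a n\<close> maps \<open>v\<close> to
  \<open>d * Re (cnj c * v)\<close>, whose parts are \<open>d * cnj c / 2\<close> and
  \<open>d * c / 2\<close>. Solving for \<open>p\<close> and \<open>q\<close> gives
  \<open>c^2 = q / p\<close> and \<open>d = 2 * p * c\<close>, hence the square root and the norm
  2.\<close>

lemma of_parts_rank_one:
  assumes "cmod p = 1" "cmod q = 1"
  obtains a n where "norm a = 2" "norm n = 1" "of_parts p q = outer a n"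
proof -
  define c where "c = csqrt (q / p)"
  have p: "p \<noteq> 0" using assms(1) by auto
  have c2: "c\<^sup>2 = q / p" by (simp add: c_def)
  have "(cmod c)\<^sup>2 = 1" using assms c2 by (metis norm_power norm_divide div_by_1)
  then have c: "cmod c = 1" by (metis norm_ge_zero power2_eq_iff_nonneg power_one zero_le_one)
  define d where "d = 2 * p * c"
  define a n :: "real^2" where "a = vector [Re d, Im d]" and "n = vector [Re c, Im c]"
  have n2: "(Re c)\<^sup>2 + (Im c)\<^sup>2 = 1" using c by (metis cmod_power2 power_one)
  have dp: "d * cnj c = 2 * p"
    using c by (simp add: d_def complex_norm_square[symmetric] mult.assoc)
  have dq: "d * c = 2 * q"
  proof -
    have "d * c = 2 * p * c\<^sup>2" by (simp add: d_def power2_eq_square)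
    then show ?thesis using p by (simp add: c2)
  qed
  have "norm n = 1" using n2 by (simp add: n_def norm_real_2)
  moreover have "norm a = 2"
  proof -
    have "cmod d = 2" using assms c by (simp add: d_def norm_mult)
    then show ?thesis by (simp add: a_def norm_real_2 cmod_def)
  qed
  moreover have "of_parts p q = outer a n"
  proof -
    have "2 * Re p = Re d * Re c + Im d * Im c" "2 * Im p = Im d * Re c - Re d * Im c"
      using arg_cong[OF dp, of Re] arg_cong[OF dp, of Im] by simp_all
    moreover have "2 * Re q = Re d * Re c - Im d * Im c" "2 * Im q = Re d * Im c + Im d * Re c"
      using arg_cong[OF dq, of Re] arg_cong[OF dq, of Im] by simp_all
    ultimately show ?thesis
      by (simp add: of_parts_def outer_def vec_eq_iff forall_2 a_def n_def field_simps)
  qed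
  ultimately show thesis using that by blast
qed

lemma movable_of_parts:
  assumes "cmod p = 1" "cmod q = 1" "0 \<le> \<delta>"
    and U: "\<And>t. \<bar>t\<bar> \<le> \<delta> \<Longrightarrow> of_parts (cpart A + t *\<^sub>R p) (apart A + t *\<^sub>R q) \<in> U"
  shows "movable U (2 * \<delta>) A"
proof -
  obtain a n where an: "norm a = 2" "norm n = 1" "of_parts p q = outer a n"
    using of_parts_rank_one[OF assms(1,2)] by blast
  have "A + outer (\<delta> *\<^sub>R a) (\<tau> *\<^sub>R n) \<in> U" if "\<bar>\<tau>\<bar> \<le> 1" for \<tau>
  proof -
    have "\<bar>\<delta> * \<tau>\<bar> \<le> \<delta> * 1" unfolding abs_mult using that assms(3) by (intro mult_mono) auto
    then have "of_parts (cpart A + (\<delta> * \<tau>) *\<^sub>R p) (apart A + (\<delta> * \<tau>) *\<^sub>R q) \<in> U" by (intro U) simp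
    then show ?thesis unfolding of_parts_line an(3) by (simp add: outer_scaleR mult.commute)
  qed
  moreover have "norm (\<delta> *\<^sub>R a) = 2 * \<delta>" using an(1) assms(3) by simp
  ultimately show ?thesis using an(2) unfolding movable_def by blast
qed

section \<open>Rank-one perturbations\<close>

text \<open>\<open>B\<close> is the largest second coordinate and is attained;
  \<open>(c0, B)\<close> serves as an explicit competitor in maxima over \<open>K\<close>.\<close>

locale singular_value_set =
  fixes K :: "(real \<times> real) set" and B x0 c0 :: real
  assumes compact_K: "compact K" and x0_pos: "0 < x0"
    and K_bounds: "(a, b) \<in> K \<Longrightarrow> x0 \<le> a \<and> a \<le> b \<and> b \<le> B" and c0_in: "(c0, B) \<in> K"
begin

definition val :: "real \<Rightarrow> real \<times> real \<Rightarrow> real" where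
  "val \<theta> k = fst k * snd k + \<theta> * (snd k - fst k)"

text \<open>For singular values \<open>x \<le> y\<close>; the condition says
  \<open>f \<theta> x y < max\<^sub>K (f \<theta>)\<close> with \<open>f \<theta> x y = x * y + \<theta> * (y - x)\<close>.\<close>

definition below :: "real \<Rightarrow> real \<Rightarrow> bool" where
  "below x y \<longleftrightarrow> (\<forall>\<theta>\<in>{0..B}. \<exists>k\<in>K. x * y + \<theta> * (y - x) < val \<theta> k)"

definition maxi :: "real \<Rightarrow> real \<times> real \<Rightarrow> bool" where
  "maxi \<theta> k \<longleftrightarrow> k \<in> K \<and> (\<forall>k'\<in>K. val \<theta> k' \<le> val \<theta> k)"

lemma B_pos: "0 < B" and c0_bounds: "x0 \<le> c0" "c0 \<le> B"
  using K_bounds[OF c0_in] x0_pos by auto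

lemma K_bounds': "k \<in> K \<Longrightarrow> x0 \<le> fst k \<and> fst k \<le> snd k \<and> snd k \<le> B"
  using K_bounds[of "fst k" "snd k"] by simp

text \<open>Exactly, \<open>val \<theta> (c0, B) = \<theta> * B + c0 * (B - \<theta>)\<close>, and
  \<open>x0\<close> is at most \<open>c0\<close>.\<close>

lemma val_c0:
  assumes "0 \<le> \<theta>" "\<theta> \<le> B"
  shows "\<theta> * B + x0 * (B - \<theta>) \<le> val \<theta> (c0, B)"
  using mult_right_mono[OF c0_bounds(1), of "B - \<theta>"] assms by (simp add: val_def algebra_simps)

lemma val_B: "k \<in> K \<Longrightarrow> val B k \<le> B\<^sup>2"
proof -
  assume "k \<in> K"
  then have "0 \<le> (fst k + B) * (B - snd k)"
    using K_bounds'[of k] x0_pos B_pos by (intro mult_nonneg_nonneg) auto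
  then show ?thesis by (simp add: val_def power2_eq_square algebra_simps)
qed

text \<open>From \<open>x * y + \<theta> * (y - x) - \<theta>^2 = (x + \<theta>) * (y -
  \<theta>)\<close>: the parameter \<open>\<theta> = B\<close> encodes the bound on the larger
  singular value.\<close>

lemma below_lt_B:
  assumes "below x y" "0 \<le> x"
  shows "y < B"
proof -
  obtain k where "k \<in> K" "x * y + B * (y - x) < val B k"
    using assms(1) B_pos unfolding below_def by force
  then have "x * y + B * (y - x) < B\<^sup>2" using val_B by fastforce
  then have "(x + B) * (y - B) < 0" by (simp add: power2_eq_square algebra_simps)
  then show ?thesis using assms(2) B_pos by (simp add: mult_less_0_iff)
qed

text \<open>For \<open>x\<close> up to \<open>x0\<close> the competitor \<open>(c0, B)\<close>
  settles every \<theta>. This leaves room around the matrices of determinant 0.\<close>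

lemma below_small:
  assumes "0 \<le> x" "x \<le> y" "y < B" "x \<le> x0"
  shows "below x y"
  unfolding below_def
proof
  fix \<theta> assume "\<theta> \<in> {0..B}"
  then have \<theta>: "0 \<le> \<theta>" "\<theta> \<le> B" by auto
  have "x * y + \<theta> * (y - x) < \<theta> * B + x0 * (B - \<theta>)"
  proof (cases "\<theta> \<le> y")
    case True
    have "x * y + \<theta> * (y - x) = \<theta> * y + x * (y - \<theta>)" by (simp add: algebra_simps)
    also have "\<dots> \<le> \<theta> * y + x0 * (y - \<theta>)" using assms(4) True by (simp add: mult_right_mono)
    also have "\<dots> = y * (\<theta> + x0) - x0 * \<theta>" by (simp add: algebra_simps)
    also have "\<dots> < B * (\<theta> + x0) - x0 * \<theta>" using assms(3) \<theta>(1) x0_pos by (simp add: mult_strict_right_mono add_nonneg_pos)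
    finally show ?thesis by (simp add: algebra_simps)
  next
    case False
    then have "x * y + \<theta> * (y - x) \<le> \<theta> * y" using assms(1) mult_left_mono[of y \<theta> x] by (simp add: algebra_simps)
    also have "\<dots> < \<theta> * B" using False assms by (intro mult_strict_left_mono) auto
    also have "\<dots> \<le> \<theta> * B + x0 * (B - \<theta>)" using \<theta> x0_pos by simp
    finally show ?thesis .
  qed
  then show "\<exists>k\<in>K. x * y + \<theta> * (y - x) < val \<theta> k" using val_c0[OF \<theta>] c0_in by force
qed

lemma continuous_on_val [continuous_intros]:
  assumes "continuous_on X f" "continuous_on X g"
  shows "continuous_on X (\<lambda>p. val (f p) (g p))"
  unfolding val_def using assms by (intro continuous_intros)

lemma maxi_exists: "\<exists>k. maxi \<theta> k"
proof -
  have "continuous_on K (val \<theta>)" unfolding val_def by (intro continuous_intros)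
  then obtain k where "k \<in> K" "\<forall>k'\<in>K. val \<theta> k' \<le> val \<theta> k"
    using continuous_attains_sup[OF compact_K] c0_in by blast
  then show ?thesis unfolding maxi_def by blast
qed

lemma maxi_val: "maxi \<theta> k \<Longrightarrow> maxi \<theta> k' \<Longrightarrow> val \<theta> k = val \<theta> k'"
  unfolding maxi_def by (meson order_antisym)

text \<open>The maximizers of \<open>val \<theta>\<close> move from slope at most \<open>m\<close> to slope at least \<open>m\<close>
  as \<open>\<theta>\<close> increases; a parameter where both kinds occur exists because the interval is connected.\<close>

lemma balanced_parameter:
  obtains \<theta> where "0 \<le> \<theta>" "\<theta> \<le> B" "\<theta> = B \<or> (\<exists>k. maxi \<theta> k \<and> m \<le> (snd k - fst k) / 2)"
    "\<theta> = 0 \<or> (\<exists>k. maxi \<theta> k \<and> (snd k - fst k) / 2 \<le> m)"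
proof -
  \<comment> \<open>Written as the projection of a closed set of pairs along the compact
    \<open>K\<close>, which makes the set of parameters closed.\<close>
  define up where "up = {\<theta>. \<exists>k. k \<in> K \<and> (k, \<theta>) \<in> {p. 0 \<le> snd p \<and> snd p \<le> B \<and>
      m \<le> (snd (fst p) - fst (fst p)) / 2 \<and> (\<forall>k'\<in>K. val (snd p) k' \<le> val (snd p) (fst p))}}"
  define dn where "dn = {\<theta>. \<exists>k. k \<in> K \<and> (k, \<theta>) \<in> {p. 0 \<le> snd p \<and> snd p \<le> B \<and>
      (snd (fst p) - fst (fst p)) / 2 \<le> m \<and> (\<forall>k'\<in>K. val (snd p) k' \<le> val (snd p) (fst p))}}"
  have cl: "closed {p. \<forall>k'\<in>K. val (snd p) k' \<le> val (snd p) (fst p)}"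
  proof -
    have "{p. \<forall>k'\<in>K. val (snd p) k' \<le> val (snd p) (fst p)} = (\<Inter>k'\<in>K. {p. val (snd p) k' \<le> val (snd p) (fst p)})"
      by auto
    then show ?thesis by (auto intro!: closed_INT closed_Collect_le continuous_intros)
  qed
  have cu: "closed up" unfolding up_def
    by (intro closed_compact_projection[OF compact_K] closed_Collect_conj cl closed_Collect_le continuous_intros) auto
  have cd: "closed dn" unfolding dn_def
    by (intro closed_compact_projection[OF compact_K] closed_Collect_conj cl closed_Collect_le continuous_intros) auto
  have cover: "\<theta> \<in> up \<or> \<theta> \<in> dn" if "\<theta> \<in> {0..B}" for \<theta>
  proof -
    obtain k where k: "maxi \<theta> k" using maxi_exists by blast
    show ?thesis
    proof (cases "m \<le> (snd k - fst k) / 2")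
      case True
      then have "\<theta> \<in> up" using that k unfolding up_def maxi_def mem_Collect_eq by (intro exI[of _ k]) simp
      then show ?thesis ..
    next
      case False
      then have "\<theta> \<in> dn" using that k unfolding dn_def maxi_def mem_Collect_eq by (intro exI[of _ k]) simp
      then show ?thesis ..
    qed
  qed
  have up: "\<exists>k. maxi \<theta> k \<and> m \<le> (snd k - fst k) / 2" if "\<theta> \<in> up" for \<theta>
    using that unfolding up_def maxi_def by auto
  have dn: "\<exists>k. maxi \<theta> k \<and> (snd k - fst k) / 2 \<le> m" if "\<theta> \<in> dn" for \<theta>
    using that unfolding dn_def maxi_def by auto
  \<comment> \<open>If \<open>up\<close> and \<open>dn\<close> do not meet in the interval,
    connectedness empties one of them there, and an endpoint serves.\<close>
  consider \<theta> where "\<theta> \<in> {0..B}" "\<theta> \<in> up" "\<theta> \<in> dn" | "B \<in> dn" | "0 \<in> up"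
  proof (cases "up \<inter> dn \<inter> {0..B} = {}")
    case True
    have "{0..B} \<subseteq> up \<union> dn" using cover by blast
    then have "up \<inter> {0..B} = {} \<or> dn \<inter> {0..B} = {}"
      by (rule connected_closedD[OF connected_Icc True _ cu cd])
    moreover have "0 \<in> {0..B}" "B \<in> {0..B}" using B_pos by auto
    ultimately show ?thesis using cover[of 0] cover[of B] that(2,3) by blast
  qed (use that(1) in blast)
  then show thesis
  proof cases
    case 1 then show ?thesis using that[of \<theta>] up dn by auto
  next
    case 2 then show ?thesis using that[of B] dn B_pos by auto
  next
    case 3 then show ?thesis using that[of 0] up B_pos by auto
  qed
qed

text \<open>With \<open>Zk\<close>, \<open>mk\<close> half the sum and half the difference of
  \<open>k\<close>, \<open>val \<theta> k = Zk^2 - mk^2 + 2 \<theta> mk\<close>. So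
  \<open>|Zk^2 - Z^2|\<close> is at most \<open>8 B \<delta>\<close> from the gap plus
  \<open>2 B \<delta>\<close> from each of the terms with \<open>mk - m\<close>; dividing by
  \<open>Zk + Z \<ge> x0\<close> gives \<open>12 * B / x0\<close>.\<close>

lemma near_maximizer:
  assumes "0 \<le> \<theta>" "\<theta> \<le> B" "k \<in> K" "0 \<le> m" "m \<le> Z" "Z + m \<le> B"
    and v: "val \<theta> k = Z\<^sup>2 - m\<^sup>2 + 2 * \<theta> * m + \<gamma>" "0 \<le> \<gamma>" "\<gamma> \<le> 8 * B * \<delta>"
    and s: "\<bar>(snd k - fst k) / 2 - m\<bar> \<le> \<delta>"
  shows "\<bar>Z - (fst k + snd k) / 2\<bar> + \<bar>m - (snd k - fst k) / 2\<bar> \<le> \<delta> * (1 + 12 * B / x0)"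
proof -
  define Zk mk where "Zk = (fst k + snd k) / 2" and "mk = (snd k - fst k) / 2"
  have k: "x0 \<le> fst k" "fst k \<le> snd k" "snd k \<le> B" using K_bounds'[OF assms(3)] by auto
  have Zk: "x0 \<le> Zk" and mk: "0 \<le> mk" "mk \<le> B" using k x0_pos by (auto simp: Zk_def mk_def)
  have v': "val \<theta> k = Zk\<^sup>2 - mk\<^sup>2 + 2 * \<theta> * mk"
    by (simp add: val_def Zk_def mk_def power2_eq_square field_simps)
  have s': "\<bar>mk - m\<bar> \<le> \<delta>" using s by (simp add: mk_def)
  have \<delta>: "0 \<le> \<delta>" using s' by linarith
  have "Zk\<^sup>2 - Z\<^sup>2 = \<gamma> - 2 * \<theta> * (mk - m) + (mk + m) * (mk - m)"
    using v v' by (simp add: power2_eq_square algebra_simps)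
  moreover have "\<bar>2 * \<theta> * (mk - m)\<bar> \<le> 2 * B * \<delta>"
    unfolding abs_mult using assms(1,2) s' B_pos by (intro mult_mono) auto
  moreover have "\<bar>(mk + m) * (mk - m)\<bar> \<le> (2 * B) * \<delta>"
    unfolding abs_mult using s' mk assms(4-6) B_pos by (intro mult_mono) auto
  ultimately have "\<bar>Zk\<^sup>2 - Z\<^sup>2\<bar> \<le> 12 * B * \<delta>" using v(2,3) by linarith
  moreover have "\<bar>Zk\<^sup>2 - Z\<^sup>2\<bar> = (Zk + Z) * \<bar>Zk - Z\<bar>"
  proof -
    have "Zk\<^sup>2 - Z\<^sup>2 = (Zk + Z) * (Zk - Z)" by (simp add: power2_eq_square algebra_simps)
    then show ?thesis using Zk x0_pos assms(4,5) by (simp add: abs_mult)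
  qed
  moreover have "x0 * \<bar>Zk - Z\<bar> \<le> (Zk + Z) * \<bar>Zk - Z\<bar>" using Zk assms(4,5) by (intro mult_right_mono) auto
  ultimately have "x0 * \<bar>Zk - Z\<bar> \<le> 12 * B * \<delta>" by linarith
  then have "\<bar>Zk - Z\<bar> \<le> \<delta> * (12 * B / x0)" using x0_pos by (simp add: field_simps)
  then show ?thesis using s' unfolding Zk_def[symmetric] mk_def[symmetric]
    by (simp add: abs_minus_commute algebra_simps)
qed

text \<open>Along the perturbation of the conformal and anticonformal parts used below,
  \<open>m\<close> moves by \<open>t\<close> while the determinant \<open>d\<close> moves by \<open>- 2 * \<theta>s * t\<close>, so that
  \<open>d + 2 * \<theta>s * m\<close> is conserved.\<close>

lemma conserved_move:
  assumes below: "below (Z - m) (Z + m)" and m: "0 \<le> m" "m \<le> Z" and x: "x0 / 4 < Z - m"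
    and \<delta>: "0 < \<delta>" "\<delta> \<le> x0 / 8" "2 * B * \<delta> < x0\<^sup>2 / 16"
    and far: "\<And>k. k \<in> K \<Longrightarrow> \<delta> * (1 + 12 * B / x0) < \<bar>Z - (fst k + snd k) / 2\<bar> + \<bar>m - (snd k - fst k) / 2\<bar>"
  obtains \<theta>s where "0 \<le> \<theta>s" "\<theta>s \<le> Z + m"
    "\<And>t Z'. \<bar>t\<bar> \<le> \<delta> \<Longrightarrow> 0 \<le> Z' \<Longrightarrow> Z'\<^sup>2 - (m + t)\<^sup>2 = Z\<^sup>2 - m\<^sup>2 - 2 * \<theta>s * t \<Longrightarrow>
       \<bar>m + t\<bar> \<le> Z' \<and> below (Z' - \<bar>m + t\<bar>) (Z' + \<bar>m + t\<bar>)"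
proof -
  define d where "d = Z\<^sup>2 - m\<^sup>2"
  define y where "y = Z + m"
  define mu where "mu k = (snd k - fst k) / 2" for k :: "real \<times> real"
  have yB: "y < B" using below_lt_B[OF below] m by (simp add: y_def)
  have y0: "0 < y" using m x x0_pos by (simp add: y_def)
  have d_eq: "d = y * (y - 2 * m)" by (simp add: d_def y_def power2_eq_square algebra_simps)
  have bel: "\<exists>k\<in>K. d + 2 * \<theta> * m < val \<theta> k" if "0 \<le> \<theta>" "\<theta> \<le> B" for \<theta>
    using below that unfolding below_def d_def by (force simp: power2_eq_square algebra_simps)
  obtain \<theta>0 where \<theta>0: "0 \<le> \<theta>0" "\<theta>0 \<le> B"
    and up0: "\<theta>0 = B \<or> (\<exists>k. maxi \<theta>0 k \<and> m \<le> mu k)" and dn0: "\<theta>0 = 0 \<or> (\<exists>k. maxi \<theta>0 k \<and> mu k \<le> m)"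
    using balanced_parameter[of m] unfolding mu_def by blast
  obtain k0 where k0: "maxi \<theta>0 k0" using maxi_exists by blast
  define \<gamma> where "\<gamma> = val \<theta>0 k0 - (d + 2 * \<theta>0 * m)"
  have \<gamma>: "0 < \<gamma>" using bel[OF \<theta>0] k0 unfolding \<gamma>_def maxi_def by force
  have max\<gamma>: "val \<theta>0 k = d + 2 * \<theta>0 * m + \<gamma>" if "maxi \<theta>0 k" for k
    using maxi_val[OF that k0] by (simp add: \<gamma>_def)
  have val_shift: "val \<theta> k = d + 2 * \<theta> * m + \<gamma> + 2 * (\<theta> - \<theta>0) * (mu k - m)" if "maxi \<theta>0 k" for \<theta> k
    using max\<gamma>[OF that] by (simp add: val_def mu_def field_simps)
  \<comment> \<open>\<gamma> is the least gap over all parameters: \<open>val\<close> is affine in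
    \<theta>, and on either side of \<open>\<theta>0\<close> some maximizer has a slope that keeps
    the gap from shrinking.\<close>
  have gap: "\<exists>k\<in>K. d + 2 * \<theta> * m + \<gamma> \<le> val \<theta> k" if \<theta>: "0 \<le> \<theta>" "\<theta> \<le> B" for \<theta>
  proof -
    consider "\<theta> = \<theta>0" | "\<theta>0 < \<theta>" | "\<theta> < \<theta>0" by linarith
    then show ?thesis
    proof cases
      case 1 then show ?thesis using max\<gamma>[OF k0] k0 by (auto simp: maxi_def intro!: bexI[of _ k0])
    next
      case 2
      then obtain k where k: "maxi \<theta>0 k" "m \<le> mu k" using up0 \<theta> by auto
      have "0 \<le> 2 * (\<theta> - \<theta>0) * (mu k - m)" using 2 k by simp
      then show ?thesis using val_shift[OF k(1), of \<theta>] k(1) by (auto simp: maxi_def intro!: bexI[of _ k])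
    next
      case 3
      then obtain k where k: "maxi \<theta>0 k" "mu k \<le> m" using dn0 \<theta> by auto
      have "0 \<le> 2 * (\<theta> - \<theta>0) * (mu k - m)" using 3 k by (simp add: mult_nonpos_nonpos)
      then show ?thesis using val_shift[OF k(1), of \<theta>] k(1) by (auto simp: maxi_def intro!: bexI[of _ k])
    qed
  qed
  \<comment> \<open>When the gap is small, a maximizer with \<open>mu k\<close> near
    \<open>m\<close> would by \<open>near_maximizer\<close> lie too close to \<open>(Z, m)\<close>,
    against \<open>far\<close>.\<close>
  have sep: "\<delta> < \<bar>mu k - m\<bar>" if "\<gamma> \<le> 8 * B * \<delta>" "maxi \<theta>0 k" for k
  proof (rule ccontr)
    assume "\<not> \<delta> < \<bar>mu k - m\<bar>"
    moreover have "k \<in> K" using that(2) by (simp add: maxi_def)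
    ultimately show False
      using near_maximizer[of \<theta>0 k m Z \<gamma> \<delta>] far[of k] max\<gamma>[OF that(2)] that(1) \<theta>0 m yB \<gamma>
      by (auto simp: mu_def d_def y_def)
  qed
  \<comment> \<open>Truncated at \<open>y\<close>, because a unit direction can produce the
    prescribed change of determinant only if \<open>|m - \<theta>s| \<le> Z\<close>.\<close>
  define \<theta>s where "\<theta>s = min \<theta>0 y"
  have \<theta>s: "0 \<le> \<theta>s" "\<theta>s \<le> y" "\<theta>s \<le> \<theta>0" "\<theta>s \<le> B" using \<theta>0 y0 by (auto simp: \<theta>s_def)
  have key: "\<exists>k\<in>K. d - 2 * \<theta>s * t + 2 * \<theta> * \<bar>m + t\<bar> < val \<theta> k"
    if t: "\<bar>t\<bar> \<le> \<delta>" and \<theta>: "0 \<le> \<theta>" "\<theta> \<le> B" for t \<theta>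
  proof (cases "\<gamma> \<le> 8 * B * \<delta>")
    case False
    \<comment> \<open>A large gap absorbs the move, which costs at most
      \<open>4 * B * \<delta>\<close>.\<close>
    have "\<bar>\<theta>s * t\<bar> \<le> B * \<delta>" unfolding abs_mult using \<theta>s t by (intro mult_mono) auto
    moreover have "\<theta> * \<bar>m + t\<bar> \<le> \<theta> * (m + \<delta>)" using \<theta> t m by (intro mult_left_mono) auto
    moreover have "\<theta> * \<delta> \<le> B * \<delta>" using \<theta> \<delta> by (intro mult_right_mono) auto
    moreover have "0 < B * \<delta>" using B_pos \<delta> by simp
    ultimately have "d - 2 * \<theta>s * t + 2 * \<theta> * \<bar>m + t\<bar> < d + 2 * \<theta> * m + \<gamma>"
      using False by (simp add: algebra_simps)
    then show ?thesis using gap[OF \<theta>] by force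
  next
    case True
    have up: "\<exists>k. maxi \<theta>0 k \<and> m + \<delta> < mu k" if lt: "\<theta>0 < B"
    proof -
      obtain k where k: "maxi \<theta>0 k" "m \<le> mu k" using up0 lt by auto
      then show ?thesis using sep[OF True k(1)] by (intro exI[of _ k]) auto
    qed
    have dn: "\<exists>k. maxi \<theta>0 k \<and> mu k < m - \<delta>" if pos: "0 < \<theta>0"
    proof -
      obtain k where k: "maxi \<theta>0 k" "mu k \<le> m" using dn0 pos by auto
      then show ?thesis using sep[OF True k(1)] by (intro exI[of _ k]) auto
    qed
    \<comment> \<open>\<open>mu\<close> is nonnegative on \<open>K\<close>, so a maximizer with
      \<open>mu k < m - \<delta>\<close> forces \<open>m > \<delta>\<close>. The absolute value of
      \<open>m + t\<close> thus matters only for \<open>\<theta>0 = 0\<close>.\<close>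
    have mt: "0 \<le> m + t" if pos: "0 < \<theta>0"
    proof -
      obtain k where k: "maxi \<theta>0 k" "mu k < m - \<delta>" using dn[OF pos] by blast
      moreover have "0 \<le> mu k" using k(1) K_bounds'[of k] by (auto simp: mu_def maxi_def)
      ultimately show ?thesis using t by linarith
    qed
    \<comment> \<open>Left of \<open>\<theta>s\<close> the flat maximizer is the competitor, right
      of it the steep one; if \<open>\<theta>s\<close> was truncated, \<open>(c0, B)\<close>
      replaces the latter because \<open>y < B\<close>.\<close>
    consider "\<theta> < \<theta>s" | "\<theta>s \<le> \<theta>" "\<theta>0 \<le> y" | "\<theta>s \<le> \<theta>" "y < \<theta>0" by linarith
    then show ?thesis
    proof cases
      case 1
      then have pos: "0 < \<theta>0" using \<theta> \<theta>s by linarith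
      obtain k where k: "maxi \<theta>0 k" "mu k < m - \<delta>" using dn[OF pos] by blast
      have "(\<theta>s - \<theta>) * (- t) \<le> (\<theta>s - \<theta>) * \<delta>" using 1 t by (intro mult_left_mono) auto
      moreover have "(\<theta>s - \<theta>) * \<delta> \<le> (\<theta>0 - \<theta>) * (m - mu k)" using 1 \<theta>s k \<delta> by (intro mult_mono) auto
      ultimately have "d - 2 * \<theta>s * t + 2 * \<theta> * (m + t) < val \<theta> k"
        unfolding val_shift[OF k(1)] using \<gamma> by (simp add: algebra_simps)
      then show ?thesis using mt[OF pos] k(1) by (auto simp: maxi_def)
    next
      case 2
      then have eq: "\<theta>s = \<theta>0" and lt: "\<theta>0 < B" using yB by (auto simp: \<theta>s_def)
      obtain k where k: "maxi \<theta>0 k" "m + \<delta> < mu k" using up[OF lt] by blast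
      have sgn: "(\<theta> - \<theta>0) * s \<le> (\<theta> - \<theta>0) * (mu k - m)" if "s \<le> \<delta>" for s
        by (rule mult_left_mono) (use 2 eq k that in auto)
      have "d - 2 * \<theta>s * t + 2 * \<theta> * \<bar>m + t\<bar> < val \<theta> k"
      proof (cases "0 \<le> m + t")
        case True
        then show ?thesis
          unfolding val_shift[OF k(1)] eq using \<gamma> sgn[OF abs_le_D1[OF t]] by (simp add: algebra_simps)
      next
        case False
        then have "\<theta>0 = 0" using mt \<theta>0 by linarith
        moreover have "0 \<le> \<theta> * m" using \<theta> m by simp
        ultimately show ?thesis
          unfolding val_shift[OF k(1)] eq using False \<gamma> sgn[OF abs_le_D2[OF t]] by (simp add: algebra_simps)
      qed
      then show ?thesis using k(1) unfolding maxi_def by blast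
    next
      case 3
      then have eq: "\<theta>s = y" and pos: "0 < \<theta>0" using y0 by (auto simp: \<theta>s_def)
      have "2 * (m + t) \<le> y" using x t \<delta> by (simp add: y_def)
      then have "(\<theta> - y) * (2 * (m + t)) \<le> (\<theta> - y) * y" using 3 eq by (intro mult_left_mono) auto
      then have "d - 2 * \<theta>s * t + 2 * \<theta> * (m + t) \<le> \<theta> * y" unfolding eq d_eq by (simp add: algebra_simps)
      also have "\<dots> < \<theta> * B" using 3 eq y0 yB by (intro mult_strict_left_mono) auto
      also have "\<dots> \<le> \<theta> * B + x0 * (B - \<theta>)" using \<theta> x0_pos by simp
      also have "\<dots> \<le> val \<theta> (c0, B)" by (rule val_c0[OF \<theta>])
      finally show ?thesis using mt[OF pos] c0_in by auto
    qed
  qed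
  show thesis
  proof (rule that[of \<theta>s])
    show "0 \<le> \<theta>s" "\<theta>s \<le> Z + m" using \<theta>s by (auto simp: y_def)
    fix t Z' assume t: "\<bar>t\<bar> \<le> \<delta>" and Z': "0 \<le> Z'" "Z'\<^sup>2 - (m + t)\<^sup>2 = Z\<^sup>2 - m\<^sup>2 - 2 * \<theta>s * t"
    have "\<bar>\<theta>s * t\<bar> \<le> B * \<delta>" unfolding abs_mult using \<theta>s t by (intro mult_mono) auto
    \<comment> \<open>The determinant is at least \<open>(x0 / 4)^2\<close>, so the bound on
      \<open>2 * B * \<delta>\<close> prevents it from changing sign along the move.\<close>
    moreover have "x0\<^sup>2 / 16 \<le> d"
    proof -
      have "x0 / 4 * (x0 / 4) \<le> y * (y - 2 * m)" using x m x0_pos by (intro mult_mono) (auto simp: y_def)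
      then show ?thesis by (simp add: d_eq power2_eq_square)
    qed
    ultimately have "0 \<le> Z'\<^sup>2 - (m + t)\<^sup>2" using Z'(2) \<delta>(3) unfolding d_def by linarith
    then have le: "\<bar>m + t\<bar> \<le> Z'" using Z'(1) abs_le_square_iff[of "m + t" Z'] by simp
    have "(Z' - \<bar>m + t\<bar>) * (Z' + \<bar>m + t\<bar>) = d - 2 * \<theta>s * t"
    proof -
      have "(Z' - \<bar>m + t\<bar>) * (Z' + \<bar>m + t\<bar>) = Z'\<^sup>2 - \<bar>m + t\<bar>\<^sup>2" by (simp add: power2_eq_square algebra_simps)
      then show ?thesis using Z'(2) by (simp add: d_def)
    qed
    moreover have "\<theta> * ((Z' + \<bar>m + t\<bar>) - (Z' - \<bar>m + t\<bar>)) = 2 * \<theta> * \<bar>m + t\<bar>" for \<theta> by simp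
    ultimately have eqs: "(Z' - \<bar>m + t\<bar>) * (Z' + \<bar>m + t\<bar>) = d - 2 * \<theta>s * t"
      "\<And>\<theta>. \<theta> * ((Z' + \<bar>m + t\<bar>) - (Z' - \<bar>m + t\<bar>)) = 2 * \<theta> * \<bar>m + t\<bar>" by blast+
    have "below (Z' - \<bar>m + t\<bar>) (Z' + \<bar>m + t\<bar>)"
      unfolding below_def eqs by (intro ballI key[OF t]) auto
    with le show "\<bar>m + t\<bar> \<le> Z' \<and> below (Z' - \<bar>m + t\<bar>) (Z' + \<bar>m + t\<bar>)" by blast
  qed
qed

end

section \<open>The open set of matrices and its rank-one segments\<close>

context singular_value_set
begin

definition Uset :: "(real^2^2) set" where
  "Uset = {A. below (sv1 A) (sv2 A)}"

lemma continuous_on_sv [continuous_intros]: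
  assumes "continuous_on X f"
  shows "continuous_on X (\<lambda>x. sv1 (f x))" "continuous_on X (\<lambda>x. sv2 (f x))"
proof -
  show "continuous_on X (\<lambda>x. sv1 (f x))" unfolding sv1_eq by (intro continuous_intros assms)
  show "continuous_on X (\<lambda>x. sv2 (f x))" unfolding sv2_eq by (intro continuous_intros assms)
qed

text \<open>The complement is the projection of a closed set along the compact interval of
  parameters.\<close>

lemma open_Uset: "open Uset"
proof -
  define T where "T = {p. \<forall>k\<in>K. val (fst p) k \<le> sv1 (snd p) * sv2 (snd p) + fst p * (sv2 (snd p) - sv1 (snd p))}"
  have "T = (\<Inter>k\<in>K. {p. val (fst p) k \<le> sv1 (snd p) * sv2 (snd p) + fst p * (sv2 (snd p) - sv1 (snd p))})"
    unfolding T_def by auto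
  moreover have "closed {p. val (fst p) k \<le> sv1 (snd p) * sv2 (snd p) + fst p * (sv2 (snd p) - sv1 (snd p))}" for k
    by (intro closed_Collect_le continuous_intros)
  ultimately have "closed T" by auto
  then have "closed {A. \<exists>\<theta>. \<theta> \<in> {0..B} \<and> (\<theta>, A) \<in> T}"
    by (intro closed_compact_projection) auto
  moreover have "(\<exists>\<theta>. \<theta> \<in> {0..B} \<and> (\<theta>, A) \<in> T) \<longleftrightarrow> A \<notin> Uset" for A
    unfolding Uset_def below_def T_def mem_Collect_eq fst_conv snd_conv not_less[symmetric] by blast
  then have "{A. \<exists>\<theta>. \<theta> \<in> {0..B} \<and> (\<theta>, A) \<in> T} = - Uset" by blast
  ultimately show ?thesis by (simp add: open_closed)
qed

lemma sv_nonneg: "0 \<le> sv1 A" "sv1 A \<le> sv2 A"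
  unfolding sv1_eq sv2_eq using norm_ge_zero[of "cpart A"] norm_ge_zero[of "apart A"] by linarith+

lemma norm_Uset: "A \<in> Uset \<Longrightarrow> norm A \<le> 2 * B"
  using below_lt_B[of "sv1 A" "sv2 A"] sv_nonneg[of A] norm_le_parts[of A]
  unfolding Uset_def sv2_eq by simp

lemma unit_direction: "\<exists>e. cmod e = 1 \<and> z = cmod z *\<^sub>R e"
proof (cases "z = 0")
  case True then show ?thesis by (intro exI[of _ 1]) simp
next
  case False then show ?thesis by (intro exI[of _ "sgn z"]) (simp add: norm_sgn sgn_div_norm)
qed

lemma move_direction:
  fixes z w :: complex
  assumes wz: "cmod w \<le> cmod z" and below: "below (cmod z - cmod w) (cmod z + cmod w)"
    and \<delta>: "0 < \<delta>" "\<delta> \<le> x0 / 8" "2 * B * \<delta> < x0\<^sup>2 / 16"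
    and far: "\<And>k. k \<in> K \<Longrightarrow>
      \<delta> * (1 + 12 * B / x0) < \<bar>cmod z - (fst k + snd k) / 2\<bar> + \<bar>cmod w - (snd k - fst k) / 2\<bar>"
  obtains p q where "cmod p = 1" "cmod q = 1" "\<And>t. \<bar>t\<bar> \<le> \<delta> \<Longrightarrow>
    below \<bar>cmod (z + t *\<^sub>R p) - cmod (w + t *\<^sub>R q)\<bar> (cmod (z + t *\<^sub>R p) + cmod (w + t *\<^sub>R q))"
proof -
  define Z m where "Z = cmod z" and "m = cmod w"
  have Zm: "0 \<le> m" "m \<le> Z" using wz by (auto simp: Z_def m_def)
  obtain e where e: "cmod e = 1" "z = Z *\<^sub>R e" using unit_direction[of z] unfolding Z_def by blast
  obtain f where f: "cmod f = 1" "w = m *\<^sub>R f" using unit_direction[of w] unfolding m_def by blast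
  have wt: "cmod (w + t *\<^sub>R f) = \<bar>m + t\<bar>" for t
  proof -
    have "w + t *\<^sub>R f = (m + t) *\<^sub>R f" unfolding f(2) by (simp only: scaleR_left_distrib)
    then show ?thesis using f(1) by simp
  qed
  show thesis
  proof (cases "Z - m \<le> x0 / 4")
    case True
    txt \<open>Here one singular value is fixed while the small one passes through zero, that is, the sign
      of the determinant may change.\<close>
    have zt: "cmod (z + t *\<^sub>R (- e)) = \<bar>Z - t\<bar>" for t
    proof -
      have "z + t *\<^sub>R (- e) = (Z - t) *\<^sub>R e" unfolding e(2) by (simp add: scaleR_left_diff_distrib)
      then show ?thesis using e(1) by simp
    qed
    have "Z + m < B" using below_lt_B[OF below] Zm by (simp add: Z_def m_def)
    have "below \<bar>\<bar>Z - t\<bar> - \<bar>m + t\<bar>\<bar> (\<bar>Z - t\<bar> + \<bar>m + t\<bar>)" if t: "\<bar>t\<bar> \<le> \<delta>" for t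
    proof (rule below_small)
      have "x0 \<le> B" using c0_bounds by linarith
      then show "\<bar>Z - t\<bar> + \<bar>m + t\<bar> < B" using \<open>Z + m < B\<close> t \<delta>(2) True Zm x0_pos by linarith
      show "\<bar>\<bar>Z - t\<bar> - \<bar>m + t\<bar>\<bar> \<le> x0" using t \<delta>(2) True Zm x0_pos by linarith
    qed linarith+
    then show ?thesis using e(1) f(1) by (intro that[of "- e" f]) (simp_all only: zt wt norm_minus_cancel)
  next
    case False
    then have x: "x0 / 4 < Z - m" by simp
    obtain \<theta> where \<theta>: "0 \<le> \<theta>" "\<theta> \<le> Z + m"
      "\<And>t Z'. \<bar>t\<bar> \<le> \<delta> \<Longrightarrow> 0 \<le> Z' \<Longrightarrow> Z'\<^sup>2 - (m + t)\<^sup>2 = Z\<^sup>2 - m\<^sup>2 - 2 * \<theta> * t \<Longrightarrow>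
       \<bar>m + t\<bar> \<le> Z' \<and> below (Z' - \<bar>m + t\<bar>) (Z' + \<bar>m + t\<bar>)"
      by (rule conserved_move[OF below[folded Z_def m_def] Zm x \<delta> far[folded Z_def m_def]]) (assumption, blast)
    have Z: "0 < Z" using False Zm x0_pos by linarith
    \<comment> \<open>A unit direction with component \<open>c\<close> along \<open>e\<close> gives
      \<open>Z'^2 = Z^2 + 2 t Z c + t^2\<close>. In \<open>Z'^2 - (m + t)^2\<close> the squares of
      \<open>t\<close> cancel, and \<open>Z c = m - \<theta>\<close> leaves the rate
      \<open>- 2 \<theta>\<close>; the other component of \<open>u\<close> only normalizes
      it.\<close>
    define c where "c = (m - \<theta>) / Z"
    have "\<bar>m - \<theta>\<bar> \<le> Z" using \<theta> Zm by linarith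
    then have "\<bar>c\<bar> \<le> 1" unfolding c_def abs_divide using Z by simp
    then have c: "c\<^sup>2 \<le> 1" using abs_square_le_1[of c] by blast
    define u where "u = Complex c (sqrt (1 - c\<^sup>2))"
    have "(cmod u)\<^sup>2 = 1" unfolding u_def cmod_power2 complex.sel using c by simp
    then have u: "cmod u = 1" by (metis norm_ge_zero power2_eq_iff_nonneg power_one zero_le_one)
    have below_t: "below \<bar>cmod (z + t *\<^sub>R (e * u)) - cmod (w + t *\<^sub>R f)\<bar> (cmod (z + t *\<^sub>R (e * u)) + cmod (w + t *\<^sub>R f))"
      if t: "\<bar>t\<bar> \<le> \<delta>" for t
    proof -
      define Z' where "Z' = cmod (z + t *\<^sub>R (e * u))"
      have "z + t *\<^sub>R (e * u) = e * (complex_of_real Z + t *\<^sub>R u)"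
        unfolding e(2) by (simp add: scaleR_conv_of_real algebra_simps)
      then have "Z' = cmod (complex_of_real Z + t *\<^sub>R u)" using e(1) by (simp add: Z'_def norm_mult)
      then have "Z'\<^sup>2 = (Z + t * c)\<^sup>2 + (t * sqrt (1 - c\<^sup>2))\<^sup>2" by (simp add: cmod_power2 u_def)
      also have "\<dots> = Z\<^sup>2 + 2 * t * (Z * c) + t\<^sup>2 * (c\<^sup>2 + (sqrt (1 - c\<^sup>2))\<^sup>2)"
        by (simp add: power2_eq_square algebra_simps)
      also have "(sqrt (1 - c\<^sup>2))\<^sup>2 = 1 - c\<^sup>2" using c by simp
      also have "Z * c = m - \<theta>" using Z by (simp add: c_def)
      finally have "Z'\<^sup>2 - (m + t)\<^sup>2 = Z\<^sup>2 - m\<^sup>2 - 2 * \<theta> * t" by (simp add: power2_eq_square algebra_simps)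
      then have "\<bar>m + t\<bar> \<le> Z' \<and> below (Z' - \<bar>m + t\<bar>) (Z' + \<bar>m + t\<bar>)"
        using \<theta>(3)[OF t, of Z'] by (simp add: Z'_def)
      then show ?thesis unfolding wt Z'_def[symmetric] by simp
    qed
    have "cmod (e * u) = 1" using e(1) u by (simp add: norm_mult)
    then show ?thesis by (rule that[OF _ f(1) below_t])
  qed
qed

text \<open>Exchanging the conformal and the anticonformal part preserves singular values and flips
  the sign of the determinant, so \<open>move_direction\<close> covers both signs.\<close>

lemma movable_away_from_E:
  assumes "0 < \<epsilon>"
  shows "\<exists>\<delta>>0. \<forall>A\<in>Uset. (\<forall>A'\<in>{A. (sv1 A, sv2 A) \<in> K}. \<epsilon> \<le> dist A A') \<longrightarrow> movable Uset \<delta> A"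
proof -
  define c where "c = 1 + 12 * B / x0"
  have c: "0 < c" using B_pos x0_pos by (simp add: c_def add_pos_pos)
  \<comment> \<open>The first two bounds are those of \<open>move_direction\<close>; the third makes
    distance \<epsilon> from \<open>E\<close> imply its condition on \<open>K\<close>.\<close>
  define \<delta> where "\<delta> = min (x0 / 8) (min (x0\<^sup>2 / (64 * B)) (\<epsilon> / (4 * c)))"
  have \<delta>: "0 < \<delta>" "\<delta> \<le> x0 / 8" using x0_pos B_pos c assms by (auto simp: \<delta>_def)
  have \<delta>2: "2 * B * \<delta> < x0\<^sup>2 / 16"
  proof -
    have "2 * B * \<delta> \<le> 2 * B * (x0\<^sup>2 / (64 * B))" using B_pos by (intro mult_left_mono) (auto simp: \<delta>_def)
    also have "\<dots> = x0\<^sup>2 / 32" using B_pos by (simp add: field_simps)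
    also have "\<dots> < x0\<^sup>2 / 16" using x0_pos by simp
    finally show ?thesis .
  qed
  have \<delta>c: "\<delta> * c < \<epsilon> / 2"
  proof -
    have "\<delta> * c \<le> \<epsilon> / (4 * c) * c" using c by (intro mult_right_mono) (auto simp: \<delta>_def)
    also have "\<dots> < \<epsilon> / 2" using c assms by simp
    finally show ?thesis .
  qed
  have "movable Uset (2 * \<delta>) A"
    if A: "A \<in> Uset" and away: "\<forall>A'\<in>{A. (sv1 A, sv2 A) \<in> K}. \<epsilon> \<le> dist A A'" for A
  proof -
    define z w where "z = cpart A" and "w = apart A"
    have bel: "below \<bar>cmod z - cmod w\<bar> (cmod z + cmod w)"
      using A unfolding Uset_def sv1_eq sv2_eq z_def w_def by simp
    \<comment> \<open>A point of \<open>E\<close> is built with the directions of \<open>z\<close>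
      and \<open>w\<close> but moduli \<open>r\<close> and \<open>s\<close>;
      \<open>norm_le_parts\<close> costs the factor 2.\<close>
    have dist_parts: "\<epsilon> / 2 \<le> \<bar>cmod z - r\<bar> + \<bar>cmod w - s\<bar>"
      if "0 \<le> r" "0 \<le> s" "(\<bar>r - s\<bar>, r + s) \<in> K" for r s
    proof -
      obtain e where e: "cmod e = 1" "z = cmod z *\<^sub>R e" using unit_direction[of z] by blast
      obtain f where f: "cmod f = 1" "w = cmod w *\<^sub>R f" using unit_direction[of w] by blast
      define A' where "A' = of_parts (r *\<^sub>R e) (s *\<^sub>R f)"
      have "sv1 A' = \<bar>r - s\<bar>" "sv2 A' = r + s"
        unfolding sv1_eq sv2_eq A'_def using e f that by simp_all
      then have "\<epsilon> \<le> norm (A - A')" using away that(3) by (auto simp: dist_norm)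
      also have "\<dots> \<le> 2 * (cmod (cpart (A - A')) + cmod (apart (A - A')))" by (rule norm_le_parts)
      also have "cpart (A - A') = (cmod z - r) *\<^sub>R e"
        using e(2) by (simp add: linear_diff[OF linear_parts(1)] z_def[symmetric] A'_def scaleR_left_diff_distrib)
      also have "apart (A - A') = (cmod w - s) *\<^sub>R f"
        using f(2) by (simp add: linear_diff[OF linear_parts(2)] w_def[symmetric] A'_def scaleR_left_diff_distrib)
      finally show ?thesis using e(1) f(1) by simp
    qed
    obtain p q where pq: "cmod p = 1" "cmod q = 1" "\<And>t. \<bar>t\<bar> \<le> \<delta> \<Longrightarrow>
        below \<bar>cmod (z + t *\<^sub>R p) - cmod (w + t *\<^sub>R q)\<bar> (cmod (z + t *\<^sub>R p) + cmod (w + t *\<^sub>R q))"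
    proof (cases "cmod w \<le> cmod z")
      case True
      have "\<delta> * (1 + 12 * B / x0) < \<bar>cmod z - (fst k + snd k) / 2\<bar> + \<bar>cmod w - (snd k - fst k) / 2\<bar>"
        if "k \<in> K" for k
      proof -
        obtain a b where k: "k = (a, b)" by (cases k)
        then have ab: "x0 \<le> a" "a \<le> b" using K_bounds'[OF that] by auto
        have "(a + b) / 2 - (b - a) / 2 = a" "(a + b) / 2 + (b - a) / 2 = b" by (simp_all add: field_simps)
        then have "\<epsilon> / 2 \<le> \<bar>cmod z - (a + b) / 2\<bar> + \<bar>cmod w - (b - a) / 2\<bar>"
          using ab x0_pos that k by (intro dist_parts) auto
        then show ?thesis using \<delta>c unfolding c_def k fst_conv snd_conv by linarith
      qed
      moreover have "below (cmod z - cmod w) (cmod z + cmod w)" using bel True by simp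
      ultimately show ?thesis using move_direction[OF True _ \<delta> \<delta>2] that by blast
    next
      case False
      then have le: "cmod z \<le> cmod w" by simp
      have "\<delta> * (1 + 12 * B / x0) < \<bar>cmod w - (fst k + snd k) / 2\<bar> + \<bar>cmod z - (snd k - fst k) / 2\<bar>"
        if "k \<in> K" for k
      proof -
        obtain a b where k: "k = (a, b)" by (cases k)
        then have ab: "x0 \<le> a" "a \<le> b" using K_bounds'[OF that] by auto
        have "(b - a) / 2 - (a + b) / 2 = - a" "(b - a) / 2 + (a + b) / 2 = b" by (simp_all add: field_simps)
        then have "\<epsilon> / 2 \<le> \<bar>cmod z - (b - a) / 2\<bar> + \<bar>cmod w - (a + b) / 2\<bar>"
          using ab x0_pos that k by (intro dist_parts) auto
        then show ?thesis using \<delta>c unfolding c_def k fst_conv snd_conv by linarith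
      qed
      moreover have "below (cmod w - cmod z) (cmod w + cmod z)"
        using bel le by (simp add: abs_minus_commute add.commute)
      ultimately obtain p q where "cmod p = 1" "cmod q = 1" "\<And>t. \<bar>t\<bar> \<le> \<delta> \<Longrightarrow>
          below \<bar>cmod (w + t *\<^sub>R p) - cmod (z + t *\<^sub>R q)\<bar> (cmod (w + t *\<^sub>R p) + cmod (z + t *\<^sub>R q))"
        using move_direction[OF le _ \<delta> \<delta>2] by blast
      then show ?thesis using that[of q p] by (simp add: abs_minus_commute add.commute)
    qed
    show ?thesis
    proof (rule movable_of_parts[OF pq(1,2)])
      show "0 \<le> \<delta>" using \<delta> by simp
      show "of_parts (cpart A + t *\<^sub>R p) (apart A + t *\<^sub>R q) \<in> Uset" if "\<bar>t\<bar> \<le> \<delta>" for t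
        using pq(3)[OF that] unfolding Uset_def sv1_eq sv2_eq z_def w_def by simp
    qed
  qed
  then show ?thesis using \<delta>(1) by (intro exI[of _ "2 * \<delta>"]) simp
qed

end

section \<open>The rank-one convex hull\<close>

text \<open>The coefficient of the quadratic term in \<open>t\<close> is a multiple of
  \<open>det (X - Y)\<close>, which vanishes for rank one.\<close>

lemma det_segment:
  fixes X Y :: "real^2^2"
  assumes "rank (X - Y) = 1"
  shows "det ((1 - t) *\<^sub>R X + t *\<^sub>R Y) = (1 - t) * det X + t * det Y"
proof -
  have "det (X - Y) = 0" using assms by (simp add: det_eq_0_rank)
  moreover have "det ((1 - t) *\<^sub>R X + t *\<^sub>R Y) = (1 - t) * det X + t * det Y - t * (1 - t) * det (X - Y)"
    by (simp add: det_2 algebra_simps)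
  ultimately show ?thesis by simp
qed

text \<open>Along rank-one segments the determinant is affine, so either sign of it may be added to
  a convex function. Used with \<open>\<sigma> = 1\<close> and \<open>apart\<close>, and with
  \<open>\<sigma> = -1\<close> and \<open>cpart\<close>.\<close>

lemma rank_one_convex_det_norm:
  fixes g :: "real^2^2 \<Rightarrow> complex"
  assumes "linear g" "0 \<le> \<theta>"
  shows "rank_one_convex (\<lambda>A. \<sigma> * det A + 2 * \<theta> * cmod (g A) - M)"
  unfolding rank_one_convex_def
proof (intro allI impI, elim conjE)
  fix X Y :: "real^2^2" and t :: real
  assume r: "rank (X - Y) = 1" and t: "0 \<le> t" "t \<le> 1"
  have "cmod (g ((1 - t) *\<^sub>R X + t *\<^sub>R Y)) = cmod ((1 - t) *\<^sub>R g X + t *\<^sub>R g Y)"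
    by (simp add: linear_add[OF assms(1)] linear_scale[OF assms(1)])
  also have "\<dots> \<le> (1 - t) * cmod (g X) + t * cmod (g Y)"
    using t by (intro order_trans[OF norm_triangle_ineq]) simp
  finally have "2 * \<theta> * cmod (g ((1 - t) *\<^sub>R X + t *\<^sub>R Y)) \<le> 2 * \<theta> * ((1 - t) * cmod (g X) + t * cmod (g Y))"
    using assms(2) by (intro mult_left_mono) auto
  then show "\<sigma> * det ((1 - t) *\<^sub>R X + t *\<^sub>R Y) + 2 * \<theta> * cmod (g ((1 - t) *\<^sub>R X + t *\<^sub>R Y)) - M
      \<le> (1 - t) * (\<sigma> * det X + 2 * \<theta> * cmod (g X) - M) + t * (\<sigma> * det Y + 2 * \<theta> * cmod (g Y) - M)"
    unfolding det_segment[OF r] by (simp add: algebra_simps)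
qed

context singular_value_set
begin

text \<open>For \<open>Q \<le> P\<close> the left side is \<open>val\<close> at the given point. For
  \<open>P < Q\<close>, the part of \<open>E\<close> with the other sign of the determinant, that
  point still suffices if \<open>\<theta> \<le> b\<close>; otherwise
  \<open>(\<theta> - a) * (\<theta> - b) \<ge> 0\<close> bounds the left side by
  \<open>\<theta>^2 \<le> \<theta> * B\<close>, and \<open>(c0, B)\<close> takes over.\<close>

lemma val_bound:
  assumes "(\<bar>P - Q\<bar>, P + Q) \<in> K" "maxi \<theta> k" "0 \<le> \<theta>" "\<theta> \<le> B" "0 \<le> P" "0 \<le> Q"
  shows "P\<^sup>2 - Q\<^sup>2 + 2 * \<theta> * Q \<le> val \<theta> k"
proof -
  have le: "val \<theta> (\<bar>P - Q\<bar>, P + Q) \<le> val \<theta> k" "val \<theta> (c0, B) \<le> val \<theta> k"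
    using assms(1,2) c0_in unfolding maxi_def by blast+
  show ?thesis
  proof (cases "Q \<le> P")
    case True
    then have "val \<theta> (\<bar>P - Q\<bar>, P + Q) = P\<^sup>2 - Q\<^sup>2 + 2 * \<theta> * Q"
      by (simp add: val_def power2_eq_square algebra_simps)
    then show ?thesis using le by simp
  next
    case False
    define a b where "a = Q - P" and "b = P + Q"
    have a: "0 \<le> a" "a \<le> b" using False assms by (auto simp: a_def b_def)
    have eq: "P\<^sup>2 - Q\<^sup>2 + 2 * \<theta> * Q = \<theta> * (a + b) - a * b"
      by (simp add: a_def b_def power2_eq_square algebra_simps)
    show ?thesis
    proof (cases "\<theta> \<le> b")
      case True
      then have "a * \<theta> \<le> a * b" using a by (intro mult_left_mono) auto
      moreover have "val \<theta> (\<bar>P - Q\<bar>, P + Q) = a * b + \<theta> * (b - a)"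
        using False by (simp add: val_def a_def b_def)
      ultimately show ?thesis using le(1) unfolding eq by (simp add: algebra_simps)
    next
      case False
      then have "0 \<le> (\<theta> - a) * (\<theta> - b)" using a by simp
      then have "\<theta> * (a + b) - a * b \<le> \<theta> * \<theta>" by (simp add: algebra_simps)
      also have "\<dots> \<le> \<theta> * B" using assms by (intro mult_left_mono) auto
      also have "\<dots> \<le> \<theta> * B + x0 * (B - \<theta>)" using assms x0_pos by simp
      also have "\<dots> \<le> val \<theta> (c0, B)" using val_c0 assms by blast
      finally show ?thesis using le(2) unfolding eq by simp
    qed
  qed
qed

lemma interior_hull_subset:
  assumes X: "X \<in> interior (rc_hull {A. (sv1 A, sv2 A) \<in> K})"
  shows "X \<in> Uset"
proof -
  obtain r where r: "0 < r" "ball X r \<subseteq> rc_hull {A. (sv1 A, sv2 A) \<in> K}"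
    using X unfolding mem_interior by blast
  define s where "s = r / (2 * (norm X + 1))"
  have n: "0 < norm X + 1" using norm_ge_zero[of X] by linarith
  have s: "0 < s" using r(1) n by (simp add: s_def)
  have "s * norm X < r"
  proof -
    have "s * norm X \<le> s * (norm X + 1)" using s by simp
    also have "\<dots> = r / 2" using n by (simp add: s_def field_simps)
    also have "\<dots> < r" using r(1) by simp
    finally show ?thesis .
  qed
  then have "(1 + s) *\<^sub>R X \<in> ball X r" using s by (simp add: dist_norm algebra_simps)
  then have hull: "(1 + s) *\<^sub>R X \<in> rc_hull {A. (sv1 A, sv2 A) \<in> K}" using r(2) by blast
  txt \<open>The rank-one convex functions only give the weak inequality; scaling by \<open>1 + s\<close> makes it strict.\<close>
  have strict: "P\<^sup>2 - Q\<^sup>2 + 2 * \<theta> * Q < val \<theta> k"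
    if "Q \<le> P" "0 \<le> Q" "maxi \<theta> k" "0 \<le> \<theta>" "((1 + s) * P)\<^sup>2 - ((1 + s) * Q)\<^sup>2 + 2 * \<theta> * ((1 + s) * Q) \<le> val \<theta> k"
    for P Q \<theta> k
  proof -
    define d where "d = P\<^sup>2 - Q\<^sup>2"
    have d: "0 \<le> d" using that by (simp add: d_def power_mono)
    have q: "0 \<le> 2 * \<theta> * Q" using that by simp
    have pos: "0 < val \<theta> k"
    proof -
      have k: "x0 \<le> fst k" "fst k \<le> snd k" using that(3) K_bounds'[of k] by (auto simp: maxi_def)
      then have "0 < fst k * snd k" using x0_pos by simp
      then show ?thesis using k that(4) by (simp add: val_def add_pos_nonneg)
    qed
    have "((1 + s) * P)\<^sup>2 - ((1 + s) * Q)\<^sup>2 + 2 * \<theta> * ((1 + s) * Q) = (1 + s) * ((d + 2 * \<theta> * Q) + s * d)"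
      by (simp add: d_def power2_eq_square algebra_simps)
    also have "\<dots> = (d + 2 * \<theta> * Q) + (s * d + s * ((d + 2 * \<theta> * Q) + s * d))"
      by (simp add: algebra_simps)
    finally have eq: "((1 + s) * P)\<^sup>2 - ((1 + s) * Q)\<^sup>2 + 2 * \<theta> * ((1 + s) * Q)
      = (d + 2 * \<theta> * Q) + (s * d + s * ((d + 2 * \<theta> * Q) + s * d))" .
    show ?thesis
    proof (cases "d + 2 * \<theta> * Q = 0")
      case True then show ?thesis using pos by (simp add: d_def)
    next
      case False
      then have "0 < d + 2 * \<theta> * Q" using d q by linarith
      moreover have "0 \<le> s * d" using s d by simp
      moreover from calculation have "0 < s * ((d + 2 * \<theta> * Q) + s * d)"
        by (intro mult_pos_pos[OF s]) linarith
      ultimately have "0 < s * d + s * ((d + 2 * \<theta> * Q) + s * d)" by linarith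
      then show ?thesis using that(5) eq by (simp add: d_def)
    qed
  qed
  define Z m where "Z = cmod (cpart X)" and "m = cmod (apart X)"
  have Zm: "0 \<le> Z" "0 \<le> m" by (simp_all add: Z_def m_def)
  have parts: "cmod (cpart ((1 + s) *\<^sub>R X)) = (1 + s) * Z" "cmod (apart ((1 + s) *\<^sub>R X)) = (1 + s) * m"
    using s by (simp_all add: parts_scaleR Z_def m_def)
  have "\<exists>k\<in>K. \<bar>Z - m\<bar> * (Z + m) + \<theta> * ((Z + m) - \<bar>Z - m\<bar>) < val \<theta> k" if \<theta>: "0 \<le> \<theta>" "\<theta> \<le> B" for \<theta>
  proof -
    obtain k where k: "maxi \<theta> k" using maxi_exists by blast
    have hullD: "f ((1 + s) *\<^sub>R X) \<le> 0" if "rank_one_convex f" "\<And>A. (sv1 A, sv2 A) \<in> K \<Longrightarrow> f A \<le> 0" for f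
      using hull that unfolding rc_hull_def by blast
    \<comment> \<open>The sign of the determinant of \<open>X\<close> decides which of the two
      families is used for the test.\<close>
    have "\<bar>Z - m\<bar> * (Z + m) + \<theta> * ((Z + m) - \<bar>Z - m\<bar>) < val \<theta> k"
    proof (cases "m \<le> Z")
      case True
      have "1 * det ((1 + s) *\<^sub>R X) + 2 * \<theta> * cmod (apart ((1 + s) *\<^sub>R X)) - val \<theta> k \<le> 0"
      proof (rule hullD[OF rank_one_convex_det_norm[OF linear_parts(2) \<theta>(1)]])
        fix A assume "(sv1 A, sv2 A) \<in> K"
        then show "1 * det A + 2 * \<theta> * cmod (apart A) - val \<theta> k \<le> 0"
          using val_bound[OF _ k \<theta>, of "cmod (cpart A)" "cmod (apart A)"] by (simp add: sv1_eq sv2_eq det_parts)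
      qed
      then have "((1 + s) * Z)\<^sup>2 - ((1 + s) * m)\<^sup>2 + 2 * \<theta> * ((1 + s) * m) \<le> val \<theta> k"
        unfolding det_parts parts by simp
      from strict[OF True Zm(2) k \<theta>(1) this] show ?thesis
        using True by (simp add: power2_eq_square algebra_simps)
    next
      case False
      then have le: "Z \<le> m" by simp
      have "(-1) * det ((1 + s) *\<^sub>R X) + 2 * \<theta> * cmod (cpart ((1 + s) *\<^sub>R X)) - val \<theta> k \<le> 0"
      proof (rule hullD[OF rank_one_convex_det_norm[OF linear_parts(1) \<theta>(1)]])
        fix A assume "(sv1 A, sv2 A) \<in> K"
        then show "(-1) * det A + 2 * \<theta> * cmod (cpart A) - val \<theta> k \<le> 0"
          using val_bound[OF _ k \<theta>, of "cmod (apart A)" "cmod (cpart A)"]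
          by (simp add: sv1_eq sv2_eq det_parts abs_minus_commute add.commute)
      qed
      then have "((1 + s) * m)\<^sup>2 - ((1 + s) * Z)\<^sup>2 + 2 * \<theta> * ((1 + s) * Z) \<le> val \<theta> k"
        unfolding det_parts parts by simp
      from strict[OF le Zm(1) k \<theta>(1) this] show ?thesis
        using le by (simp add: power2_eq_square algebra_simps)
    qed
    then show ?thesis using k unfolding maxi_def by blast
  qed
  then show ?thesis unfolding Uset_def below_def sv1_eq sv2_eq Z_def m_def by simp
qed

end

text \<open>The constant 1 is rank-one convex and vacuously admissible. This provides the point of
  \<open>K\<close> without which its extreme coordinates would not exist.\<close>

lemma rc_hull_empty: "rc_hull {} = {}"
proof -
  have "rank_one_convex (\<lambda>A. 1)" by (simp add: rank_one_convex_def)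
  then show ?thesis unfolding rc_hull_def by fastforce
qed

text \<open>Membership in \<open>\<phi>\<close> plus the Sobolev space with zero boundary values is
  expressed by a Lipschitz map of the plane that equals \<open>\<phi>\<close> off \<Omega>; the weak
  gradient of such a map is its pointwise derivative almost everywhere.\<close>

theorem theorem5p3:
  fixes \<Omega> :: "(real^2) set" and K :: "(real \<times> real) set" and E :: "(real^2^2) set"
    and xi :: "real^2^2" and b :: "real^2" and \<phi> :: "real^2 \<Rightarrow> real^2"
  assumes "open \<Omega>" and "bounded \<Omega>"
    and "compact K" and "K \<subseteq> {(x, y). 0 < x \<and> x \<le> y}"
    and "E = {A. (sv1 A, sv2 A) \<in> K}"
    and "xi \<in> interior (rc_hull E)"
    and "\<phi> = (\<lambda>x. xi *v x + b)"
  shows "\<exists>u :: real^2 \<Rightarrow> real^2.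
           (\<exists>C. C-lipschitz_on UNIV u) \<and>
           (\<forall>x. x \<notin> \<Omega> \<longrightarrow> u x = \<phi> x) \<and>
           (AE x in lebesgue. x \<in> \<Omega> \<longrightarrow>
              (\<exists>A\<in>E. (u has_derivative (\<lambda>h. A *v h)) (at x)))"
proof -
  have "K \<noteq> {}"
  proof
    assume "K = {}"
    then show False using assms(5,6) by (simp add: rc_hull_empty)
  qed
  \<comment> \<open>The two extreme coordinates may be attained at different points:
    \<open>k0\<close> supplies \<open>x0\<close>, and \<open>k1\<close> supplies
    \<open>(c0, B)\<close>.\<close>
  obtain k0 where k0: "k0 \<in> K" "\<And>k. k \<in> K \<Longrightarrow> fst k0 \<le> fst k"
    using continuous_attains_inf[OF assms(3) \<open>K \<noteq> {}\<close> continuous_on_fst[OF continuous_on_id]] by blast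
  obtain k1 where k1: "k1 \<in> K" "\<And>k. k \<in> K \<Longrightarrow> snd k \<le> snd k1"
    using continuous_attains_sup[OF assms(3) \<open>K \<noteq> {}\<close> continuous_on_snd[OF continuous_on_id]] by blast
  interpret singular_value_set K "snd k1" "fst k0" "fst k1"
  proof
    show "0 < fst k0" using k0(1) assms(4) by auto
    show "fst k0 \<le> a \<and> a \<le> b \<and> b \<le> snd k1" if "(a, b) \<in> K" for a b
      using k0(2)[OF that] k1(2)[OF that] that assms(4) by auto
    show "(fst k1, snd k1) \<in> K" using k1(1) by simp
  qed (rule assms(3))
  interpret gradient_inclusion \<Omega> Uset "2 * snd k1"
    using assms(1,2) open_Uset norm_Uset B_pos by unfold_locales auto
  have "closed E"
  proof -
    have "E = (\<lambda>A. (sv1 A, sv2 A)) -` K" using assms(5) by auto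
    moreover have "continuous_on UNIV (\<lambda>A. (sv1 A, sv2 A))" by (intro continuous_intros)
    ultimately show ?thesis using compact_imp_closed[OF assms(3)] by (simp add: closed_vimage)
  qed
  moreover have "xi \<in> Uset" using interior_hull_subset assms(5,6) by simp
  ultimately show ?thesis
    using inclusion_solvable[OF _ assms(7)] movable_away_from_E unfolding assms(5) by blast
qed

end
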